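(* Let $\mathbb{K}$ be a field with $\operatorname{char}\mathbb{K}\neq 2$, let $V$ be a $\mathbb{K}$-vector space with basis $v_1,\dots,v_n$, let $G\subset GL(V)$ be a finite group with $\operatorname{char}\mathbb{K}\nmid |G|$, let $\mathbf{q}=\{q_{ij}\}_{1\le i,j\le n}$ be nonzero elements of $\mathbb{K}$, and let $\kappa: V\times V\to \mathbb{K}G$ be a bilinear function with components $\kappa(v_i,v_j)=\sum_{g\in G}\kappa_g(v_i,v_j)\,g$, $\kappa_g(v_i,v_j)\in\mathbb{K}$. Then the algebra $\hat{\mathscr{H}}_{\mathbf{q},\kappa,1}$ is a truncated quantum Drinfeld Hecke algebra over $\mathbb{K}$ if and only if all of the following hold: (i) $G$ acts on $\Lambda_{\mathbf{q}}(V)$ by automorphisms and $q_{ij}=q_{ji}^{-1}$ for all $i\neq j$; (ii) $\kappa$ is a quantum 2-form; (iii) for all $h\in G$ and $1\le i<j<k\le n$, $$0=(q_{ik}q_{jk}\,{}^hv_k-v_k)\,\kappa_h(v_i,v_j)+(q_{jk}v_j-q_{ij}\,{}^hv_j)\,\kappa_h(v_i,v_k)+({}^hv_i-q_{ij}q_{ik}v_i)\,\kappa_h(v_j,v_k);$$ (iv) for all $g,h\in G$ and all $1\le r<s\le n$, $$\kappa_{h^{-1}gh}(v_r,v_s)=\sum_{i<j}\det{}_{rsij}(h)\,\kappa_g(v_i,v_j);$$ (v) for all $h\in G$ and $1\le i<j\le n$, $$0=q_{ij}v_i\,\kappa_h(v_i,v_j)+{}^hv_i\,\kappa_h(v_i,v_j)\quad\text{and}\quad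 0=q_{ij}\,{}^hv_j\,\kappa_h(v_i,v_j)+v_j\,\kappa_h(v_i,v_j);$$ (vi) for all $g,h\in G$ and all $1\le r\le n$, $$\sum_{i<j}g_i^r g_j^r\,\kappa_h(v_i,v_j)=0.$$
   Context: Notation: ${}^gv$ denotes the action of $g\in G$ on $v\in V$, and scalars $g_i^j\in\mathbb{K}$ are defined by ${}^gv_j=\sum_{i=1}^n g_i^j v_i$. The skew group algebra $A\rtimes G$ of an algebra $A$ with $G$-action is $A\otimes\mathbb{K}G$ as a vector space, with multiplication $(ag)(bh)=a({}^gb)gh$; $T(V)$ is the tensor algebra. The algebra $\hat{\mathscr{H}}_{\mathbf{q},\kappa,1}$ is the quotient of $T(V)\rtimes G$ by the two-sided ideal generated by $v_jv_i-q_{ij}v_iv_j-\kappa(v_i,v_j)$ and $v_i^2$ for all $i,j\in\{1,\dots,n\}$. It is called a truncated quantum Drinfeld Hecke algebra over $\mathbb{K}$ if it has a PBW basis, i.e. if the images of the elements $v_1^{\alpha_1}\cdots v_n^{\alpha_n}g$ ($\alpha_i\in\{0,1\}$, $g\in G$) form a $\mathbb{K}$-basis of it. The quantum exterior algebra is $\Lambda_{\mathbf{q}}(V)=\mathbb{K}\langle v_1,\dots,v_n\mid v_jv_i=q_{ij}v_iv_j \text{ for } i\neq j,\ v_i^2=0 \text{ for all } i\rangle$. "$G$ acts on $\Lambda_{\mathbf{q}}(V)$ by automorphisms" means that the linear action of each $g\in G$ on $V$ extends to an algebra automorphism of $\Lambda_{\mathbf{q}}(V)$. Quantum minor determinant: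 $\det_{ijkl}(g):=g_k^i g_l^j-q_{ij}g_l^i g_k^j$. $\kappa$ is a quantum 2-form if for all $i,j$: $\kappa(v_i,v_i)=0$ and $\kappa(v_j,v_i)=-q_{ij}^{-1}\kappa(v_i,v_j)$. *)

theory Defs
  imports Complex_Main "HOL-Library.Poly_Mapping" "HOL-Algebra.QuotRing" "HOL-Algebra.Module"
begin

text \<open>
  Algebras over the field \<open>'k\<close> are records of type \<^typ>\<open>('k, 'a) module\<close>: a ring together with a
  scalar multiplication. \<open>V\<close> is the type \<open>'v\<close> with scalar multiplication \<open>scale\<close>, and its basis
  \<open>v\<^sub>1, \<dots>, v\<^sub>n\<close> is a family indexed by a finite linearly ordered type \<open>'n\<close>.
\<close>

subsection \<open>Bases, the general linear group, matrix entries\<close>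

definition vs_basis :: "('k::field \<Rightarrow> 'v::ab_group_add \<Rightarrow> 'v) \<Rightarrow> ('n \<Rightarrow> 'v) \<Rightarrow> bool" where
  "vs_basis scale v \<longleftrightarrow>
     inj v \<and> \<not> Modules.module.dependent scale (range v) \<and> Modules.module.span scale (range v) = UNIV"

definition GL :: "('k::field \<Rightarrow> 'v::ab_group_add \<Rightarrow> 'v) \<Rightarrow> ('v \<Rightarrow> 'v) monoid" where
  "GL scale = \<lparr>carrier = {f. Vector_Spaces.linear scale scale f \<and> bij f}, mult = (\<circ>), one = id\<rparr>"

definition coord :: "('k::field \<Rightarrow> 'v::ab_group_add \<Rightarrow> 'v) \<Rightarrow> ('n \<Rightarrow> 'v) \<Rightarrow> 'v \<Rightarrow> 'n \<Rightarrow> 'k" where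
  "coord scale v x i = Modules.module.representation scale (range v) x (v i)"

text \<open>\<open>entry scale v g i j\<close> is the scalar \<open>g\<^sub>i\<^sup>j\<close>, with lower index \<open>i\<close> and upper index \<open>j\<close>:
  \<open>g v\<^sub>j = \<Sum>\<^sub>i g\<^sub>i\<^sup>j v\<^sub>i\<close>.\<close>

definition entry ::
  "('k::field \<Rightarrow> 'v::ab_group_add \<Rightarrow> 'v) \<Rightarrow> ('n \<Rightarrow> 'v) \<Rightarrow> ('v \<Rightarrow> 'v) \<Rightarrow> 'n \<Rightarrow> 'n \<Rightarrow> 'k" where
  "entry scale v g i j = coord scale v (g (v j)) i"

definition qdet ::
  "('k::field \<Rightarrow> 'v::ab_group_add \<Rightarrow> 'v) \<Rightarrow> ('n \<Rightarrow> 'v) \<Rightarrow> ('n \<Rightarrow> 'n \<Rightarrow> 'k) \<Rightarrow>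
    'n \<Rightarrow> 'n \<Rightarrow> 'n \<Rightarrow> 'n \<Rightarrow> ('v \<Rightarrow> 'v) \<Rightarrow> 'k" where
  "qdet scale v q i j k l g =
     entry scale v g k i * entry scale v g l j - q i j * entry scale v g l i * entry scale v g k j"

text \<open>Pointwise scalar multiplication of finitely supported functions.\<close>

definition pm_scale :: "'k::mult_zero \<Rightarrow> ('x \<Rightarrow>\<^sub>0 'k) \<Rightarrow> ('x \<Rightarrow>\<^sub>0 'k)" where
  "pm_scale c = Poly_Mapping.map ((*) c)"


subsection \<open>The free algebra on \<open>v\<^sub>1, \<dots>, v\<^sub>n\<close>, i.e. the tensor algebra of \<open>V\<close>\<close>

text \<open>
  Words in the index type form a monoid under concatenation, written additively because
  the convolution product on \<^typ>\<open>'a \<Rightarrow>\<^sub>0 'b\<close> is defined for additive monoids \<open>'a\<close>.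
\<close>

datatype 'n fmon = Fmon (letters: "'n list")

instantiation fmon :: (type) monoid_add
begin
definition zero_fmon :: "'n fmon" where "zero_fmon = Fmon []"
definition plus_fmon :: "'n fmon \<Rightarrow> 'n fmon \<Rightarrow> 'n fmon" where
  "plus_fmon x y = Fmon (letters x @ letters y)"
instance by standard (simp_all add: zero_fmon_def plus_fmon_def)
end

text \<open>
  The monoid algebra of the words is \<open>K\<langle>v\<^sub>1, \<dots>, v\<^sub>n\<rangle>\<close>. It also serves as \<open>T(V)\<close>: the word
  \<open>i\<^sub>1 \<dots> i\<^sub>d\<close> stands for the basis tensor \<open>v\<^bsub>i\<^sub>1\<^esub> \<otimes> \<dots> \<otimes> v\<^bsub>i\<^sub>d\<^esub>\<close>.
\<close>

type_synonym ('n, 'k) free_alg = "'n fmon \<Rightarrow>\<^sub>0 'k"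

definition gen :: "'n \<Rightarrow> ('n, 'k::field) free_alg" where
  "gen i = Poly_Mapping.single (Fmon [i]) 1"

text \<open>The inclusion of \<open>V\<close> in \<open>T(V)\<close>.\<close>

definition vec_incl ::
  "('k::field \<Rightarrow> 'v::ab_group_add \<Rightarrow> 'v) \<Rightarrow> ('n::finite \<Rightarrow> 'v) \<Rightarrow> 'v \<Rightarrow> ('n, 'k) free_alg" where
  "vec_incl scale v x = (\<Sum>i\<in>UNIV. pm_scale (coord scale v x i) (gen i))"

text \<open>The diagonal action on tensors: \<open>g\<close> maps \<open>v\<^bsub>i\<^sub>1\<^esub> \<otimes> \<dots> \<otimes> v\<^bsub>i\<^sub>d\<^esub>\<close> to \<open>g v\<^bsub>i\<^sub>1\<^esub> \<otimes> \<dots> \<otimes> g v\<^bsub>i\<^sub>d\<^esub>\<close>.\<close>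

definition tensor_act ::
  "('k::field \<Rightarrow> 'v::ab_group_add \<Rightarrow> 'v) \<Rightarrow> ('n::finite \<Rightarrow> 'v) \<Rightarrow> ('v \<Rightarrow> 'v) \<Rightarrow>
    ('n, 'k) free_alg \<Rightarrow> ('n, 'k) free_alg" where
  "tensor_act scale v g a =
     (\<Sum>w\<in>Poly_Mapping.keys a. pm_scale (Poly_Mapping.lookup a w)
        (prod_list (map (\<lambda>i. vec_incl scale v (g (v i))) (letters w))))"


subsection \<open>Skew group algebras, quotient algebras, bases of algebras\<close>

text \<open>
  \<open>A \<rtimes> G\<close> for an algebra \<open>A\<close> (a type with scalar multiplication \<open>sc\<close>) on which the group \<open>G\<close> acts
  by \<open>act\<close>. An element \<open>\<Sum>\<^sub>g a\<^sub>g g\<close> of \<open>A \<otimes> KG\<close> is the finitely supported function \<open>g \<mapsto> a\<^sub>g\<close>,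
  so that \<open>a g\<close> is \<open>Poly_Mapping.single g a\<close>.
\<close>

definition skew_group_algebra ::
  "('k \<Rightarrow> 'a \<Rightarrow> 'a::ring_1) \<Rightarrow> ('g \<Rightarrow> 'a \<Rightarrow> 'a) \<Rightarrow> 'g monoid \<Rightarrow> ('k, 'g \<Rightarrow>\<^sub>0 'a) module" where
  "skew_group_algebra sc act G =
     \<lparr>carrier = {x. Poly_Mapping.keys x \<subseteq> carrier G},
      mult = (\<lambda>x y. \<Sum>g\<in>Poly_Mapping.keys x. \<Sum>h\<in>Poly_Mapping.keys y.
                Poly_Mapping.single (g \<otimes>\<^bsub>G\<^esub> h)
                  (Poly_Mapping.lookup x g * act g (Poly_Mapping.lookup y h))),
      one = Poly_Mapping.single \<one>\<^bsub>G\<^esub> 1,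
      zero = 0,
      add = (+),
      smult = (\<lambda>c. Poly_Mapping.map (sc c))\<rparr>"

definition quot_algebra :: "('k, 'a) module \<Rightarrow> 'a set \<Rightarrow> ('k, 'a set) module" where
  "quot_algebra A I =
     \<lparr>carrier = carrier (A Quot I), mult = mult (A Quot I), one = one (A Quot I),
      zero = zero (A Quot I), add = add (A Quot I),
      smult = (\<lambda>c X. \<Union>x\<in>X. I +>\<^bsub>A\<^esub> (c \<odot>\<^bsub>A\<^esub> x))\<rparr>"

text \<open>The family \<open>(x b)\<close>, \<open>b \<in> B\<close>, is a basis of \<open>M\<close> (only finite families occur below).\<close>

definition finite_basis :: "('k::field, 'a) module \<Rightarrow> ('b \<Rightarrow> 'a) \<Rightarrow> 'b set \<Rightarrow> bool" where
  "finite_basis M x B \<longleftrightarrow>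
     finite B \<and> x ` B \<subseteq> carrier M \<and>
     (\<forall>a\<in>carrier M. \<exists>c. a = (\<Oplus>\<^bsub>M\<^esub>b\<in>B. c b \<odot>\<^bsub>M\<^esub> x b)) \<and>
     (\<forall>c. (\<Oplus>\<^bsub>M\<^esub>b\<in>B. c b \<odot>\<^bsub>M\<^esub> x b) = \<zero>\<^bsub>M\<^esub> \<longrightarrow> (\<forall>b\<in>B. c b = 0))"

definition algebra_automorphisms :: "('k, 'a) module \<Rightarrow> ('a \<Rightarrow> 'a) set" where
  "algebra_automorphisms A =
     {\<phi> \<in> ring_iso A A. \<forall>c. \<forall>x\<in>carrier A. \<phi> (c \<odot>\<^bsub>A\<^esub> x) = c \<odot>\<^bsub>A\<^esub> \<phi> x}"


subsection \<open>The quantum exterior algebra\<close>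

definition free_algebra :: "('k::field, ('n, 'k) free_alg) module" where
  "free_algebra =
     \<lparr>carrier = UNIV, mult = (*), one = 1, zero = 0, add = (+), smult = pm_scale\<rparr>"

definition qext_ideal :: "('n \<Rightarrow> 'n \<Rightarrow> 'k::field) \<Rightarrow> ('n, 'k) free_alg set" where
  "qext_ideal q = Idl\<^bsub>free_algebra\<^esub>
     ({gen j * gen i - pm_scale (q i j) (gen i * gen j) | i j. i \<noteq> j} \<union> {gen i * gen i | i. True})"

definition quantum_exterior_algebra ::
  "('n \<Rightarrow> 'n \<Rightarrow> 'k::field) \<Rightarrow> ('k, ('n, 'k) free_alg set) module" where
  "quantum_exterior_algebra q = quot_algebra free_algebra (qext_ideal q)"

definition qext_vec ::
  "('k::field \<Rightarrow> 'v::ab_group_add \<Rightarrow> 'v) \<Rightarrow> ('n::finite \<Rightarrow> 'v) \<Rightarrow> ('n \<Rightarrow> 'n \<Rightarrow> 'k) \<Rightarrow>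
    'v \<Rightarrow> ('n, 'k) free_alg set" where
  "qext_vec scale v q x = qext_ideal q +>\<^bsub>free_algebra\<^esub> vec_incl scale v x"

definition acts_on_qext_by_automorphisms ::
  "('k::field \<Rightarrow> 'v::ab_group_add \<Rightarrow> 'v) \<Rightarrow> ('n::finite \<Rightarrow> 'v) \<Rightarrow> ('n \<Rightarrow> 'n \<Rightarrow> 'k) \<Rightarrow>
    ('v \<Rightarrow> 'v) set \<Rightarrow> bool" where
  "acts_on_qext_by_automorphisms scale v q G \<longleftrightarrow>
     (\<forall>g\<in>G. \<exists>\<phi>\<in>algebra_automorphisms (quantum_exterior_algebra q).
        \<forall>x. \<phi> (qext_vec scale v q x) = qext_vec scale v q (g x))"


subsection \<open>Truncated quantum Drinfeld Hecke algebras\<close>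

text \<open>
  The group algebra \<open>KG\<close> consists of the finitely supported functions \<open>('v \<Rightarrow> 'v) \<Rightarrow>\<^sub>0 'k\<close> with
  support in \<open>G\<close>. The component \<open>\<kappa>\<^sub>g(v\<^sub>i, v\<^sub>j)\<close> is \<open>form_comp v \<kappa> g i j\<close>.
\<close>

definition form_comp ::
  "('n \<Rightarrow> 'v) \<Rightarrow> ('v \<Rightarrow> 'v \<Rightarrow> ('v \<Rightarrow> 'v) \<Rightarrow>\<^sub>0 'k::field) \<Rightarrow> ('v \<Rightarrow> 'v) \<Rightarrow> 'n \<Rightarrow> 'n \<Rightarrow> 'k" where
  "form_comp v \<kappa> g i j = Poly_Mapping.lookup (\<kappa> (v i) (v j)) g"

definition bilinear_into_group_algebra ::
  "('k::field \<Rightarrow> 'v::ab_group_add \<Rightarrow> 'v) \<Rightarrow> ('v \<Rightarrow> 'v) set \<Rightarrow>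
    ('v \<Rightarrow> 'v \<Rightarrow> ('v \<Rightarrow> 'v) \<Rightarrow>\<^sub>0 'k) \<Rightarrow> bool" where
  "bilinear_into_group_algebra scale G \<kappa> \<longleftrightarrow>
     (\<forall>x y. Poly_Mapping.keys (\<kappa> x y) \<subseteq> G) \<and>
     (\<forall>x. Vector_Spaces.linear scale pm_scale (\<lambda>y. \<kappa> x y)) \<and>
     (\<forall>y. Vector_Spaces.linear scale pm_scale (\<lambda>x. \<kappa> x y))"

definition quantum_2_form ::
  "('n \<Rightarrow> 'v) \<Rightarrow> ('n \<Rightarrow> 'n \<Rightarrow> 'k::field) \<Rightarrow> ('v \<Rightarrow> 'v \<Rightarrow> ('v \<Rightarrow> 'v) \<Rightarrow>\<^sub>0 'k) \<Rightarrow> bool" where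
  "quantum_2_form v q \<kappa> \<longleftrightarrow>
     (\<forall>i j. \<kappa> (v i) (v i) = 0 \<and> \<kappa> (v j) (v i) = pm_scale (- inverse (q i j)) (\<kappa> (v i) (v j)))"

definition tensor_skew ::
  "('k::field \<Rightarrow> 'v::ab_group_add \<Rightarrow> 'v) \<Rightarrow> ('n::finite \<Rightarrow> 'v) \<Rightarrow> ('v \<Rightarrow> 'v) set \<Rightarrow>
    ('k, ('v \<Rightarrow> 'v) \<Rightarrow>\<^sub>0 ('n, 'k) free_alg) module" where
  "tensor_skew scale v G =
     skew_group_algebra pm_scale (tensor_act scale v) (GL scale\<lparr>carrier := G\<rparr>)"

text \<open>The inclusions of \<open>T(V)\<close> and \<open>KG\<close> in \<open>T(V) \<rtimes> G\<close>.\<close>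

definition of_tensor :: "('n, 'k::field) free_alg \<Rightarrow> ('v \<Rightarrow> 'v) \<Rightarrow>\<^sub>0 ('n, 'k) free_alg" where
  "of_tensor a = Poly_Mapping.single id a"

definition of_group_algebra ::
  "(('v \<Rightarrow> 'v) \<Rightarrow>\<^sub>0 'k::field) \<Rightarrow> ('v \<Rightarrow> 'v) \<Rightarrow>\<^sub>0 ('n, 'k) free_alg" where
  "of_group_algebra = Poly_Mapping.map (\<lambda>c. pm_scale c 1)"

definition tqdh_ideal ::
  "('k::field \<Rightarrow> 'v::ab_group_add \<Rightarrow> 'v) \<Rightarrow> ('n::finite \<Rightarrow> 'v) \<Rightarrow> ('v \<Rightarrow> 'v) set \<Rightarrow>
    ('n \<Rightarrow> 'n \<Rightarrow> 'k) \<Rightarrow> ('v \<Rightarrow> 'v \<Rightarrow> ('v \<Rightarrow> 'v) \<Rightarrow>\<^sub>0 'k) \<Rightarrow>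
    (('v \<Rightarrow> 'v) \<Rightarrow>\<^sub>0 ('n, 'k) free_alg) set" where
  "tqdh_ideal scale v G q \<kappa> = Idl\<^bsub>tensor_skew scale v G\<^esub>
     ({of_tensor (gen j * gen i - pm_scale (q i j) (gen i * gen j))
         - of_group_algebra (\<kappa> (v i) (v j)) | i j. True}
      \<union> {of_tensor (gen i * gen i) | i. True})"

definition tqdh_quotient ::
  "('k::field \<Rightarrow> 'v::ab_group_add \<Rightarrow> 'v) \<Rightarrow> ('n::finite \<Rightarrow> 'v) \<Rightarrow> ('v \<Rightarrow> 'v) set \<Rightarrow>
    ('n \<Rightarrow> 'n \<Rightarrow> 'k) \<Rightarrow> ('v \<Rightarrow> 'v \<Rightarrow> ('v \<Rightarrow> 'v) \<Rightarrow>\<^sub>0 'k) \<Rightarrow>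
    ('k, (('v \<Rightarrow> 'v) \<Rightarrow>\<^sub>0 ('n, 'k) free_alg) set) module" where
  "tqdh_quotient scale v G q \<kappa> =
     quot_algebra (tensor_skew scale v G) (tqdh_ideal scale v G q \<kappa>)"

text \<open>\<open>v\<^sub>1\<^bsup>\<alpha>\<^sub>1\<^esup> \<cdots> v\<^sub>n\<^bsup>\<alpha>\<^sub>n\<^esup>\<close>, the factors in increasing order of the indices.\<close>

definition ordered_monomial ::
  "('n::{finite,linorder} \<Rightarrow> nat) \<Rightarrow> ('n, 'k::field) free_alg" where
  "ordered_monomial \<alpha> = prod_list (map (\<lambda>i. gen i ^ \<alpha> i) (sorted_list_of_set UNIV))"

definition truncated_quantum_drinfeld_hecke ::
  "('k::field \<Rightarrow> 'v::ab_group_add \<Rightarrow> 'v) \<Rightarrow> ('n::{finite,linorder} \<Rightarrow> 'v) \<Rightarrow> ('v \<Rightarrow> 'v) set \<Rightarrow>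
    ('n \<Rightarrow> 'n \<Rightarrow> 'k) \<Rightarrow> ('v \<Rightarrow> 'v \<Rightarrow> ('v \<Rightarrow> 'v) \<Rightarrow>\<^sub>0 'k) \<Rightarrow> bool" where
  "truncated_quantum_drinfeld_hecke scale v G q \<kappa> \<longleftrightarrow>
     finite_basis (tqdh_quotient scale v G q \<kappa>)
       (\<lambda>(\<alpha>, g). tqdh_ideal scale v G q \<kappa>
           +>\<^bsub>tensor_skew scale v G\<^esub> Poly_Mapping.single g (ordered_monomial \<alpha>))
       ({\<alpha>. \<forall>i. \<alpha> i \<in> {0, 1}} \<times> G)"

end

theory Submission
  imports Defs
begin

text \<open>
  The relations of the algebra are rewriting rules \<open>v\<^sub>j v\<^sub>i \<leadsto> q\<^sub>i\<^sub>j v\<^sub>i v\<^sub>j + \<kappa>(v\<^sub>i, v\<^sub>j)\<close> for \<open>i < j\<close> and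
  \<open>v\<^sub>i v\<^sub>i \<leadsto> 0\<close> on the vector space with basis \<open>(w, g)\<close>, \<open>w\<close> a word and \<open>g\<close> a group element;
  they decrease words in the length-lexicographic order, and the irreducible words are the strictly
  increasing ones. So the PBW property says that the ideal contains no nonzero combination of
  irreducible elements. Conjugating a relation by \<open>h \<in> G\<close>, and resolving the overlaps
  \<open>v\<^sub>k v\<^sub>j v\<^sub>i\<close>, \<open>v\<^sub>j v\<^sub>j v\<^sub>i\<close>, \<open>v\<^sub>j v\<^sub>i v\<^sub>i\<close> in two ways, yields elements of the ideal that are
  irreducible; their coefficients are the expressions in the theorem, so these must vanish. Conversely,
  when they vanish all ambiguities are resolvable, and the diamond lemma applies: for every irreducible
  element there is a linear functional that kills the ideal and is dual to that element.
\<close>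

text \<open>The group is what separates this from rewriting on words. Reducing
  \<open>v_j v_i\<close> creates group elements inside a word; they are moved to its right end at
  once, which turns every letter they pass into a combination of all letters. Such terms are two
  letters shorter, so a length-first order absorbs them, and the group component can stay out of the
  order. Moreover, reductions at disjoint places no longer commute for free: a group element made by
  the left one has to cross the right one. This, and the closure of the relations under left
  multiplication by group elements, rests on one fact: \<open>h\<close> times a relation is a
  combination of relations times \<open>h\<close>. It has two obstructions. The quadratic one
  amounts to the action on the quantum exterior algebra, which matters only through degree-two
  coefficients (\<open>preserves_qext\<close>); the one in the group algebra yields the quantum
  minors and the sums over \<open>g_i^r g_j^r\<close>. Finally, the ideal has generators
  \<open>relator i j\<close> for all pairs, also with \<open>i \<ge> j\<close>. Comparing these with
  the rules is what forces \<open>q\<close> to be symmetric and \<open>\<kappa>\<close> to be a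
  quantum 2-form.\<close>

lemma lookup_pm_scale [simp]: "Poly_Mapping.lookup (pm_scale c a) w = c * Poly_Mapping.lookup a w"
  by (simp add: pm_scale_def map.rep_eq when_def)

lemma lookup_map_zero:
  "f 0 = 0 \<Longrightarrow> Poly_Mapping.lookup (Poly_Mapping.map f p) k = f (Poly_Mapping.lookup p k)"
  by (auto simp: map.rep_eq when_def)

lemma pm_scale_single [simp]: "pm_scale c (Poly_Mapping.single w d) = Poly_Mapping.single w (c * d)"
  by (simp add: pm_scale_def)

lemma vector_space_pm_scale:
  "vector_space (pm_scale :: 'k::field \<Rightarrow> ('x \<Rightarrow>\<^sub>0 'k) \<Rightarrow> ('x \<Rightarrow>\<^sub>0 'k))"
  by unfold_locales (auto intro!: poly_mapping_eqI simp: lookup_add algebra_simps)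

interpretation pm: vector_space "pm_scale :: 'k::field \<Rightarrow> ('x \<Rightarrow>\<^sub>0 'k) \<Rightarrow> ('x \<Rightarrow>\<^sub>0 'k)"
  by (rule vector_space_pm_scale)

lemma poly_mapping_sum_single:
  assumes "finite A" "Poly_Mapping.keys p \<subseteq> A"
  shows "(\<Sum>k\<in>A. Poly_Mapping.single k (Poly_Mapping.lookup p k)) = p"
proof (rule poly_mapping_eqI)
  fix x
  have "(\<Sum>k\<in>A. Poly_Mapping.lookup p k when k = x) = Poly_Mapping.lookup p x"
    using assms by (auto simp: when_def sum.delta' in_keys_iff subset_eq)
  then show "Poly_Mapping.lookup (\<Sum>k\<in>A. Poly_Mapping.single k (Poly_Mapping.lookup p k)) x
      = Poly_Mapping.lookup p x"
    by (simp add: lookup_sum lookup_single)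
qed

text \<open>Additive identities reduce to monomials, with no condition on the supports of the
  summands. Zero needs no case of its own, being a monomial with coefficient 0.\<close>

lemma poly_mapping_additive_induct [case_names single add]:
  fixes p :: "'x \<Rightarrow>\<^sub>0 'b::comm_monoid_add"
  assumes single: "\<And>k b. P (Poly_Mapping.single k b)" and add: "\<And>p q. P p \<Longrightarrow> P q \<Longrightarrow> P (p + q)"
  shows "P p"
proof -
  have "P (\<Sum>k\<in>A. Poly_Mapping.single k (Poly_Mapping.lookup p k))" if "finite A" for A
    using that
  proof induction
    case empty
    show ?case using single[of undefined 0] by simp
  qed (simp add: single add)
  from this[of "Poly_Mapping.keys p"] show ?thesis
    by (simp add: poly_mapping_sum_single)
qed

section \<open>The free algebra in terms of words\<close>

definition word_elem :: "'n list \<Rightarrow> ('n, 'k::field) free_alg" where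
  "word_elem w = Poly_Mapping.single (Fmon w) 1"

lemma word_elem_mult [simp]: "word_elem w * word_elem w' = word_elem (w @ w')"
  by (simp add: word_elem_def mult_single plus_fmon_def)

lemma word_elem_Nil: "word_elem [] = 1"
  by (simp add: word_elem_def zero_fmon_def[symmetric])

lemma gen_eq_word_elem: "gen i = word_elem [i]"
  by (simp add: gen_def word_elem_def)

lemma single_eq_word_elem: "Poly_Mapping.single w c = pm_scale c (word_elem (letters w))"
  by (simp add: word_elem_def)

lemma lookup_word_elem: "Poly_Mapping.lookup (word_elem w) x = (if letters x = w then 1 else 0)"
  by (cases x) (auto simp: word_elem_def lookup_single when_def)

lemma free_alg_induct [case_names word add]:
  fixes a :: "('n, 'k::field) free_alg"
  assumes "\<And>c w. P (pm_scale c (word_elem w))" and "\<And>a b. P a \<Longrightarrow> P b \<Longrightarrow> P (a + b)"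
  shows "P a"
  using assms by (induction a rule: poly_mapping_additive_induct) (auto simp: single_eq_word_elem)

lemma pm_scale_mult_left [simp]:
  fixes a b :: "('n, 'k::field) free_alg"
  shows "pm_scale c a * b = pm_scale c (a * b)"
  by (simp add: pm_scale_def mult_map_scale_conv_mult mult.assoc)

lemma pm_scale_mult_right [simp]:
  fixes a b :: "('n, 'k::field) free_alg"
  shows "a * pm_scale c b = pm_scale c (a * b)"
proof (induction a rule: free_alg_induct)
  case (word d w)
  show ?case
  proof (induction b rule: free_alg_induct)
    case (word e x)
    have "word_elem w * pm_scale (c * e) (word_elem x) = pm_scale (c * e) (word_elem w * word_elem x :: ('n, 'k) free_alg)" for c e
      by (simp add: word_elem_def mult_single mult.commute)
    from this[of c e] this[of 1 e] show ?case by (simp add: mult_ac)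
  next
    case (add a b)
    then show ?case by (simp add: distrib_left pm.scale_right_distrib)
  qed
next
  case (add a b)
  then show ?case by (simp add: distrib_right pm.scale_right_distrib)
qed

text \<open>By bilinearity both factors may be taken to be words, and \<open>x @ y\<close> is cut
  into \<open>x\<close> and \<open>y\<close> at the single position \<open>length x\<close>.\<close>

lemma lookup_free_alg_mult:
  fixes a b :: "('n, 'k::field) free_alg"
  shows "Poly_Mapping.lookup (a * b) (Fmon w)
    = (\<Sum>k\<le>length w. Poly_Mapping.lookup a (Fmon (take k w)) * Poly_Mapping.lookup b (Fmon (drop k w)))"
proof (induction a rule: free_alg_induct)
  case (word c x)
  show ?case
  proof (induction b rule: free_alg_induct)
    case (word d y)
    have *: "take k w = x \<and> drop k w = y \<longleftrightarrow> k = length x \<and> w = x @ y" if "k \<le> length w" for k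
      using that by (metis append_take_drop_id append_eq_conv_conj length_take min.absorb2)
    have "(if take k w = x then 1 else 0) * (if drop k w = y then 1 else (0::'k))
        = (if k = length x then (if w = x @ y then 1 else 0) else 0)" if "k \<le> length w" for k
      using *[OF that] by (cases "take k w = x"; cases "drop k w = y") simp_all
    then have "(\<Sum>k\<le>length w. (if take k w = x then 1 else 0) * (if drop k w = y then 1 else (0::'k)))
        = (\<Sum>k\<le>length w. if k = length x then (if w = x @ y then 1 else 0) else 0)"
      by (intro sum.cong) simp_all
    also have "\<dots> = (if w = x @ y then 1 else 0)"
      by (auto simp: sum.delta')
    finally have *: "(if w = x @ y then 1 else (0::'k))
        = (\<Sum>k\<le>length w. (if take k w = x then 1 else 0) * (if drop k w = y then 1 else (0::'k)))" ..
    have "Poly_Mapping.lookup (pm_scale c (word_elem x) * pm_scale d (word_elem y)) (Fmon w)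
       = c * d * (if w = x @ y then 1 else (0::'k))"
      by (simp add: lookup_word_elem)
    also have "\<dots> = (\<Sum>k\<le>length w. Poly_Mapping.lookup (pm_scale c (word_elem x)) (Fmon (take k w))
        * Poly_Mapping.lookup (pm_scale d (word_elem y)) (Fmon (drop k w)))"
      unfolding * by (simp only: lookup_pm_scale lookup_word_elem fmon.sel sum_distrib_left mult_ac)
    finally show ?case .
  next
    case (add a b)
    then show ?case by (simp add: distrib_left lookup_add sum.distrib)
  qed
next
  case (add a b)
  then show ?case by (simp add: distrib_right lookup_add sum.distrib)
qed

section \<open>The diagonal action on tensors\<close>

context
  fixes scale :: "'k::field \<Rightarrow> 'v::ab_group_add \<Rightarrow> 'v" and v :: "'n::finite \<Rightarrow> 'v"
begin

text \<open>The definition sums over the support of its argument. Passing to a larger finite set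
  lets several elements share one index set, which is how additivity is obtained.\<close>

lemma tensor_act_superset:
  assumes "finite A" "Poly_Mapping.keys a \<subseteq> A"
  shows "tensor_act scale v g a = (\<Sum>w\<in>A. pm_scale (Poly_Mapping.lookup a w)
        (prod_list (map (\<lambda>i. vec_incl scale v (g (v i))) (letters w))))"
  unfolding tensor_act_def using assms
  by (intro sum.mono_neutral_left) (auto simp: in_keys_iff)

lemma tensor_act_add: "tensor_act scale v g (a + b) = tensor_act scale v g a + tensor_act scale v g b"
proof -
  let ?A = "Poly_Mapping.keys a \<union> Poly_Mapping.keys b"
  show ?thesis
    using tensor_act_superset[of ?A a g] tensor_act_superset[of ?A b g]
      tensor_act_superset[of ?A "a + b" g] Poly_Mapping.keys_add[of a b]
    by (simp add: lookup_add pm.scale_left_distrib sum.distrib)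
qed

lemma tensor_act_scale: "tensor_act scale v g (pm_scale c a) = pm_scale c (tensor_act scale v g a)"
proof -
  have "Poly_Mapping.keys (pm_scale c a) \<subseteq> Poly_Mapping.keys a"
    by (auto simp: in_keys_iff)
  then show ?thesis
    using tensor_act_superset[of "Poly_Mapping.keys a" a g]
      tensor_act_superset[of "Poly_Mapping.keys a" "pm_scale c a" g]
    by (simp add: pm.scale_sum_right)
qed

lemma tensor_act_word_elem:
  "tensor_act scale v g (word_elem w) = prod_list (map (\<lambda>i. vec_incl scale v (g (v i))) w)"
  using tensor_act_superset[of "{Fmon w}" "word_elem w" g] by (simp add: word_elem_def)

lemma tensor_act_zero [simp]: "tensor_act scale v g 0 = 0"
  by (simp add: tensor_act_def)

lemma tensor_act_one [simp]: "tensor_act scale v g 1 = 1"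
  using tensor_act_word_elem[of g "[]"] by (simp add: word_elem_Nil)

lemma tensor_act_mult: "tensor_act scale v g (a * b) = tensor_act scale v g a * tensor_act scale v g b"
proof (induction a rule: free_alg_induct)
  case (word c x)
  show ?case
  proof (induction b rule: free_alg_induct)
    case (add a b)
    then show ?case by (simp add: distrib_left tensor_act_add pm.scale_right_distrib)
  qed (simp add: tensor_act_scale tensor_act_word_elem)
next
  case (add a b)
  then show ?case by (simp add: distrib_right tensor_act_add)
qed

lemma tensor_act_gen: "tensor_act scale v g (gen i) = vec_incl scale v (g (v i))"
  by (simp add: gen_eq_word_elem tensor_act_word_elem)

end

lemma tensor_act_uminus: "tensor_act scale v g (- a) = - tensor_act scale v g a"
  using tensor_act_add[of scale v g a "- a"] by (simp add: eq_neg_iff_add_eq_0 add.commute)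

lemma tensor_act_diff: "tensor_act scale v g (a - b) = tensor_act scale v g a - tensor_act scale v g b"
  using tensor_act_add[of scale v g a "- b"] by (simp add: tensor_act_uminus)

lemma tensor_act_sum: "tensor_act scale v g (sum f A) = (\<Sum>x\<in>A. tensor_act scale v g (f x))"
  by (induction A rule: infinite_finite_induct) (simp_all add: tensor_act_add)

text \<open>The multiplication of \<^const>\<open>tensor_skew\<close>, which does not depend on \<open>G\<close>: this makes it
  biadditive without carrier conditions.\<close>

definition skew_mult ::
  "('k::field \<Rightarrow> 'v::ab_group_add \<Rightarrow> 'v) \<Rightarrow> ('n::finite \<Rightarrow> 'v) \<Rightarrow>
    (('v \<Rightarrow> 'v) \<Rightarrow>\<^sub>0 ('n, 'k) free_alg) \<Rightarrow> (('v \<Rightarrow> 'v) \<Rightarrow>\<^sub>0 ('n, 'k) free_alg) \<Rightarrow>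
    (('v \<Rightarrow> 'v) \<Rightarrow>\<^sub>0 ('n, 'k) free_alg)" where
  "skew_mult scale v x y = (\<Sum>g\<in>Poly_Mapping.keys x. \<Sum>h\<in>Poly_Mapping.keys y.
     Poly_Mapping.single (g \<circ> h) (Poly_Mapping.lookup x g * tensor_act scale v g (Poly_Mapping.lookup y h)))"

definition skew_scale :: "'k::field \<Rightarrow> ('g \<Rightarrow>\<^sub>0 ('n, 'k) free_alg) \<Rightarrow> ('g \<Rightarrow>\<^sub>0 ('n, 'k) free_alg)" where
  "skew_scale c = Poly_Mapping.map (pm_scale c)"

lemma lookup_skew_scale [simp]: "Poly_Mapping.lookup (skew_scale c u) g = pm_scale c (Poly_Mapping.lookup u g)"
  by (simp add: skew_scale_def lookup_map_zero)

lemma skew_scale_single [simp]: "skew_scale c (Poly_Mapping.single g a) = Poly_Mapping.single g (pm_scale c a)"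
  by (simp add: skew_scale_def)

interpretation skew_scale: vector_space "skew_scale :: 'k::field \<Rightarrow> ('g \<Rightarrow>\<^sub>0 ('n, 'k) free_alg) \<Rightarrow> _"
  by unfold_locales (auto intro!: poly_mapping_eqI simp: lookup_add algebra_simps)

context
  fixes scale :: "'k::field \<Rightarrow> 'v::ab_group_add \<Rightarrow> 'v" and v :: "'n::finite \<Rightarrow> 'v"
begin

lemma skew_mult_superset:
  assumes "finite A" "Poly_Mapping.keys x \<subseteq> A" "finite B" "Poly_Mapping.keys y \<subseteq> B"
  shows "skew_mult scale v x y = (\<Sum>g\<in>A. \<Sum>h\<in>B. Poly_Mapping.single (g \<circ> h)
     (Poly_Mapping.lookup x g * tensor_act scale v g (Poly_Mapping.lookup y h)))"
proof -
  have "skew_mult scale v x y = (\<Sum>g\<in>A. \<Sum>h\<in>Poly_Mapping.keys y. Poly_Mapping.single (g \<circ> h)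
     (Poly_Mapping.lookup x g * tensor_act scale v g (Poly_Mapping.lookup y h)))"
    unfolding skew_mult_def using assms
    by (intro sum.mono_neutral_left) (auto simp: in_keys_iff)
  also have "\<dots> = (\<Sum>g\<in>A. \<Sum>h\<in>B. Poly_Mapping.single (g \<circ> h)
     (Poly_Mapping.lookup x g * tensor_act scale v g (Poly_Mapping.lookup y h)))"
    using assms by (intro sum.cong sum.mono_neutral_left) (auto simp: in_keys_iff)
  finally show ?thesis .
qed

lemma skew_mult_add_left: "skew_mult scale v (x + y) z = skew_mult scale v x z + skew_mult scale v y z"
proof -
  let ?A = "Poly_Mapping.keys x \<union> Poly_Mapping.keys y"
  show ?thesis
    using skew_mult_superset[of ?A x "Poly_Mapping.keys z" z] skew_mult_superset[of ?A y "Poly_Mapping.keys z" z]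
      skew_mult_superset[of ?A "x + y" "Poly_Mapping.keys z" z] Poly_Mapping.keys_add[of x y]
    by (simp add: lookup_add distrib_right single_add sum.distrib)
qed

lemma skew_mult_add_right: "skew_mult scale v x (y + z) = skew_mult scale v x y + skew_mult scale v x z"
proof -
  let ?A = "Poly_Mapping.keys y \<union> Poly_Mapping.keys z"
  show ?thesis
    using skew_mult_superset[of "Poly_Mapping.keys x" x ?A y] skew_mult_superset[of "Poly_Mapping.keys x" x ?A z]
      skew_mult_superset[of "Poly_Mapping.keys x" x ?A "y + z"] Poly_Mapping.keys_add[of y z]
    by (simp add: lookup_add distrib_left single_add sum.distrib tensor_act_add)
qed

lemma skew_mult_single [simp]:
  "skew_mult scale v (Poly_Mapping.single g a) (Poly_Mapping.single h b)
    = Poly_Mapping.single (g \<circ> h) (a * tensor_act scale v g b)"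
  using skew_mult_superset[of "{g}" "Poly_Mapping.single g a" "{h}" "Poly_Mapping.single h b"]
  by simp

lemma skew_mult_zero_left [simp]: "skew_mult scale v 0 x = 0"
  by (simp add: skew_mult_def)

lemma skew_mult_zero_right [simp]: "skew_mult scale v x 0 = 0"
  by (simp add: skew_mult_def)

lemma skew_mult_uminus_left: "skew_mult scale v (- x) y = - skew_mult scale v x y"
  using skew_mult_add_left[of x "- x" y] by (simp add: eq_neg_iff_add_eq_0 add.commute)

lemma skew_mult_uminus_right: "skew_mult scale v x (- y) = - skew_mult scale v x y"
  using skew_mult_add_right[of x y "- y"] by (simp add: eq_neg_iff_add_eq_0 add.commute)

lemma skew_mult_diff_left: "skew_mult scale v (x - y) z = skew_mult scale v x z - skew_mult scale v y z"
  using skew_mult_add_left[of x "- y" z] by (simp add: skew_mult_uminus_left)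

lemma skew_mult_diff_right: "skew_mult scale v x (y - z) = skew_mult scale v x y - skew_mult scale v x z"
  using skew_mult_add_right[of x y "- z"] by (simp add: skew_mult_uminus_right)

lemma skew_mult_sum_left: "skew_mult scale v (sum f A) z = (\<Sum>x\<in>A. skew_mult scale v (f x) z)"
  by (induction A rule: infinite_finite_induct) (simp_all add: skew_mult_add_left)

lemma skew_mult_sum_right: "skew_mult scale v z (sum f A) = (\<Sum>x\<in>A. skew_mult scale v z (f x))"
  by (induction A rule: infinite_finite_induct) (simp_all add: skew_mult_add_right)

lemma skew_mult_scale_left: "skew_mult scale v (skew_scale c x) y = skew_scale c (skew_mult scale v x y)"
proof (induction x rule: poly_mapping_additive_induct)
  case (single g a)
  show ?case
  proof (induction y rule: poly_mapping_additive_induct)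
    case (add p q)
    then show ?case by (simp add: skew_mult_add_right skew_scale.scale_right_distrib del: skew_scale_single)
  qed simp
next
  case (add p q)
  then show ?case by (simp add: skew_mult_add_left skew_scale.scale_right_distrib)
qed

lemma skew_mult_scale_right: "skew_mult scale v x (skew_scale c y) = skew_scale c (skew_mult scale v x y)"
proof (induction x rule: poly_mapping_additive_induct)
  case (single g a)
  show ?case
  proof (induction y rule: poly_mapping_additive_induct)
    case (add p q)
    then show ?case by (simp add: skew_mult_add_right skew_scale.scale_right_distrib del: skew_scale_single)
  qed (simp add: tensor_act_scale)
next
  case (add p q)
  then show ?case by (simp add: skew_mult_add_left skew_scale.scale_right_distrib)
qed

end

text \<open>Separates the two-letter words into the reducible ones, decreasing or constant, and the
  irreducible ones, increasing.\<close>

lemma sum_triangle: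
  fixes f :: "'n::{finite,linorder} \<Rightarrow> 'n \<Rightarrow> 'b::comm_monoid_add"
  shows "(\<Sum>a\<in>UNIV. \<Sum>b\<in>UNIV. f a b)
    = (\<Sum>(i, j) | i < j. f j i) + (\<Sum>i\<in>UNIV. f i i) + (\<Sum>(i, j) | i < j. f i j)"
proof -
  have U: "(UNIV :: ('n \<times> 'n) set) = {(i, j). i > j} \<union> {(i, j). i = j} \<union> {(i, j). i < j}" by auto
  have "(\<Sum>a\<in>UNIV. \<Sum>b\<in>UNIV. f a b) = (\<Sum>(a, b)\<in>UNIV. f a b)"
    by (simp add: sum.cartesian_product)
  also have "\<dots> = (\<Sum>(a, b) | a > b. f a b) + (\<Sum>(a, b) | a = b. f a b) + (\<Sum>(a, b) | a < b. f a b)"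
    unfolding U by (subst sum.union_disjoint, auto simp: sum.union_disjoint)+
  also have "(\<Sum>(a, b) | a > b. f a b) = (\<Sum>(i, j) | i < j. f j i)"
    by (rule sum.reindex_bij_witness[of _ prod.swap prod.swap]) auto
  also have "(\<Sum>(a, b) | a = b. f a b) = (\<Sum>i\<in>UNIV. f i i)"
    by (rule sum.reindex_bij_witness[of _ "\<lambda>i. (i, i)" fst]) auto
  finally show ?thesis .
qed

lemma single_sum: "Poly_Mapping.single g (sum f A) = (\<Sum>x\<in>A. Poly_Mapping.single g (f x))"
  by (induction A rule: infinite_finite_induct) (simp_all add: single_add)

lemma free_alg_eqI:
  "(\<And>w. Poly_Mapping.lookup a (Fmon w) = Poly_Mapping.lookup b (Fmon w)) \<Longrightarrow> a = b"
  by (metis fmon.exhaust poly_mapping_eqI)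

text \<open>By transitivity of the order it suffices to compare adjacent letters; so a word is
  irreducible exactly when it is strictly increasing.\<close>

lemma not_strictly_sorted_split:
  fixes w :: "'a::linorder list"
  shows "\<not> sorted_wrt (<) w \<longleftrightarrow> (\<exists>A i j D. i \<le> j \<and> w = A @ [j, i] @ D)"
proof
  show "\<exists>A i j D. i \<le> j \<and> w = A @ [j, i] @ D" if "\<not> sorted_wrt (<) w"
    using that
  proof (induction w)
    case (Cons a w)
    show ?case
    proof (cases "sorted_wrt (<) w")
      case False
      with Cons.IH obtain A i j D where "i \<le> j" "w = A @ [j, i] @ D" by blast
      then show ?thesis by (intro exI[of _ "a # A"]) auto
    next
      case True
      with Cons.prems obtain b D where w: "w = b # D" by (cases w) auto
      with True Cons.prems have "b \<le> a" by (fastforce intro: less_trans)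
      then show ?thesis using w by (intro exI[of _ "[]"]) auto
    qed
  qed simp
qed (auto simp: sorted_wrt_append)

subsection \<open>The diamond lemma\<close>

text \<open>A linear form of Bergman's diamond lemma: a pair \<open>(x, f)\<close> in \<open>R\<close> is a rewrite rule
  \<open>b x \<leadsto> f\<close>, and every choice of values on the irreducible basis vectors extends to a
  functional that is invariant under rewriting.\<close>

lemma linear_diamond:
  fixes scale :: "'k::field \<Rightarrow> 'u::ab_group_add \<Rightarrow> 'u" and b :: "'x \<Rightarrow> 'u"
    and r :: "('x \<times> 'x) set" and R :: "('x \<times> 'u) set" and c :: "'x \<Rightarrow> 'k"
  assumes vs: "vector_space scale" and inj: "inj b"
    and ind: "\<not> Modules.module.dependent scale (range b)" and wf: "wf r"
    and descending: "\<And>x f. (x, f) \<in> R \<Longrightarrow> f \<in> Modules.module.span scale (b ` {y. (y, x) \<in> r})"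
    and resolvable: "\<And>x f f'. (x, f) \<in> R \<Longrightarrow> (x, f') \<in> R \<Longrightarrow>
      f - f' \<in> Modules.module.span scale {b y - e | y e. (y, e) \<in> R \<and> (y, x) \<in> r}"
  obtains N where "Vector_Spaces.linear scale (*) N" "\<And>x f. (x, f) \<in> R \<Longrightarrow> N f = N (b x)"
    "\<And>x. (\<And>f. (x, f) \<notin> R) \<Longrightarrow> N (b x) = c x"
proof -
  interpret V: vector_space scale by (rule vs)
  interpret P: vector_space_pair scale "(*) :: 'k \<Rightarrow> 'k \<Rightarrow> 'k"
    by unfold_locales (auto simp: algebra_simps)
  \<comment> \<open>\<open>ext M\<close> is a linear functional with value \<open>M y\<close> at the
    basis vector \<open>b y\<close>.\<close>
  define ext where "ext = (\<lambda>M. SOME L. Vector_Spaces.linear scale (*) L \<and> (\<forall>y. L (b y) = M y))"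
  have "\<exists>L. Vector_Spaces.linear scale (*) L \<and> (\<forall>y. L (b y) = M y)" for M :: "'x \<Rightarrow> 'k"
  proof -
    from P.linear_independent_extend[OF ind, of "M \<circ> inv_into UNIV b"] obtain L
      where "Vector_Spaces.linear scale (*) L" "\<forall>x\<in>range b. L x = (M \<circ> inv_into UNIV b) x" by blast
    then show ?thesis using inj by (intro exI[of _ L]) simp
  qed
  then have ext: "Vector_Spaces.linear scale (*) (ext M)" "ext M (b y) = M y" for M y
    unfolding ext_def using someI_ex[of "\<lambda>L. Vector_Spaces.linear scale (*) L \<and> (\<forall>y. L (b y) = M y)"]
    by blast+
  \<comment> \<open>Recursion along \<open>r\<close>: a reducible vector receives the value of one
    arbitrarily chosen reduct, an irreducible one the prescribed value \<open>c x\<close>.\<close>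
  define step where "step = (\<lambda>M x. if \<exists>f. (x, f) \<in> R then ext M (SOME f. (x, f) \<in> R) else c x)"
  define M where "M = wfrec r step"
  have M: "M x = step (cut M r x) x" for x
    unfolding M_def by (rule wfrec[OF wf])
  define N where "N = ext M"
  interpret N: Vector_Spaces.linear scale "(*)" N unfolding N_def by (rule ext)
  have N_b: "N (b x) = step (cut M r x) x" for x
    by (simp add: N_def ext M[symmetric])
  have chosen: "N (b x) = N (SOME f. (x, f) \<in> R)" if "(x, f) \<in> R" for x f
  proof -
    let ?f = "SOME f. (x, f) \<in> R"
    have R: "(x, ?f) \<in> R" using that by (rule someI)
    \<comment> \<open>\<open>cut M r x\<close> is \<open>undefined\<close> away from the
      predecessors of \<open>x\<close>. This is harmless, since \<open>descending\<close> puts the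
      reduct into the span of their basis vectors.\<close>
    have "ext (cut M r x) ?f = N ?f"
    proof (rule P.linear_eq_on_span[OF ext(1) N.linear_axioms _ descending[OF R]])
      fix u assume "u \<in> b ` {y. (y, x) \<in> r}"
      then show "ext (cut M r x) u = N u" by (auto simp: N_def ext cut_apply)
    qed
    then show ?thesis using that by (auto simp: N_b step_def)
  qed
  have rule: "\<forall>f. (x, f) \<in> R \<longrightarrow> N f = N (b x)" for x
    using wf
  proof (induction x rule: wf_induct_rule)
    case (less x)
    show ?case
    proof (intro allI impI)
      fix f assume f: "(x, f) \<in> R"
      let ?f = "SOME f. (x, f) \<in> R"
      have "(x, ?f) \<in> R" using f by (rule someI)
      \<comment> \<open>The difference of two reducts is spanned by vectors \<open>b y - e\<close>
        with \<open>y\<close> below \<open>x\<close>, and \<open>N\<close> kills these by the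
        induction hypothesis. So the chosen reduct is as good as any other.\<close>
      from resolvable[OF f this] have "N (f - ?f) = 0"
        by (rule P.linear_eq_0_on_span[OF N.linear_axioms, rotated])
          (use less in \<open>auto simp: N.diff\<close>)
      then show "N f = N (b x)" using chosen[OF f] by (simp add: N.diff)
    qed
  qed
  show thesis
    by (rule that[of N]) (use rule in \<open>auto simp: N.linear_axioms N_b step_def\<close>)
qed

subsection \<open>The skew group algebra\<close>

locale tqdh_data =
  fixes scale :: "'k::field \<Rightarrow> 'v::ab_group_add \<Rightarrow> 'v"  (infixr \<open>*s\<close> 75)
    and v :: "'n::{finite,linorder} \<Rightarrow> 'v"
    and G :: "('v \<Rightarrow> 'v) set"
    and q :: "'n \<Rightarrow> 'n \<Rightarrow> 'k"
    and \<kappa> :: "'v \<Rightarrow> 'v \<Rightarrow> ('v \<Rightarrow> 'v) \<Rightarrow>\<^sub>0 'k"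
  assumes vs: "vector_space scale"
    and basis: "vs_basis scale v"
    and subgrp: "subgroup G (GL scale)"
    and finG: "finite G"
    and q_nonzero: "q i j \<noteq> 0"
    and kappa: "bilinear_into_group_algebra scale G \<kappa>"
begin

text \<open>Group elements \<open>id\<close> and \<open>g \<circ> h\<close> occurring as arguments must not be unfolded to
  \<open>\<lambda>\<close>-terms by the simplifier.\<close>

declare id_apply [simp del] comp_apply [simp del]

sublocale V: vector_space scale by (rule vs)

abbreviation cf :: "'v \<Rightarrow> 'n \<Rightarrow> 'k" where "cf \<equiv> coord scale v"
abbreviation vec :: "'v \<Rightarrow> ('n, 'k) free_alg" where "vec \<equiv> vec_incl scale v"
abbreviation act :: "('v \<Rightarrow> 'v) \<Rightarrow> ('n, 'k) free_alg \<Rightarrow> ('n, 'k) free_alg" where "act \<equiv> tensor_act scale v"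
abbreviation ent :: "('v \<Rightarrow> 'v) \<Rightarrow> 'n \<Rightarrow> 'n \<Rightarrow> 'k" where "ent \<equiv> entry scale v"
abbreviation kap :: "('v \<Rightarrow> 'v) \<Rightarrow> 'n \<Rightarrow> 'n \<Rightarrow> 'k" where "kap \<equiv> form_comp v \<kappa>"
abbreviation S where "S \<equiv> tensor_skew scale v G"
abbreviation mul (infixl \<open>\<star>\<close> 70) where "mul \<equiv> skew_mult scale v"

lemma inj_v: "inj v" and indep_v: "V.independent (range v)" and span_v: "V.span (range v) = UNIV"
  using basis by (auto simp: vs_basis_def)

lemma coord_add: "cf (x + y) i = cf x i + cf y i"
  unfolding coord_def using indep_v span_v by (simp add: V.representation_add)

lemma coord_scale: "cf (c *s x) i = c * cf x i"
  unfolding coord_def using indep_v span_v by (simp add: V.representation_scale)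

lemma coord_zero [simp]: "cf 0 i = 0"
  using coord_scale[of 0 0 i] by simp

lemma coord_uminus: "cf (- x) i = - cf x i"
  using coord_scale[of "-1" x i] by simp

lemma coord_diff: "cf (x - y) i = cf x i - cf y i"
  using coord_add[of x "- y" i] by (simp add: coord_uminus)

lemma coord_basis: "cf (v j) i = (if i = j then 1 else 0)"
  unfolding coord_def using indep_v inj_v by (auto simp: V.representation_basis inj_eq)

lemma coord_expand: "x = (\<Sum>i\<in>UNIV. cf x i *s v i)"
proof -
  have "x = (\<Sum>b\<in>range v. V.representation (range v) x b *s b)"
    using V.sum_representation_eq[OF indep_v, of x "range v"] span_v by simp
  also have "\<dots> = (\<Sum>i\<in>UNIV. cf x i *s v i)"
    using inj_v by (simp add: sum.reindex coord_def comp_apply)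
  finally show ?thesis .
qed

lemma coord_eqI: "(\<And>i. cf x i = cf y i) \<Longrightarrow> x = y"
  by (subst coord_expand[of x], subst coord_expand[of y]) simp

lemma vec_add: "vec (x + y) = vec x + vec y"
  by (simp add: vec_incl_def coord_add pm.scale_left_distrib sum.distrib)

lemma vec_scale: "vec (c *s x) = pm_scale c (vec x)"
  by (simp add: vec_incl_def coord_scale pm.scale_sum_right)

lemma vec_zero [simp]: "vec 0 = 0"
  by (simp add: vec_incl_def)

lemma vec_diff: "vec (x - y) = vec x - vec y"
  by (simp add: vec_incl_def coord_diff pm.scale_left_diff_distrib sum_subtractf)

lemma vec_basis: "vec (v i) = gen i"
  by (simp add: vec_incl_def coord_basis if_distrib[of "\<lambda>c. pm_scale c _"] sum.delta cong: if_cong)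

lemma lookup_vec: "Poly_Mapping.lookup (vec x) (Fmon w) = (case w of [i] \<Rightarrow> cf x i | _ \<Rightarrow> 0)"
proof -
  have "Poly_Mapping.lookup (vec x) (Fmon w) = (\<Sum>i\<in>UNIV. if w = [i] then cf x i else 0)"
    by (auto simp: vec_incl_def lookup_sum gen_eq_word_elem lookup_word_elem intro!: sum.cong)
  also have "\<dots> = (case w of [i] \<Rightarrow> cf x i | _ \<Rightarrow> 0)"
    by (auto split: list.split)
  finally show ?thesis .
qed

lemma vec_entry: "vec (g (v j)) = (\<Sum>i\<in>UNIV. pm_scale (ent g i j) (gen i))"
  by (simp add: vec_incl_def entry_def)

lemma G_linear: "g \<in> G \<Longrightarrow> Vector_Spaces.linear scale scale g"
  using subgroup.subset[OF subgrp] by (auto simp: GL_def)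

lemma G_id: "id \<in> G"
  using subgroup.one_closed[OF subgrp] by (simp add: GL_def)

lemma G_comp: "g \<in> G \<Longrightarrow> h \<in> G \<Longrightarrow> g \<circ> h \<in> G"
  using subgroup.m_closed[OF subgrp] by (simp add: GL_def)

lemma group_GL: "group (GL scale)"
proof (rule groupI)
  interpret vector_space_pair scale scale by unfold_locales
  fix f assume "f \<in> carrier (GL scale)"
  then have f: "Vector_Spaces.linear scale scale f" "bij f" by (auto simp: GL_def)
  interpret f: Vector_Spaces.linear scale scale f by fact
  have "Vector_Spaces.linear scale scale (inv_into UNIV f)"
  proof
    fix a b c
    show "inv_into UNIV f (a + b) = inv_into UNIV f a + inv_into UNIV f b"
      using f(2) by (metis bij_inv_eq_iff f.add)
    show "inv_into UNIV f (c *s a) = c *s inv_into UNIV f a"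
      using f(2) by (metis bij_inv_eq_iff f.scale)
  qed
  then show "\<exists>y\<in>carrier (GL scale). y \<otimes>\<^bsub>GL scale\<^esub> f = \<one>\<^bsub>GL scale\<^esub>"
    using f(2) by (intro bexI[of _ "inv_into UNIV f"]) (simp_all add: GL_def bij_imp_bij_inv bij_is_inj)
next
  show "\<one>\<^bsub>GL scale\<^esub> \<in> carrier (GL scale)"
    using V.linear_id by (simp add: GL_def)
next
  fix f g assume "f \<in> carrier (GL scale)" "g \<in> carrier (GL scale)"
  then show "f \<otimes>\<^bsub>GL scale\<^esub> g \<in> carrier (GL scale)"
    using Vector_Spaces.linear_compose[of scale scale g scale f] bij_comp[of g f]
    by (simp add: GL_def)
qed (simp_all add: GL_def comp_assoc)

lemma G_inv: "g \<in> G \<Longrightarrow> inv\<^bsub>GL scale\<^esub> g \<in> G"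
  by (rule subgroup.m_inv_closed[OF subgrp])

lemma GL_mult: "g \<otimes>\<^bsub>GL scale\<^esub> h = g \<circ> h"
  by (simp add: GL_def)

lemma G_inv_comp: "g \<in> G \<Longrightarrow> inv\<^bsub>GL scale\<^esub> g \<circ> g = id" "g \<in> G \<Longrightarrow> g \<circ> inv\<^bsub>GL scale\<^esub> g = id"
  using group.l_inv[OF group_GL, of g] group.r_inv[OF group_GL, of g] subgroup.subset[OF subgrp]
  by (auto simp: GL_def)

lemma act_vec:
  assumes "g \<in> G"
  shows "act g (vec x) = vec (g x)"
proof -
  interpret g: Vector_Spaces.linear scale scale g by (rule G_linear[OF assms])
  have "g x = (\<Sum>i\<in>UNIV. cf x i *s g (v i))"
    by (subst coord_expand[of x]) (simp add: g.sum g.scale)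
  moreover have "vec (\<Sum>i\<in>A. f i) = (\<Sum>i\<in>A. vec (f i))" for A :: "'n set" and f
    by (induction A rule: infinite_finite_induct) (simp_all add: vec_add)
  ultimately have "vec (g x) = (\<Sum>i\<in>UNIV. pm_scale (cf x i) (vec (g (v i))))"
    by (simp add: vec_scale)
  then show ?thesis
    by (simp add: vec_incl_def[of _ _ x] tensor_act_sum tensor_act_scale tensor_act_gen)
qed

text \<open>Only the outer map has to be linear: \<open>act h\<close> replaces letters by vectors,
  and \<open>g\<close> is then applied to these vectors.\<close>

lemma act_comp:
  assumes "g \<in> G"
  shows "act (g \<circ> h) a = act g (act h a)"
proof (induction a rule: free_alg_induct)
  case (word c w)
  have "act (g \<circ> h) (word_elem w) = act g (act h (word_elem w))"
  proof (induction w)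
    case (Cons i w)
    have "act f (word_elem (i # w)) = vec (f (v i)) * act f (word_elem w)" for f
      by (simp add: tensor_act_word_elem)
    with Cons show ?case
      by (simp add: tensor_act_mult act_vec[OF assms] comp_apply)
  qed (simp add: word_elem_Nil)
  then show ?case by (simp add: tensor_act_scale)
qed (simp add: tensor_act_add)

lemma act_id [simp]: "act id a = a"
proof (induction a rule: free_alg_induct)
  case (word c w)
  have "act id (word_elem w) = word_elem w"
  proof (induction w)
    case (Cons i w)
    then show ?case using word_elem_mult[of "[i]" w]
      by (simp add: tensor_act_word_elem vec_basis gen_eq_word_elem id_apply)
  qed (simp add: word_elem_Nil)
  then show ?case by (simp add: tensor_act_scale)
qed (simp add: tensor_act_add)

text \<open>A carrier condition is imposed on the leftmost factor alone, because only its group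
  elements occur as the outer map in \<open>act_comp\<close>.\<close>

lemma mul_assoc:
  assumes "Poly_Mapping.keys x \<subseteq> G"
  shows "(x \<star> y) \<star> z = x \<star> (y \<star> z)"
proof -
  have "(Poly_Mapping.single g a \<star> y) \<star> z = Poly_Mapping.single g a \<star> (y \<star> z)" if "g \<in> G" for g a
  proof (induction y rule: poly_mapping_additive_induct)
    case (single h b)
    show ?case
    proof (induction z rule: poly_mapping_additive_induct)
      case (single k c)
      then show ?case using that by (simp add: act_comp tensor_act_mult mult.assoc comp_assoc)
    qed (simp add: skew_mult_add_right)
  qed (simp add: skew_mult_add_left skew_mult_add_right)
  then have "((\<Sum>g\<in>Poly_Mapping.keys x. Poly_Mapping.single g (Poly_Mapping.lookup x g)) \<star> y) \<star> z
      = (\<Sum>g\<in>Poly_Mapping.keys x. Poly_Mapping.single g (Poly_Mapping.lookup x g)) \<star> (y \<star> z)"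
    using assms by (simp add: skew_mult_sum_left subset_eq)
  then show ?thesis by (simp add: poly_mapping_sum_single)
qed

lemma S_carrier: "x \<in> carrier S \<longleftrightarrow> Poly_Mapping.keys x \<subseteq> G"
  by (simp add: tensor_skew_def skew_group_algebra_def)

lemma S_simps [simp]:
  "x \<otimes>\<^bsub>S\<^esub> y = x \<star> y" "x \<oplus>\<^bsub>S\<^esub> y = x + y" "\<zero>\<^bsub>S\<^esub> = 0" "\<one>\<^bsub>S\<^esub> = Poly_Mapping.single id 1"
  "c \<odot>\<^bsub>S\<^esub> x = skew_scale c x"
  by (simp_all add: tensor_skew_def skew_group_algebra_def skew_mult_def skew_scale_def GL_def)

lemma one_mul [simp]: "Poly_Mapping.single id 1 \<star> x = x"
  by (induction x rule: poly_mapping_additive_induct) (simp_all add: skew_mult_add_right)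

lemma mul_one [simp]: "x \<star> Poly_Mapping.single id 1 = x"
  by (induction x rule: poly_mapping_additive_induct) (simp_all add: skew_mult_add_left)

lemma S_single: "g \<in> G \<Longrightarrow> Poly_Mapping.single g a \<in> carrier S"
  by (simp add: S_carrier)

lemma S_zero: "0 \<in> carrier S" by (simp add: S_carrier)

lemma S_add: "x \<in> carrier S \<Longrightarrow> y \<in> carrier S \<Longrightarrow> x + y \<in> carrier S"
  using Poly_Mapping.keys_add[of x y] by (auto simp: S_carrier)

lemma S_sum: "(\<And>i. i \<in> A \<Longrightarrow> f i \<in> carrier S) \<Longrightarrow> sum f A \<in> carrier S"
  by (induction A rule: infinite_finite_induct) (simp_all add: S_add S_zero)

lemma S_mul: "x \<in> carrier S \<Longrightarrow> y \<in> carrier S \<Longrightarrow> x \<star> y \<in> carrier S"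
  unfolding skew_mult_def by (intro S_sum S_single) (auto simp: S_carrier intro: G_comp)

lemma S_uminus: "x \<in> carrier S \<Longrightarrow> - x \<in> carrier S"
  by (auto simp: S_carrier in_keys_iff)

lemma S_diff: "x \<in> carrier S \<Longrightarrow> y \<in> carrier S \<Longrightarrow> x - y \<in> carrier S"
  using S_add[of x "- y"] by (simp add: S_uminus)

lemma S_skew_scale: "x \<in> carrier S \<Longrightarrow> skew_scale c x \<in> carrier S"
  by (auto simp: S_carrier in_keys_iff)

lemma ring_S: "ring S"
proof (rule ringI)
  show "abelian_group S"
    by (rule abelian_groupI)
      (auto simp: S_add S_zero add_ac intro: bexI[of _ "- x" for x] S_uminus)
  show "Group.monoid S"
    by (rule Group.monoidI) (auto simp: S_mul mul_assoc S_single G_id, auto simp: S_carrier mul_assoc)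
qed (auto simp: skew_mult_add_left skew_mult_add_right)

subsection \<open>Overlaps and conjugates of the relations\<close>

abbreviation tt :: "('n, 'k) free_alg \<Rightarrow> ('v \<Rightarrow> 'v) \<Rightarrow>\<^sub>0 ('n, 'k) free_alg" where
  "tt \<equiv> Poly_Mapping.single id"
abbreviation gg :: "('v \<Rightarrow> 'v) \<Rightarrow> ('v \<Rightarrow> 'v) \<Rightarrow>\<^sub>0 ('n, 'k) free_alg" where
  "gg g \<equiv> Poly_Mapping.single g 1"

definition qcomm :: "'n \<Rightarrow> 'n \<Rightarrow> ('n, 'k) free_alg" where
  "qcomm i j = gen j * gen i - pm_scale (q i j) (gen i * gen j)"

definition group_sum :: "(('v \<Rightarrow> 'v) \<Rightarrow> ('n, 'k) free_alg) \<Rightarrow> ('v \<Rightarrow> 'v) \<Rightarrow>\<^sub>0 ('n, 'k) free_alg" where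
  "group_sum f = (\<Sum>h\<in>G. Poly_Mapping.single h (f h))"

definition relator :: "'n \<Rightarrow> 'n \<Rightarrow> ('v \<Rightarrow> 'v) \<Rightarrow>\<^sub>0 ('n, 'k) free_alg" where
  "relator i j = tt (qcomm i j) - group_sum (\<lambda>h. pm_scale (kap h i j) 1)"

definition square :: "'n \<Rightarrow> ('v \<Rightarrow> 'v) \<Rightarrow>\<^sub>0 ('n, 'k) free_alg" where
  "square i = tt (gen i * gen i)"

lemma lookup_group_sum: "Poly_Mapping.lookup (group_sum f) h = (if h \<in> G then f h else 0)"
  using finG by (simp add: group_sum_def lookup_sum lookup_single when_def sum.delta)

lemma S_group_sum: "group_sum f \<in> carrier S"
  unfolding group_sum_def by (intro S_sum S_single)

lemma S_relator: "relator i j \<in> carrier S"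
  unfolding relator_def by (intro S_diff S_single S_group_sum G_id)

lemma S_square: "square i \<in> carrier S"
  unfolding square_def by (intro S_single G_id)

lemma relator_generator:
  "of_tensor (gen j * gen i - pm_scale (q i j) (gen i * gen j)) - of_group_algebra (\<kappa> (v i) (v j)) = relator i j"
proof -
  have "Poly_Mapping.keys (\<kappa> (v i) (v j)) \<subseteq> G"
    using kappa by (simp add: bilinear_into_group_algebra_def)
  then have "of_group_algebra (\<kappa> (v i) (v j)) = group_sum (\<lambda>h. pm_scale (kap h i j) 1)"
    by (intro poly_mapping_eqI)
      (auto simp: of_group_algebra_def lookup_map_zero lookup_group_sum form_comp_def in_keys_iff subset_eq)
  then show ?thesis
    by (simp add: relator_def qcomm_def of_tensor_def)
qed

lemma group_sum_mul: "group_sum f \<star> tt a = group_sum (\<lambda>h. f h * act h a)"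
  by (simp add: group_sum_def skew_mult_sum_left)

lemma mul_group_sum: "tt a \<star> group_sum f = group_sum (\<lambda>h. a * f h)"
  by (simp add: group_sum_def skew_mult_sum_right)

lemma skew_scale_group_sum: "skew_scale c (group_sum f) = group_sum (\<lambda>h. pm_scale c (f h))"
  by (simp add: group_sum_def skew_scale.scale_sum_right)

lemma relator_mul: "relator i j \<star> tt a = tt (qcomm i j * a) - group_sum (\<lambda>h. pm_scale (kap h i j) (act h a))"
  by (simp add: relator_def skew_mult_diff_left group_sum_mul)

lemma mul_relator: "tt a \<star> relator i j = tt (a * qcomm i j) - group_sum (\<lambda>h. pm_scale (kap h i j) a)"
  by (simp add: relator_def skew_mult_diff_right mul_group_sum)

text \<open>The coefficient of \<open>h\<close>, a vector of \<open>V\<close>, in what remains after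
  both reductions of \<open>v_k v_j v_i\<close> have been continued to normal form. Its vanishing is
  condition (iii).\<close>

definition overlap_vec :: "('v \<Rightarrow> 'v) \<Rightarrow> 'n \<Rightarrow> 'n \<Rightarrow> 'n \<Rightarrow> 'v" where
  "overlap_vec h i j k = kap h i j *s ((q i k * q j k) *s h (v k) - v k)
         + kap h i k *s (q j k *s v j - q i j *s h (v j))
         + kap h j k *s (h (v i) - (q i j * q i k) *s v i)"

text \<open>The left side compares the two first reductions of \<open>v_k v_j v_i\<close>; the four
  products on the right record the reductions that follow, with the factors of \<open>q\<close>
  picked up on the way. All cubic words cancel, and moving \<open>h\<close> to the right end past a
  letter yields the vectors \<open>h (v i)\<close>. As an identity it holds for all indices; their
  order decides only which words are smaller.\<close>

lemma overlap_distinct: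
  "relator j k \<star> tt (gen i) - tt (gen k) \<star> relator i j =
    skew_scale (q i j) (relator i k \<star> tt (gen j)) + skew_scale (q i j * q i k) (tt (gen i) \<star> relator j k)
    - skew_scale (q j k) (tt (gen j) \<star> relator i k) - skew_scale (q j k * q i k) (relator i j \<star> tt (gen k))
    - group_sum (\<lambda>h. vec (overlap_vec h i j k))"
  unfolding relator_mul mul_relator
  by (rule poly_mapping_eqI)
    (simp add: lookup_group_sum lookup_add lookup_minus lookup_single qcomm_def when_def
       overlap_vec_def vec_add vec_diff vec_scale tensor_act_gen vec_basis algebra_simps id_apply)

text \<open>The word \<open>v_j v_j v_i\<close>: one reduction gives 0, the other moves both letters
  \<open>v_j\<close> past \<open>v_i\<close>. The group element created in between meets
  \<open>v_j\<close> once from the left and once from the right, hence the two vectors.\<close>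

lemma overlap_left:
  "square j \<star> tt (gen i) - tt (gen j) \<star> relator i j =
    skew_scale (q i j) (relator i j \<star> tt (gen j)) + skew_scale (q i j * q i j) (tt (gen i) \<star> square j)
    + group_sum (\<lambda>h. vec (kap h i j *s q i j *s h (v j) + kap h i j *s v j))"
  unfolding relator_mul mul_relator square_def
  by (rule poly_mapping_eqI)
    (simp add: lookup_group_sum lookup_add lookup_minus lookup_single qcomm_def when_def
        vec_add vec_diff vec_scale tensor_act_gen vec_basis algebra_simps id_apply)

text \<open>The mirror case \<open>v_j v_i v_i\<close>, where \<open>v_j\<close> passes both letters
  \<open>v_i\<close>.\<close>

lemma overlap_right:
  "relator i j \<star> tt (gen i) - tt (gen j) \<star> square i =
    - skew_scale (q i j) (tt (gen i) \<star> relator i j) - skew_scale (q i j * q i j) (square i \<star> tt (gen j))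
    - group_sum (\<lambda>h. vec (kap h i j *s q i j *s v i + kap h i j *s h (v i)))"
  unfolding relator_mul mul_relator square_def
  by (rule poly_mapping_eqI)
    (simp add: lookup_group_sum lookup_add lookup_minus lookup_single qcomm_def when_def
        vec_add vec_diff vec_scale tensor_act_gen vec_basis algebra_simps id_apply)

text \<open>Every decreasing product \<open>gen j * gen i\<close> is replaced by
  \<open>qcomm i j\<close> plus its reduct. The first two sums are combinations of quadratic
  relations; the third is the normal form that is left over.\<close>

lemma quadratic_expand:
  "(\<Sum>a\<in>UNIV. \<Sum>b\<in>UNIV. pm_scale (m a b) (gen a * gen b)) =
    (\<Sum>(i, j) | i < j. pm_scale (m j i) (qcomm i j)) + (\<Sum>i\<in>UNIV. pm_scale (m i i) (gen i * gen i))
    + (\<Sum>(i, j) | i < j. pm_scale (m i j + q i j * m j i) (gen i * gen j))"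
  unfolding sum_triangle[of "\<lambda>a b. pm_scale (m a b) (gen a * gen b)"]
  by (simp add: qcomm_def pm.scale_right_diff_distrib pm.scale_left_distrib sum.distrib sum_subtractf
      case_prod_unfold mult.commute)

text \<open>The coefficient of \<open>gen a * gen b\<close> in
  \<open>act h (qcomm r s)\<close>.\<close>

definition relator_matrix :: "('v \<Rightarrow> 'v) \<Rightarrow> 'n \<Rightarrow> 'n \<Rightarrow> 'n \<Rightarrow> 'n \<Rightarrow> 'k" where
  "relator_matrix h r s a b = ent h a s * ent h b r - q r s * ent h a r * ent h b s"

definition square_matrix :: "('v \<Rightarrow> 'v) \<Rightarrow> 'n \<Rightarrow> 'n \<Rightarrow> 'n \<Rightarrow> 'k" where
  "square_matrix h r a b = ent h a r * ent h b r"

text \<open>Entries at decreasing pairs are the multiplicities of the relations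
  \<open>qcomm i j\<close>; this is the origin of the quantum minors.\<close>

lemma relator_matrix_qdet: "relator_matrix h r s j i = qdet scale v q r s i j h"
  by (simp add: relator_matrix_def qdet_def mult.commute)

lemma act_gen_gen:
  "act h (gen a * gen b) = (\<Sum>i\<in>UNIV. \<Sum>j\<in>UNIV. pm_scale (ent h i a * ent h j b) (gen i * gen j))"
  by (simp add: tensor_act_mult tensor_act_gen vec_entry sum_product mult.commute)

lemma act_qcomm: "act h (qcomm r s) = (\<Sum>a\<in>UNIV. \<Sum>b\<in>UNIV. pm_scale (relator_matrix h r s a b) (gen a * gen b))"
  by (simp add: qcomm_def tensor_act_diff tensor_act_scale act_gen_gen relator_matrix_def pm.scale_left_diff_distrib
      sum_subtractf pm.scale_sum_right mult.assoc)

lemma act_square: "act h (gen r * gen r) = (\<Sum>a\<in>UNIV. \<Sum>b\<in>UNIV. pm_scale (square_matrix h r a b) (gen a * gen b))"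
  by (simp add: act_gen_gen square_matrix_def)

text \<open>The relations used up in reducing the quadratic form with matrix \<open>m\<close>.
  Entries above the diagonal belong to irreducible words and contribute none.\<close>

definition relator_comb :: "('n \<Rightarrow> 'n \<Rightarrow> 'k) \<Rightarrow> ('v \<Rightarrow> 'v) \<Rightarrow>\<^sub>0 ('n, 'k) free_alg" where
  "relator_comb m = (\<Sum>(i, j) | i < j. skew_scale (m j i) (relator i j)) + (\<Sum>i\<in>UNIV. skew_scale (m i i) (square i))"

definition ordered_part :: "('n \<Rightarrow> 'n \<Rightarrow> 'k) \<Rightarrow> ('n, 'k) free_alg" where
  "ordered_part m = (\<Sum>(i, j) | i < j. pm_scale (m i j + q i j * m j i) (gen i * gen j))"

lemma group_sum_sum: "(\<Sum>x\<in>A. group_sum (f x)) = group_sum (\<lambda>h. \<Sum>x\<in>A. f x h)"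
  unfolding group_sum_def by (subst sum.swap) (simp add: single_sum)

lemma group_sum_gg: "group_sum f \<star> gg h = (\<Sum>g\<in>G. Poly_Mapping.single (g \<circ> h) (f g))"
  by (simp add: group_sum_def skew_mult_sum_left)

text \<open>\<open>quadratic_expand\<close> lifted to the skew group algebra: passing from
  \<open>qcomm i j\<close> to \<open>relator i j\<close> costs the group sum.\<close>

lemma relator_expand:
  "relator_comb m \<star> gg h + Poly_Mapping.single h (ordered_part m)
     = Poly_Mapping.single h (\<Sum>a\<in>UNIV. \<Sum>b\<in>UNIV. pm_scale (m a b) (gen a * gen b))
     - group_sum (\<lambda>g. pm_scale (\<Sum>(i, j) | i < j. m j i * kap g i j) 1) \<star> gg h"
proof -
  have "relator_comb m = tt ((\<Sum>(i, j) | i < j. pm_scale (m j i) (qcomm i j)) + (\<Sum>i\<in>UNIV. pm_scale (m i i) (gen i * gen i)))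
      - group_sum (\<lambda>g. pm_scale (\<Sum>(i, j) | i < j. m j i * kap g i j) 1)"
    by (simp add: relator_comb_def relator_def square_def skew_scale.scale_right_diff_distrib skew_scale_group_sum case_prod_unfold sum_subtractf
      group_sum_sum single_add single_sum pm.scale_sum_left)
  then show ?thesis
    by (simp add: quadratic_expand ordered_part_def skew_mult_diff_left skew_mult_add_left single_add)
qed

text \<open>Moving \<open>h\<close> across a relation yields a combination of relations up to two
  defects: \<open>ordered_part\<close>, which measures the failure of \<open>h\<close> to respect
  the quadratic relation, and a group sum, which measures the failure of equivariance of
  \<open>\<kappa>\<close>.\<close>

lemma conj_relator:
  assumes "h \<in> G"
  shows "gg h \<star> relator r s = relator_comb (relator_matrix h r s) \<star> gg h + Poly_Mapping.single h (ordered_part (relator_matrix h r s))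
    + group_sum (\<lambda>g. pm_scale ((\<Sum>(i, j) | i < j. qdet scale v q r s i j h * kap g i j)
        - kap (inv\<^bsub>GL scale\<^esub> h \<otimes>\<^bsub>GL scale\<^esub> g \<otimes>\<^bsub>GL scale\<^esub> h) r s) 1) \<star> gg h"
proof -
  let ?i = "inv\<^bsub>GL scale\<^esub> h"
  \<comment> \<open>Putting \<open>h g h^-1\<close> for \<open>g\<close> brings \<open>h\<close>
    back to the right end; the conjugate \<open>h^-1 g h\<close> in the equivariance condition
    arises here.\<close>
  have "(\<Sum>g\<in>G. Poly_Mapping.single (h \<circ> g) (pm_scale (kap g r s) 1))
      = (\<Sum>g\<in>G. Poly_Mapping.single (g \<circ> h) (pm_scale (kap (?i \<circ> g \<circ> h) r s) (1 :: ('n, 'k) free_alg)))"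
  proof (rule sum.reindex_bij_witness[of _ "\<lambda>g. ?i \<circ> g \<circ> h" "\<lambda>g. h \<circ> g \<circ> ?i"])
    fix g assume "g \<in> G"
    have 1: "?i \<circ> (h \<circ> f) = f" "h \<circ> (?i \<circ> f) = f" for f :: "'v \<Rightarrow> 'v"
      by (simp_all add: comp_assoc[symmetric] G_inv_comp assms)
    show "?i \<circ> (h \<circ> g \<circ> ?i) \<circ> h = g" "h \<circ> (?i \<circ> g \<circ> h) \<circ> ?i = g"
      "h \<circ> g \<circ> ?i \<in> G" "?i \<circ> g \<circ> h \<in> G"
      using assms \<open>g \<in> G\<close> by (simp_all add: comp_assoc 1 G_inv_comp G_comp G_inv)
    show "Poly_Mapping.single (h \<circ> g \<circ> ?i \<circ> h) (pm_scale (kap (?i \<circ> (h \<circ> g \<circ> ?i) \<circ> h) r s) 1)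
      = Poly_Mapping.single (h \<circ> g) (pm_scale (kap g r s) (1 :: ('n, 'k) free_alg))"
      using assms \<open>g \<in> G\<close> by (simp add: comp_assoc 1 G_inv_comp)
  qed
  then have "gg h \<star> relator r s = Poly_Mapping.single h (act h (qcomm r s))
      - group_sum (\<lambda>g. pm_scale (kap (?i \<circ> g \<circ> h) r s) 1) \<star> gg h"
    by (simp add: relator_def skew_mult_diff_right group_sum_gg) (simp add: group_sum_def skew_mult_sum_right tensor_act_scale)
  moreover have "group_sum (\<lambda>g. pm_scale (a g - b g) 1) = group_sum (\<lambda>g. pm_scale (a g) 1) - group_sum (\<lambda>g. pm_scale (b g) 1)"
    for a b by (simp add: group_sum_def pm.scale_left_diff_distrib single_diff sum_subtractf)
  ultimately show ?thesis
    using relator_expand[of "relator_matrix h r s" h]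
    by (simp add: GL_mult relator_matrix_qdet act_qcomm skew_mult_diff_left)
qed

text \<open>The square has no \<open>\<kappa>\<close> part, so nothing balances the group sum
  produced by reducing its image; this sum alone is the left side of condition (vi).\<close>

lemma conj_square:
  assumes "h \<in> G"
  shows "gg h \<star> square r = relator_comb (square_matrix h r) \<star> gg h + Poly_Mapping.single h (ordered_part (square_matrix h r))
    + group_sum (\<lambda>g. pm_scale (\<Sum>(i, j) | i < j. ent h i r * ent h j r * kap g i j) 1) \<star> gg h"
  using relator_expand[of "square_matrix h r" h] by (simp add: square_def act_square square_matrix_def mult.commute)

subsection \<open>The PBW property and irreducible elements of the ideal\<close>

abbreviation I where "I \<equiv> tqdh_ideal scale v G q \<kappa>"
abbreviation H where "H \<equiv> tqdh_quotient scale v G q \<kappa>"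
abbreviation pbw_index where "pbw_index \<equiv> {\<alpha> :: 'n \<Rightarrow> nat. \<forall>i. \<alpha> i \<in> {0, 1}} \<times> G"

lemma I_eq: "I = Idl\<^bsub>S\<^esub> ({relator i j | i j. True} \<union> {square i | i. True})"
  by (simp add: tqdh_ideal_def relator_generator) (simp add: of_tensor_def square_def)

lemma gens_S: "{relator i j | i j. True} \<union> {square i | i. True} \<subseteq> carrier S"
  using S_relator S_square by auto

lemma ideal_I: "ideal I S"
  unfolding I_eq by (rule ring.genideal_ideal[OF ring_S gens_S])

lemma relator_I: "relator i j \<in> I" and square_I: "square i \<in> I"
  using ring.genideal_self[OF ring_S gens_S] unfolding I_eq by auto

lemma I_S: "x \<in> I \<Longrightarrow> x \<in> carrier S"
  using ideal.Icarr[OF ideal_I] .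

lemma I_add: "x \<in> I \<Longrightarrow> y \<in> I \<Longrightarrow> x + y \<in> I"
  using additive_subgroup.a_closed[OF ideal.axioms(1)[OF ideal_I], of x y] by simp

lemma I_zero: "0 \<in> I"
  using additive_subgroup.zero_closed[OF ideal.axioms(1)[OF ideal_I]] by simp

lemma I_mul_left: "x \<in> I \<Longrightarrow> y \<in> carrier S \<Longrightarrow> y \<star> x \<in> I"
  using ideal.I_l_closed[OF ideal_I, of x y] by simp

lemma I_mul_right: "x \<in> I \<Longrightarrow> y \<in> carrier S \<Longrightarrow> x \<star> y \<in> I"
  using ideal.I_r_closed[OF ideal_I, of x y] by simp

text \<open>Scalars act as multiplication by ring elements, so a ring ideal is a subspace as
  well.\<close>

lemma skew_scale_eq_mul: "skew_scale c x = tt (pm_scale c 1) \<star> x"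
  by (induction x rule: poly_mapping_additive_induct)
    (simp_all add: skew_mult_add_right skew_scale.scale_right_distrib del: skew_scale_single, simp)

lemma I_skew_scale: "x \<in> I \<Longrightarrow> skew_scale c x \<in> I"
  unfolding skew_scale_eq_mul by (intro I_mul_left S_single G_id)

lemma I_uminus: "x \<in> I \<Longrightarrow> - x \<in> I"
  using I_skew_scale[of x "-1"] by simp

lemma I_diff: "x \<in> I \<Longrightarrow> y \<in> I \<Longrightarrow> x - y \<in> I"
  using I_add[of x "- y"] by (simp add: I_uminus)

lemma I_sum: "(\<And>a. a \<in> A \<Longrightarrow> f a \<in> I) \<Longrightarrow> sum f A \<in> I"
  by (induction A rule: infinite_finite_induct) (simp_all add: I_add I_zero)

lemma relator_comb_I: "relator_comb m \<in> I"
  unfolding relator_comb_def by (intro I_add I_sum) (auto intro: I_skew_scale relator_I square_I)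

lemma S_a_inv: "x \<in> carrier S \<Longrightarrow> \<ominus>\<^bsub>S\<^esub> x = - x"
  using abelian_group.minus_equality[OF ring.is_abelian_group[OF ring_S], of "- x" x]
  by (simp add: S_uminus)

lemma coset_eq_iff:
  assumes "x \<in> carrier S" "y \<in> carrier S"
  shows "I +>\<^bsub>S\<^esub> x = I +>\<^bsub>S\<^esub> y \<longleftrightarrow> x - y \<in> I"
  using ring.quotient_eq_iff_same_a_r_cos[OF ring_S ideal_I assms] assms
  by (simp add: a_minus_def S_a_inv)

lemma carrier_H: "carrier H = {I +>\<^bsub>S\<^esub> x | x. x \<in> carrier S}"
  by (auto simp: tqdh_quotient_def quot_algebra_def FactRing_def A_RCOSETS_def' a_r_coset_def' r_coset_def)

text \<open>Scalar multiplication of a coset is a union over all its representatives; the cosets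
  united here all coincide because \<open>I\<close> is closed under scaling.\<close>

lemma smult_H:
  assumes "x \<in> carrier S"
  shows "c \<odot>\<^bsub>H\<^esub> (I +>\<^bsub>S\<^esub> x) = I +>\<^bsub>S\<^esub> skew_scale c x"
proof -
  have "I +>\<^bsub>S\<^esub> skew_scale c y = I +>\<^bsub>S\<^esub> skew_scale c x" if y: "y \<in> I +>\<^bsub>S\<^esub> x" for y
  proof -
    from y obtain a where "a \<in> I" "y = a + x" by (auto simp: a_r_coset_def')
    then have "skew_scale c y - skew_scale c x \<in> I" by (simp add: skew_scale.scale_right_distrib I_skew_scale)
    then show ?thesis
      using assms \<open>a \<in> I\<close> \<open>y = a + x\<close> by (subst coset_eq_iff) (simp_all add: S_skew_scale S_add I_S)
  qed
  then have "(\<Union>y\<in>I +>\<^bsub>S\<^esub> x. I +>\<^bsub>S\<^esub> skew_scale c y) = (\<Union>y\<in>I +>\<^bsub>S\<^esub> x. I +>\<^bsub>S\<^esub> skew_scale c x)"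
    by (intro SUP_cong refl)
  also have "x \<in> I +>\<^bsub>S\<^esub> x"
    using I_zero by (force simp: a_r_coset_def')
  then have "(\<Union>y\<in>I +>\<^bsub>S\<^esub> x. I +>\<^bsub>S\<^esub> skew_scale c x) = I +>\<^bsub>S\<^esub> skew_scale c x"
    by blast
  finally show ?thesis
    by (simp add: tqdh_quotient_def quot_algebra_def)
qed

text \<open>\<open>H\<close> and \<open>S Quot I\<close> share carrier, zero and addition, so the
  sum may be computed in the quotient ring, where the coset map is a homomorphism.\<close>

lemma finsum_H:
  assumes "finite B" "\<And>b. b \<in> B \<Longrightarrow> x b \<in> carrier S"
  shows "(\<Oplus>\<^bsub>H\<^esub>b\<in>B. c b \<odot>\<^bsub>H\<^esub> (I +>\<^bsub>S\<^esub> x b)) = I +>\<^bsub>S\<^esub> (\<Sum>b\<in>B. skew_scale (c b) (x b))"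
proof -
  interpret Q: ring "S Quot I" by (rule ideal.quotient_is_ring[OF ideal_I])
  have hom: "(+>\<^bsub>S\<^esub>) I \<in> ring_hom S (S Quot I)" by (rule ideal.rcos_ring_hom[OF ideal_I])
  have "(\<Oplus>\<^bsub>H\<^esub>b\<in>B. c b \<odot>\<^bsub>H\<^esub> (I +>\<^bsub>S\<^esub> x b)) = (\<Oplus>\<^bsub>S Quot I\<^esub>b\<in>B. c b \<odot>\<^bsub>H\<^esub> (I +>\<^bsub>S\<^esub> x b))"
    by (simp add: finsum_def finprod_def tqdh_quotient_def quot_algebra_def)
  also have "\<dots> = I +>\<^bsub>S\<^esub> (\<Sum>b\<in>B. skew_scale (c b) (x b))"
    using assms
  proof (induction B)
    case empty
    have "I +>\<^bsub>S\<^esub> 0 = I" using I_zero by (auto simp: a_r_coset_def')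
    moreover have "\<zero>\<^bsub>S Quot I\<^esub> = I" by (simp add: FactRing_def)
    ultimately show ?case by simp
  next
    case (insert b B)
    have "c b \<odot>\<^bsub>H\<^esub> (I +>\<^bsub>S\<^esub> x b) \<in> carrier (S Quot I)" if "x b \<in> carrier S" for b
      using that ring_hom_closed[OF hom, of "skew_scale (c b) (x b)"] by (simp add: smult_H S_skew_scale)
    then have "(\<Oplus>\<^bsub>S Quot I\<^esub>b\<in>insert b B. c b \<odot>\<^bsub>H\<^esub> (I +>\<^bsub>S\<^esub> x b))
       = c b \<odot>\<^bsub>H\<^esub> (I +>\<^bsub>S\<^esub> x b) \<oplus>\<^bsub>S Quot I\<^esub> (\<Oplus>\<^bsub>S Quot I\<^esub>b\<in>B. c b \<odot>\<^bsub>H\<^esub> (I +>\<^bsub>S\<^esub> x b))"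
      using insert by (intro Q.finsum_insert) auto
    also have "\<dots> = (I +>\<^bsub>S\<^esub> skew_scale (c b) (x b)) \<oplus>\<^bsub>S Quot I\<^esub> (I +>\<^bsub>S\<^esub> (\<Sum>b\<in>B. skew_scale (c b) (x b)))"
      using insert by (simp add: smult_H)
    also have "\<dots> = I +>\<^bsub>S\<^esub> (skew_scale (c b) (x b) + (\<Sum>b\<in>B. skew_scale (c b) (x b)))"
      using ring_hom_add[OF hom, of "skew_scale (c b) (x b)" "\<Sum>b\<in>B. skew_scale (c b) (x b)"] insert
      by (simp add: S_skew_scale S_sum)
    finally show ?case using insert by simp
  qed
  finally show ?thesis .
qed

section \<open>Strictly increasing words and the PBW basis\<close>

definition normal_forms :: "(('v \<Rightarrow> 'v) \<Rightarrow>\<^sub>0 ('n, 'k) free_alg) set" where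
  "normal_forms = {u. \<forall>g w. Poly_Mapping.lookup (Poly_Mapping.lookup u g) (Fmon w) \<noteq> 0 \<longrightarrow> sorted_wrt (<) w}"

definition exponent_word :: "('n \<Rightarrow> nat) \<Rightarrow> 'n list" where
  "exponent_word \<alpha> = filter (\<lambda>i. \<alpha> i = 1) (sorted_list_of_set UNIV)"

lemma ordered_monomial_word_elem:
  assumes "\<forall>i. \<alpha> i \<in> {0, 1}"
  shows "(ordered_monomial \<alpha> :: ('n, 'k) free_alg) = word_elem (exponent_word \<alpha>)"
proof -
  have "prod_list (map (\<lambda>i. gen i ^ \<alpha> i) w) = (word_elem (filter (\<lambda>i. \<alpha> i = 1) w) :: ('n, 'k) free_alg)" for w
  proof (induction w)
    case (Cons i w)
    then show ?case using assms[rule_format, of i] by (auto simp: gen_eq_word_elem)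
  qed (simp add: word_elem_Nil)
  then show ?thesis by (simp add: ordered_monomial_def exponent_word_def)
qed

text \<open>Exponent vectors with values 0 and 1 are indicator functions of sets of letters, and a
  strictly increasing word is determined by its set of letters.\<close>

lemma exponent_word_eq_iff:
  assumes "\<forall>i. \<alpha> i \<in> {0, 1}"
  shows "exponent_word \<alpha> = w \<longleftrightarrow> sorted_wrt (<) w \<and> \<alpha> = (\<lambda>i. if i \<in> set w then 1 else 0)"
proof -
  have 1: "sorted_wrt (<) (exponent_word \<alpha>)" "set (exponent_word \<alpha>) = {i. \<alpha> i = 1}"
    by (auto simp: exponent_word_def intro: sorted_wrt_filter)
  have 2: "\<alpha> = (\<lambda>i. if i \<in> {i. \<alpha> i = 1} then 1 else 0)"
    using assms by fastforce
  show ?thesis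
  proof
    assume "exponent_word \<alpha> = w"
    then show "sorted_wrt (<) w \<and> \<alpha> = (\<lambda>i. if i \<in> set w then 1 else 0)" using 1 2 by metis
  next
    assume a: "sorted_wrt (<) w \<and> \<alpha> = (\<lambda>i. if i \<in> set w then 1 else 0)"
    then have "{i. \<alpha> i = 1} = set w" by auto
    with a 1 show "exponent_word \<alpha> = w"
      by (metis strict_sorted_equal)
  qed
qed

lemma finite_pbw_index: "finite pbw_index"
proof -
  have "{\<alpha> :: 'n \<Rightarrow> nat. \<forall>i. \<alpha> i \<in> {0, 1}} \<subseteq> (\<lambda>A i. if i \<in> A then 1 else 0) ` UNIV"
  proof
    fix \<alpha> :: "'n \<Rightarrow> nat" assume "\<alpha> \<in> {\<alpha>. \<forall>i. \<alpha> i \<in> {0, 1}}"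
    then have "\<alpha> = (\<lambda>i. if i \<in> {i. \<alpha> i = 1} then 1 else 0)" by fastforce
    then show "\<alpha> \<in> (\<lambda>A i. if i \<in> A then 1 else 0) ` UNIV" by blast
  qed
  from finite_subset[OF this finite_imageI[OF finite_UNIV]] show ?thesis using finG
    by (rule finite_cartesian_product)
qed

lemma lookup_pbw_sum:
  "Poly_Mapping.lookup (Poly_Mapping.lookup (\<Sum>b\<in>pbw_index. skew_scale (c b)
       (case b of (\<alpha>, g) \<Rightarrow> Poly_Mapping.single g (ordered_monomial \<alpha>))) g) (Fmon w)
    = (if g \<in> G \<and> sorted_wrt (<) w then c (\<lambda>i. if i \<in> set w then 1 else 0, g) else (0 :: 'k))"
proof -
  let ?a = "\<lambda>i. if i \<in> set w then 1 else 0 :: nat"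
  have "Poly_Mapping.lookup (Poly_Mapping.lookup (\<Sum>b\<in>pbw_index. skew_scale (c b)
       (case b of (\<alpha>, g) \<Rightarrow> Poly_Mapping.single g (ordered_monomial \<alpha>))) g) (Fmon w)
    = (\<Sum>b\<in>pbw_index. if b = (?a, g) then (if sorted_wrt (<) w then c (?a, g) else 0) else 0)"
    unfolding lookup_sum
  proof (intro sum.cong refl)
    fix b assume "b \<in> pbw_index"
    then obtain \<alpha> g' where b: "b = (\<alpha>, g')" "\<forall>i. \<alpha> i \<in> {0, 1}" "g' \<in> G" by auto
    then show "Poly_Mapping.lookup (Poly_Mapping.lookup (skew_scale (c b)
        (case b of (\<alpha>, g) \<Rightarrow> Poly_Mapping.single g (ordered_monomial \<alpha>))) g) (Fmon w)
      = (if b = (?a, g) then (if sorted_wrt (<) w then c (?a, g) else 0) else 0)"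
      using exponent_word_eq_iff[OF b(2), of w]
      by (auto simp: lookup_single when_def ordered_monomial_word_elem lookup_word_elem)
  qed
  also have "\<dots> = (if (?a, g) \<in> pbw_index then (if sorted_wrt (<) w then c (?a, g) else 0) else 0)"
    using finite_pbw_index by (subst sum.delta) auto
  also have "\<dots> = (if g \<in> G \<and> sorted_wrt (<) w then c (?a, g) else 0)"
    by auto
  finally show ?thesis .
qed

lemma normal_forms_expand:
  assumes "u \<in> normal_forms" "u \<in> carrier S"
  shows "u = (\<Sum>b\<in>pbw_index. skew_scale (Poly_Mapping.lookup (Poly_Mapping.lookup u (snd b)) (Fmon (exponent_word (fst b))))
       (case b of (\<alpha>, g) \<Rightarrow> Poly_Mapping.single g (ordered_monomial \<alpha>)))"
proof (intro poly_mapping_eqI[of u] free_alg_eqI)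
  fix g w
  have *: "exponent_word (\<lambda>i. if i \<in> set w then 1 else 0) = w" if "sorted_wrt (<) w"
    using that by (subst exponent_word_eq_iff) auto
  have "g \<in> G" "sorted_wrt (<) w" if "Poly_Mapping.lookup (Poly_Mapping.lookup u g) (Fmon w) \<noteq> 0"
    using that assms by (auto simp: normal_forms_def S_carrier in_keys_iff subset_eq)
  then show "Poly_Mapping.lookup (Poly_Mapping.lookup u g) (Fmon w) =
    Poly_Mapping.lookup (Poly_Mapping.lookup (\<Sum>b\<in>pbw_index. skew_scale (Poly_Mapping.lookup (Poly_Mapping.lookup u (snd b)) (Fmon (exponent_word (fst b))))
       (case b of (\<alpha>, g) \<Rightarrow> Poly_Mapping.single g (ordered_monomial \<alpha>))) g) (Fmon w)"
    unfolding lookup_pbw_sum by (auto simp: *)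
qed

lemma S_pbw: "b \<in> pbw_index \<Longrightarrow> (case b of (\<alpha>, g) \<Rightarrow> Poly_Mapping.single g (ordered_monomial \<alpha>)) \<in> carrier S"
  by (auto intro: S_single)

text \<open>The two conjuncts are spanning and independence. Combinations of PBW elements before
  passing to the quotient are exactly the normal forms in the carrier, so all coefficients disappear
  from the statement.\<close>

lemma pbw_iff:
  "truncated_quantum_drinfeld_hecke scale v G q \<kappa> \<longleftrightarrow>
     (\<forall>u\<in>carrier S. \<exists>z\<in>carrier S \<inter> normal_forms. u - z \<in> I) \<and> (\<forall>u\<in>I \<inter> normal_forms. u = 0)"
proof -
  define x where "x = (\<lambda>b :: ('n \<Rightarrow> nat) \<times> ('v \<Rightarrow> 'v). case b of (\<alpha>, g) \<Rightarrow>
    Poly_Mapping.single g (ordered_monomial \<alpha> :: ('n, 'k) free_alg))"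
  have x_S: "x b \<in> carrier S" if "b \<in> pbw_index" for b
    unfolding x_def by (rule S_pbw[OF that])
  define lc where "lc = (\<lambda>c. \<Sum>b\<in>pbw_index. skew_scale (c b) (x b))"
  have lc_S: "lc c \<in> carrier S" for c unfolding lc_def by (intro S_sum S_skew_scale x_S)
  have lc_normal_forms: "lc c \<in> normal_forms" for c
    unfolding lc_def x_def normal_forms_def using lookup_pbw_sum by (auto split: if_splits)
  have expand: "\<exists>c. u = lc c" if "u \<in> carrier S \<inter> normal_forms" for u
    unfolding lc_def x_def
    by (rule exI[of _ "\<lambda>b. Poly_Mapping.lookup (Poly_Mapping.lookup u (snd b)) (Fmon (exponent_word (fst b)))"])
      (use that normal_forms_expand in blast)
  have sum_H: "(\<Oplus>\<^bsub>H\<^esub>b\<in>pbw_index. c b \<odot>\<^bsub>H\<^esub> (I +>\<^bsub>S\<^esub> x b)) = I +>\<^bsub>S\<^esub> lc c" for c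
    unfolding lc_def by (rule finsum_H[OF finite_pbw_index x_S])
  have zero_H: "\<zero>\<^bsub>H\<^esub> = I +>\<^bsub>S\<^esub> 0"
    using I_zero by (force simp: tqdh_quotient_def quot_algebra_def FactRing_def a_r_coset_def')
  \<comment> \<open>The PBW elements are already independent in \<open>S\<close>: they are distinct
    pairs of a word and a group element.\<close>
  have lc_zero: "c b = 0" if lc: "lc c = 0" and b_index: "b \<in> pbw_index" for c b
  proof -
    obtain \<alpha> g where b: "b = (\<alpha>, g)" "\<forall>i. \<alpha> i \<in> {0, 1}" "g \<in> G" using b_index by auto
    have "Poly_Mapping.lookup (Poly_Mapping.lookup (lc c) g) (Fmon (exponent_word \<alpha>)) = c b"
      unfolding lc_def x_def lookup_pbw_sum using b exponent_word_eq_iff[OF b(2), of "exponent_word \<alpha>"] by simp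
    with lc show ?thesis by simp
  qed
  have zero_lc: "lc c = 0" if "\<And>b. b \<in> pbw_index \<Longrightarrow> c b = 0" for c
    unfolding lc_def using that by (intro sum.neutral) simp
  have lc_zero_iff: "(\<forall>b\<in>pbw_index. c b = 0) \<longleftrightarrow> lc c = 0" for c
    by (rule iffI, rule zero_lc, erule bspec, assumption, rule ballI, rule lc_zero)
  have x_H: "(\<lambda>b. I +>\<^bsub>S\<^esub> x b) ` pbw_index \<subseteq> carrier H"
    unfolding carrier_H using x_S by blast
  have "truncated_quantum_drinfeld_hecke scale v G q \<kappa> \<longleftrightarrow> finite_basis H (\<lambda>b. I +>\<^bsub>S\<^esub> x b) pbw_index"
    by (simp add: truncated_quantum_drinfeld_hecke_def x_def case_prod_unfold)
  also have "\<dots> \<longleftrightarrow> (\<forall>a\<in>carrier H. \<exists>c. a = I +>\<^bsub>S\<^esub> lc c) \<and> (\<forall>c. I +>\<^bsub>S\<^esub> lc c = I +>\<^bsub>S\<^esub> 0 \<longrightarrow> (\<forall>b\<in>pbw_index. c b = 0))"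
    unfolding finite_basis_def sum_H zero_H using finite_pbw_index x_H by (simp only: simp_thms)
  also have "(\<forall>a\<in>carrier H. \<exists>c. a = I +>\<^bsub>S\<^esub> lc c) \<longleftrightarrow> (\<forall>u\<in>carrier S. \<exists>c. u - lc c \<in> I)"
    using coset_eq_iff[OF _ lc_S] by (simp add: carrier_H) (metis (no_types, lifting))
  also have "\<dots> \<longleftrightarrow> (\<forall>u\<in>carrier S. \<exists>z\<in>carrier S \<inter> normal_forms. u - z \<in> I)"
    using expand lc_S lc_normal_forms by blast
  also have "(\<forall>c. I +>\<^bsub>S\<^esub> lc c = I +>\<^bsub>S\<^esub> 0 \<longrightarrow> (\<forall>b\<in>pbw_index. c b = 0)) \<longleftrightarrow> (\<forall>c. lc c \<in> I \<longrightarrow> lc c = 0)"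
    by (simp only: coset_eq_iff[OF lc_S S_zero] diff_zero lc_zero_iff)
  also have "\<dots> \<longleftrightarrow> (\<forall>u\<in>I \<inter> normal_forms. u = 0)"
    using expand I_S lc_normal_forms by blast
  finally show ?thesis .
qed

subsection \<open>Automorphisms of the quantum exterior algebra\<close>

abbreviation F :: "('k, ('n, 'k) free_alg) module" where "F \<equiv> free_algebra"
abbreviation E where "E \<equiv> qext_ideal q"
abbreviation ext_gens :: "('n, 'k) free_alg set" where
  "ext_gens \<equiv> {gen j * gen i - pm_scale (q i j) (gen i * gen j) | i j. i \<noteq> j} \<union> {gen i * gen i | i. True}"

lemma F_simps [simp]:
  "carrier F = UNIV" "x \<otimes>\<^bsub>F\<^esub> y = x * y" "x \<oplus>\<^bsub>F\<^esub> y = x + y" "\<zero>\<^bsub>F\<^esub> = 0" "\<one>\<^bsub>F\<^esub> = 1"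
  "c \<odot>\<^bsub>F\<^esub> x = pm_scale c x"
  by (simp_all add: free_algebra_def)

lemma ring_F: "ring F"
proof (rule ringI)
  show "abelian_group F"
    by (rule abelian_groupI) (auto simp: add_ac intro: exI[of _ "- x" for x])
  show "Group.monoid F"
    by (rule Group.monoidI) (auto simp: mult.assoc)
qed (auto simp: distrib_left distrib_right)

lemma F_a_inv: "\<ominus>\<^bsub>F\<^esub> x = - x"
  using abelian_group.minus_equality[OF ring.is_abelian_group[OF ring_F], of "- x" x] by simp

text \<open>Negatives need no clause, since they are multiples by -1.\<close>

lemma ideal_F_iff:
  "ideal J F \<longleftrightarrow> 0 \<in> J \<and> (\<forall>a\<in>J. \<forall>b\<in>J. a + b \<in> J) \<and> (\<forall>a\<in>J. \<forall>x. x * a \<in> J \<and> a * x \<in> J)"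
  (is "_ \<longleftrightarrow> ?R")
proof
  assume J: "ideal J F"
  show ?R
    using additive_subgroup.zero_closed[OF ideal.axioms(1)[OF J]]
      additive_subgroup.a_closed[OF ideal.axioms(1)[OF J]] ideal.I_l_closed[OF J] ideal.I_r_closed[OF J]
    by simp
next
  assume R: ?R
  have "- a \<in> J" if "a \<in> J" for a
    using R that by (metis mult_minus1)
  then have "subgroup J (add_monoid F)"
    using R F_a_inv by (intro group.subgroupI[OF abelian_group.a_group[OF ring.is_abelian_group[OF ring_F]]])
      (auto simp: a_inv_def)
  then show "ideal J F"
    using R by (intro idealI ring_F) auto
qed

lemma ideal_E: "ideal E F"
  unfolding qext_ideal_def by (rule ring.genideal_ideal[OF ring_F]) simp

lemma E_props: "0 \<in> E" "a \<in> E \<Longrightarrow> b \<in> E \<Longrightarrow> a + b \<in> E" "a \<in> E \<Longrightarrow> x * a \<in> E" "a \<in> E \<Longrightarrow> a * x \<in> E"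
  using ideal_E unfolding ideal_F_iff by auto

lemma E_gens: "ext_gens \<subseteq> E"
  unfolding qext_ideal_def by (rule ring.genideal_self[OF ring_F]) simp

lemma E_minimal: "ideal J F \<Longrightarrow> ext_gens \<subseteq> J \<Longrightarrow> E \<subseteq> J"
  unfolding qext_ideal_def by (rule ring.genideal_minimal[OF ring_F])

lemma E_qcomm: "r \<noteq> s \<Longrightarrow> qcomm r s \<in> E" and E_square: "gen i * gen i \<in> E"
  using E_gens by (auto simp: qcomm_def)

lemma E_scale: "a \<in> E \<Longrightarrow> pm_scale c a \<in> E"
  using E_props(3)[of a "pm_scale c 1"] by simp

lemma E_sum: "(\<And>x. x \<in> A \<Longrightarrow> f x \<in> E) \<Longrightarrow> sum f A \<in> E"
  by (induction A rule: infinite_finite_induct) (simp_all add: E_props)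

lemma E_coset_eq: "E +>\<^bsub>F\<^esub> x = E +>\<^bsub>F\<^esub> y \<longleftrightarrow> x - y \<in> E"
  using ring.quotient_eq_iff_same_a_r_cos[OF ring_F ideal_E, of x y]
  by (simp add: a_minus_def F_a_inv)

abbreviation L where "L \<equiv> quantum_exterior_algebra q"

lemma L_smult: "c \<odot>\<^bsub>L\<^esub> (E +>\<^bsub>F\<^esub> x) = E +>\<^bsub>F\<^esub> pm_scale c x"
proof -
  have "E +>\<^bsub>F\<^esub> pm_scale c y = E +>\<^bsub>F\<^esub> pm_scale c x" if y: "y \<in> E +>\<^bsub>F\<^esub> x" for y
  proof -
    from y obtain a where "a \<in> E" "y = a + x" by (auto simp: a_r_coset_def')
    then show ?thesis by (subst E_coset_eq) (simp add: pm.scale_right_distrib E_scale)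
  qed
  then have "(\<Union>y\<in>E +>\<^bsub>F\<^esub> x. E +>\<^bsub>F\<^esub> pm_scale c y) = (\<Union>y\<in>E +>\<^bsub>F\<^esub> x. E +>\<^bsub>F\<^esub> pm_scale c x)"
    by (intro SUP_cong refl)
  also have "x \<in> E +>\<^bsub>F\<^esub> x"
    using E_props(1) by (force simp: a_r_coset_def')
  then have "(\<Union>y\<in>E +>\<^bsub>F\<^esub> x. E +>\<^bsub>F\<^esub> pm_scale c x) = E +>\<^bsub>F\<^esub> pm_scale c x"
    by blast
  finally show ?thesis
    by (simp add: quantum_exterior_algebra_def quot_algebra_def)
qed

lemma L_hom: "(+>\<^bsub>F\<^esub>) E \<in> ring_hom F L"
  using ideal.rcos_ring_hom[OF ideal_E]
  by (auto simp: ring_hom_def quantum_exterior_algebra_def quot_algebra_def)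

lemma carrier_L: "carrier L = range ((+>\<^bsub>F\<^esub>) E)"
  by (auto simp: quantum_exterior_algebra_def quot_algebra_def FactRing_def A_RCOSETS_def' a_r_coset_def' r_coset_def)

text \<open>The automorphism agrees with \<open>act h\<close> modulo \<open>E\<close> on letters,
  hence on words and by linearity everywhere. An element of \<open>E\<close> has the same coset as
  0, so its image does too.\<close>

lemma acts_imp_E_invariant:
  assumes acts: "acts_on_qext_by_automorphisms scale v q G" and h: "h \<in> G" and a: "a \<in> E"
  shows "act h a \<in> E"
proof -
  obtain \<phi> where \<phi>: "\<phi> \<in> algebra_automorphisms L" "\<And>x. \<phi> (E +>\<^bsub>F\<^esub> vec x) = E +>\<^bsub>F\<^esub> vec (h x)"
    using acts h by (auto simp: acts_on_qext_by_automorphisms_def qext_vec_def)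
  then have hom: "\<phi> \<in> ring_hom L L"
    and sc: "\<And>c X. X \<in> carrier L \<Longrightarrow> \<phi> (c \<odot>\<^bsub>L\<^esub> X) = c \<odot>\<^bsub>L\<^esub> \<phi> X"
    by (auto simp: algebra_automorphisms_def ring_iso_def)
  have hom2: "(\<lambda>x. \<phi> (E +>\<^bsub>F\<^esub> x)) \<in> ring_hom F L"
    using ring_hom_trans[OF L_hom hom] by (simp add: comp_def)
  note hom_mult = ring_hom_mult[OF hom2, simplified] ring_hom_mult[OF L_hom, simplified]
  note hom_add = ring_hom_add[OF hom2, simplified] ring_hom_add[OF L_hom, simplified]
  have "\<phi> (E +>\<^bsub>F\<^esub> b) = E +>\<^bsub>F\<^esub> act h b" for b
  proof (induction b rule: free_alg_induct)
    case (word c w)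
    have "\<phi> (E +>\<^bsub>F\<^esub> word_elem w) = E +>\<^bsub>F\<^esub> act h (word_elem w)"
    proof (induction w)
      case Nil
      then show ?case
        using ring_hom_one[OF hom2] ring_hom_one[OF L_hom] by (simp add: word_elem_Nil)
    next
      case (Cons i w)
      have "word_elem (i # w) = gen i * (word_elem w :: ('n, 'k) free_alg)" by (simp add: gen_eq_word_elem)
      then show ?case
        using Cons \<phi>(2)[of "v i"]
        by (simp add: hom_mult(1) tensor_act_mult vec_basis tensor_act_gen) (simp add: hom_mult(2))
    qed
    then show ?case
      using sc[of "E +>\<^bsub>F\<^esub> word_elem w" c] by (simp add: L_smult tensor_act_scale carrier_L)
  next
    case (add b b')
    then show ?case by (simp add: hom_add(1) tensor_act_add) (simp add: hom_add(2))
  qed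
  from this[of a] this[of 0] have "E +>\<^bsub>F\<^esub> act h a = E +>\<^bsub>F\<^esub> 0"
    using a E_coset_eq[of a 0] by simp
  then show ?thesis
    using E_coset_eq[of "act h a" 0] by simp
qed

text \<open>The functional below detects \<open>v\<^sub>i v\<^sub>j\<close>, so these products with \<open>i < j\<close> are linearly
  independent in \<open>\<Lambda>\<^sub>q(V)\<close>.\<close>

lemma E_degree_two:
  assumes qsym: "\<forall>i j. i \<noteq> j \<longrightarrow> q i j = inverse (q j i)" and a: "a \<in> E" and "i < j"
  shows "Poly_Mapping.lookup a (Fmon [i, j]) + q i j * Poly_Mapping.lookup a (Fmon [j, i]) = 0"
proof -
  define c where "c = (\<lambda>i j (a :: ('n, 'k) free_alg).
    Poly_Mapping.lookup a (Fmon [i, j]) + q i j * Poly_Mapping.lookup a (Fmon [j, i]))"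
  \<comment> \<open>Vanishing in degrees 0 and 1 is included to make \<open>J\<close> an ideal: in
    degree two of a product, only the constant coefficient of the other factor then
    survives.\<close>
  define J where "J = {a. Poly_Mapping.lookup a (Fmon []) = 0 \<and> (\<forall>i. Poly_Mapping.lookup a (Fmon [i]) = 0)
    \<and> (\<forall>i j. i < j \<longrightarrow> c i j a = 0)}"
  have sets: "{..2::nat} = {0, 1, 2}" "{..Suc 0} = {0, 1}" by auto
  have c_add: "c i j (a + b) = c i j a + c i j b" for i j a b
    by (simp add: c_def lookup_add algebra_simps)
  have c_mult: "c i j (x * a) = Poly_Mapping.lookup x (Fmon []) * c i j a"
    "c i j (a * x) = c i j a * Poly_Mapping.lookup x (Fmon [])" if "a \<in> J" for i j x a
    using that by (simp_all add: c_def J_def lookup_free_alg_mult sets numeral_2_eq_2 algebra_simps)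
  have "ideal J F"
    unfolding ideal_F_iff
  proof (intro conjI ballI allI)
    show "0 \<in> J" by (simp add: J_def c_def)
    show "a + b \<in> J" if "a \<in> J" "b \<in> J" for a b
      using that by (simp add: J_def c_add lookup_add)
    show "x * a \<in> J" "a * x \<in> J" if a: "a \<in> J" for a x
      using a c_mult[OF a] by (simp_all add: J_def lookup_free_alg_mult sets)
  qed
  \<comment> \<open>This serves the generators with \<open>i > j\<close>, on which the functional
    takes the value \<open>1 - q j i * q i j\<close>.\<close>
  moreover have "q i j * q j i = 1" if "i \<noteq> j" for i j
    using qsym[rule_format, OF that] q_nonzero by simp
  then have "ext_gens \<subseteq> J"
    by (auto simp: J_def c_def lookup_minus lookup_word_elem gen_eq_word_elem)
  ultimately have "a \<in> J" using E_minimal a by blast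
  then show ?thesis using \<open>i < j\<close> by (simp add: J_def c_def)
qed

lemma lookup_quadratic:
  fixes m :: "'n \<Rightarrow> 'n \<Rightarrow> 'k"
  shows "Poly_Mapping.lookup (\<Sum>a\<in>UNIV. \<Sum>b\<in>UNIV. pm_scale (m a b) (gen a * gen b)) (Fmon [i, j]) = m i j"
proof -
  have "Poly_Mapping.lookup (\<Sum>a\<in>UNIV. \<Sum>b\<in>UNIV. pm_scale (m a b) (gen a * gen b)) (Fmon [i, j])
     = (\<Sum>a\<in>UNIV. \<Sum>b\<in>UNIV. if a = i then if b = j then m i j else 0 else 0)"
    unfolding lookup_sum by (intro sum.cong refl) (auto simp: gen_eq_word_elem lookup_word_elem)
  also have "\<dots> = (\<Sum>a\<in>UNIV. if a = i then m i j else 0)"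
    by (intro sum.cong refl) (simp add: sum.delta)
  finally show ?thesis by (simp add: sum.delta)
qed

text \<open>The action on the exterior algebra in coordinates: the quadratic normal form of the
  image of each defining relation vanishes. Passing from automorphisms to coordinates relies on the
  symmetry of \<open>q\<close>, because it needs increasing products to be independent modulo
  \<open>E\<close>.\<close>

definition preserves_qext :: bool where
  "preserves_qext \<longleftrightarrow> (\<forall>h\<in>G. \<forall>i j. i < j \<longrightarrow>
     (\<forall>r s. r \<noteq> s \<longrightarrow> relator_matrix h r s i j + q i j * relator_matrix h r s j i = 0) \<and>
     (\<forall>r. square_matrix h r i j + q i j * square_matrix h r j i = 0))"

lemma acts_imp_preserves_qext:
  assumes "acts_on_qext_by_automorphisms scale v q G" "\<forall>i j. i \<noteq> j \<longrightarrow> q i j = inverse (q j i)"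
  shows preserves_qext
  unfolding preserves_qext_def
proof (intro ballI allI impI conjI)
  fix h and i j r :: 'n assume h: "h \<in> G" and "i < j"
  have "act h (gen r * gen r) \<in> E" by (rule acts_imp_E_invariant[OF assms(1) h E_square])
  from E_degree_two[OF assms(2) this \<open>i < j\<close>]
  show "square_matrix h r i j + q i j * square_matrix h r j i = 0"
    by (simp add: act_square lookup_quadratic)
  fix s assume "r \<noteq> s"
  have "act h (qcomm r s) \<in> E" by (rule acts_imp_E_invariant[OF assms(1) h E_qcomm[OF \<open>r \<noteq> s\<close>]])
  from E_degree_two[OF assms(2) this \<open>i < j\<close>]
  show "relator_matrix h r s i j + q i j * relator_matrix h r s j i = 0"
    by (simp add: act_qcomm lookup_quadratic)
qed

lemma preserves_qext_imp_ordered_part: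
  assumes preserves_qext "h \<in> G"
  shows "r \<noteq> s \<Longrightarrow> ordered_part (relator_matrix h r s) = 0" "ordered_part (square_matrix h r) = 0"
  using assms by (auto simp: preserves_qext_def ordered_part_def intro!: sum.neutral)

text \<open>\<open>act h\<close> maps the relations into \<open>E\<close> and so induces a
  homomorphism on the quotient; it is onto because \<open>act\<close> of the inverse undoes it, and
  the first isomorphism theorem gives the automorphism.\<close>

lemma preserves_qext_imp_acts:
  assumes preserves_qext
  shows "acts_on_qext_by_automorphisms scale v q G"
  unfolding acts_on_qext_by_automorphisms_def qext_vec_def
proof
  have quad_E: "(\<Sum>a\<in>UNIV. \<Sum>b\<in>UNIV. pm_scale (m a b) (gen a * gen b)) \<in> E" if "ordered_part m = 0" for m
  proof -
    have "(\<Sum>a\<in>UNIV. \<Sum>b\<in>UNIV. pm_scale (m a b) (gen a * gen b))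
      = (\<Sum>(i, j) | i < j. pm_scale (m j i) (qcomm i j)) + (\<Sum>i\<in>UNIV. pm_scale (m i i) (gen i * gen i))"
      using that unfolding quadratic_expand ordered_part_def by simp
    also have "\<dots> \<in> E"
      by (intro E_props E_sum) (auto intro!: E_scale E_qcomm E_square)
    finally show ?thesis .
  qed
  have inv: "act h a \<in> E" if h: "h \<in> G" and a: "a \<in> E" for h a
  proof -
    have "ideal {a. act h a \<in> E} F"
      unfolding ideal_F_iff by (auto simp: E_props tensor_act_add tensor_act_mult)
    moreover have "act h (qcomm r s) \<in> E" if "r \<noteq> s" for r s
      unfolding act_qcomm by (rule quad_E[OF preserves_qext_imp_ordered_part(1)[OF assms h that]])
    then have "ext_gens \<subseteq> {a. act h a \<in> E}"
      using quad_E[OF preserves_qext_imp_ordered_part(2)[OF assms h]] by (auto simp: qcomm_def act_square)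
    ultimately have "E \<subseteq> {a. act h a \<in> E}" by (rule E_minimal)
    with a show ?thesis by auto
  qed
  fix h assume h: "h \<in> G"
  let ?h' = "inv\<^bsub>GL scale\<^esub> h"
  let ?f = "\<lambda>x. E +>\<^bsub>F\<^esub> act h x"
  have h': "?h' \<in> G" "act h (act ?h' a) = a" "act ?h' (act h a) = a" for a
    using h by (simp_all add: G_inv act_comp[symmetric] G_inv_comp)
  have "act h \<in> ring_hom F F"
    by (auto simp: ring_hom_def tensor_act_add tensor_act_mult)
  from ring_hom_trans[OF this L_hom] have hom: "?f \<in> ring_hom F (F Quot E)"
    by (simp add: comp_def ring_hom_def quantum_exterior_algebra_def quot_algebra_def)
  interpret f: ring_hom_ring F "F Quot E" ?f
    by (rule ring_hom_ringI2[OF ring_F ideal.quotient_is_ring[OF ideal_E] hom])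
  have "(\<lambda>X. the_elem (?f ` X)) \<in> ring_iso (F Quot (a_kernel F (F Quot E) ?f)) (F Quot E)"
  proof (rule f.FactRing_iso_set)
    have "carrier (F Quot E) = range ((+>\<^bsub>F\<^esub>) E)"
      using carrier_L by (simp add: quantum_exterior_algebra_def quot_algebra_def)
    also have "\<dots> = range ?f"
    proof (intro equalityI image_subsetI)
      show "E +>\<^bsub>F\<^esub> x \<in> range ?f" for x
        using rangeI[of ?f "act ?h' x"] h'(2) by simp
    qed simp
    finally show "?f ` carrier F = carrier (F Quot E)" by simp
  qed
  moreover have "a_kernel F (F Quot E) ?f = E"
  proof -
    have "?f x = E \<longleftrightarrow> x \<in> E" for x
    proof -
      have "E = E +>\<^bsub>F\<^esub> 0" using E_props(1) by (auto simp: a_r_coset_def')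
      then have "?f x = E \<longleftrightarrow> act h x \<in> E" using E_coset_eq[of "act h x" 0] by simp
      \<comment> \<open>Invariance of \<open>E\<close> under the inverse of \<open>h\<close> keeps
        the kernel from being larger than \<open>E\<close>.\<close>
      also have "\<dots> \<longleftrightarrow> x \<in> E" using inv[OF h] inv[OF h'(1)] h'(3) by metis
      finally show ?thesis .
    qed
    moreover have "\<zero>\<^bsub>F Quot E\<^esub> = E" by (simp add: FactRing_def)
    ultimately show ?thesis by (simp only: a_kernel_def' F_simps UNIV_I simp_thms Collect_mem_eq)
  qed
  moreover have val: "the_elem (?f ` (E +>\<^bsub>F\<^esub> x)) = E +>\<^bsub>F\<^esub> act h x" for x
  proof -
    have "?f y = ?f x" if "y \<in> E +>\<^bsub>F\<^esub> x" for y
    proof -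
      from that obtain a where "a \<in> E" "y = a + x" by (auto simp: a_r_coset_def')
      then show ?thesis by (subst E_coset_eq) (simp add: tensor_act_add inv[OF h])
    qed
    moreover have "x \<in> E +>\<^bsub>F\<^esub> x" using E_props(1) by (force simp: a_r_coset_def')
    ultimately have "?f ` (E +>\<^bsub>F\<^esub> x) = {?f x}" by blast
    then show ?thesis by simp
  qed
  moreover have "ring_iso (F Quot E) (F Quot E) = ring_iso L L"
    by (simp add: ring_iso_def ring_hom_def quantum_exterior_algebra_def quot_algebra_def)
  moreover have "the_elem (?f ` (c \<odot>\<^bsub>L\<^esub> X)) = c \<odot>\<^bsub>L\<^esub> the_elem (?f ` X)" if X: "X \<in> carrier L" for c X
  proof -
    from X obtain x where "X = E +>\<^bsub>F\<^esub> x" by (auto simp: carrier_L)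
    then show ?thesis by (simp only: L_smult val tensor_act_scale)
  qed
  ultimately have "(\<lambda>X. the_elem (?f ` X)) \<in> algebra_automorphisms L"
    by (simp add: algebra_automorphisms_def)
  then show "\<exists>\<phi>\<in>algebra_automorphisms L. \<forall>x. \<phi> (E +>\<^bsub>F\<^esub> vec x) = E +>\<^bsub>F\<^esub> vec (h x)"
    by (rule bexI[rotated]) (simp add: val act_vec[OF h])
qed

subsection \<open>Necessity of the conditions\<close>

text \<open>Restricting to \<open>h \<in> G\<close> loses nothing, as \<open>\<kappa>\<close> takes
  values in the group algebra of \<open>G\<close>.\<close>

lemma quantum_2_form_iff:
  "quantum_2_form v q \<kappa> \<longleftrightarrow>
    (\<forall>h\<in>G. \<forall>i j. kap h i i = 0 \<and> kap h j i = - inverse (q i j) * kap h i j)"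
proof -
  have "form_comp v \<kappa> h i j = 0" if "h \<notin> G" for h i j
    using that kappa unfolding bilinear_into_group_algebra_def form_comp_def
    by (meson not_in_keys_iff_lookup_eq_zero subsetD)
  then have "(\<forall>h\<in>G. \<forall>i j. kap h i i = 0 \<and> kap h j i = - inverse (q i j) * kap h i j)
    \<longleftrightarrow> (\<forall>h i j. kap h i i = 0 \<and> kap h j i = - inverse (q i j) * kap h i j)"
    by (metis mult_zero_right)
  then show ?thesis
    by (auto simp: quantum_2_form_def poly_mapping_eq_iff fun_eq_iff form_comp_def)
qed

definition ordered_quadratic :: "('n \<Rightarrow> 'n \<Rightarrow> 'k) \<Rightarrow> ('n, 'k) free_alg" where
  "ordered_quadratic m = (\<Sum>(i, j) | i < j. pm_scale (m i j) (gen i * gen j))"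

lemma ordered_part_ordered_quadratic: "ordered_part m = ordered_quadratic (\<lambda>i j. m i j + q i j * m j i)"
  by (simp add: ordered_part_def ordered_quadratic_def)

lemma lookup_ordered_quadratic:
  "Poly_Mapping.lookup (ordered_quadratic m) (Fmon w) =
    (case w of [i, j] \<Rightarrow> if i < j then m i j else 0 | _ \<Rightarrow> 0)"
proof -
  have "Poly_Mapping.lookup (ordered_quadratic m) (Fmon w) = (\<Sum>(i, j) | i < j. if w = [i, j] then m i j else 0)"
    unfolding ordered_quadratic_def lookup_sum
    by (intro sum.cong refl) (auto simp: gen_eq_word_elem lookup_word_elem)
  also have "\<dots> = (case w of [i, j] \<Rightarrow> if i < j then m i j else 0 | _ \<Rightarrow> 0)"
  proof (cases "\<exists>a b. w = [a, b]")
    case True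
    then obtain a b where w: "w = [a, b]" by auto
    have "(\<Sum>(i, j) | i < j. if w = [i, j] then m i j else 0)
      = (\<Sum>p\<in>{(i, j). i < j}. if p = (a, b) then m a b else 0)"
      by (intro sum.cong refl) (auto simp: w split: if_splits)
    also have "\<dots> = (if a < b then m a b else 0)"
      by (subst sum.delta) auto
    finally show ?thesis by (simp add: w)
  next
    case False
    then show ?thesis by (auto intro!: sum.neutral split: list.split)
  qed
  finally show ?thesis .
qed

text \<open>The common shape of the irreducible elements extracted below. Its three kinds of
  coefficients sit at words of lengths two, one and zero, so they cannot cancel each other.\<close>

lemma sparse_normal_form:
  assumes PBW: "\<forall>u\<in>I \<inter> normal_forms. u = 0"
    and mem: "tt (ordered_quadratic m) + group_sum (\<lambda>h. vec (x h) + pm_scale (d h) 1) \<in> I"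
  shows "i < j \<Longrightarrow> m i j = 0" "h \<in> G \<Longrightarrow> x h = 0" "h \<in> G \<Longrightarrow> d h = 0"
proof -
  let ?u = "tt (ordered_quadratic m) + group_sum (\<lambda>h. vec (x h) + pm_scale (d h) 1)"
  have l: "Poly_Mapping.lookup (Poly_Mapping.lookup ?u g) (Fmon w) =
      (if g = id then case w of [i, j] \<Rightarrow> if i < j then m i j else 0 | _ \<Rightarrow> 0 else 0)
      + (if g \<in> G then (case w of [i] \<Rightarrow> cf (x g) i | _ \<Rightarrow> 0) + (if w = [] then d g else 0) else 0)" for g w
    by (auto simp: lookup_add lookup_group_sum lookup_single lookup_ordered_quadratic lookup_vec word_elem_Nil[symmetric] lookup_word_elem when_def)
  have "?u \<in> normal_forms"
    unfolding normal_forms_def mem_Collect_eq l by (auto split: list.splits if_splits)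
  with PBW mem have "?u = 0" by blast
  with l have z: "(if g = id then case w of [i, j] \<Rightarrow> if i < j then m i j else 0 | _ \<Rightarrow> 0 else 0)
      + (if g \<in> G then (case w of [i] \<Rightarrow> cf (x g) i | _ \<Rightarrow> 0) + (if w = [] then d g else 0) else 0) = 0" for g w
    by (metis lookup_zero)
  show "m i j = 0" if "i < j" using z[of id "[i, j]"] that by (simp split: if_splits)
  show "x h = 0" if "h \<in> G"
    using z[of h "[_]"] that by (intro coord_eqI) (cases "h = id"; simp)
  show "d h = 0" if "h \<in> G"
    using z[of h "[]"] that by (simp split: if_splits)
qed

lemma ordered_quadratic_zero: "ordered_quadratic (\<lambda>i j. 0) = 0"
  by (simp add: ordered_quadratic_def)

lemma group_sum_vec_I:
  assumes PBW: "\<forall>u\<in>I \<inter> normal_forms. u = 0" and "group_sum (\<lambda>h. vec (x h)) \<in> I" and "h \<in> G"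
  shows "x h = 0"
  using sparse_normal_form(2)[OF PBW, of "\<lambda>_ _. 0" x "\<lambda>_. 0"] assms(2,3) by (simp add: ordered_quadratic_zero)

text \<open>Cancelling \<open>h\<close> on the right leaves exactly the two defects of
  \<open>conj_relator\<close> or \<open>conj_square\<close>, as an irreducible element of the
  ideal.\<close>

lemma conj_normal_form:
  assumes PBW: "\<forall>u\<in>I \<inter> normal_forms. u = 0" and h: "h \<in> G"
    and u: "u \<in> I" and eq: "gg h \<star> u = relator_comb m \<star> gg h + Poly_Mapping.single h (ordered_part m)
      + group_sum (\<lambda>g. pm_scale (d g) 1) \<star> gg h"
  shows "i < j \<Longrightarrow> m i j + q i j * m j i = 0" "g \<in> G \<Longrightarrow> d g = 0"
proof -
  let ?h' = "inv\<^bsub>GL scale\<^esub> h"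
  have h': "?h' \<in> G" "h \<circ> ?h' = id" using h by (simp_all add: G_inv G_inv_comp)
  have r: "relator_comb m \<in> I" by (rule relator_comb_I)
  have *: "y \<star> gg h \<star> gg ?h' = y" if "y \<in> carrier S" for y
    using that h' by (simp add: mul_assoc S_carrier)
  have "tt (ordered_part m) + group_sum (\<lambda>g. pm_scale (d g) 1) = (gg h \<star> u - relator_comb m \<star> gg h) \<star> gg ?h'"
    by (simp add: eq skew_mult_diff_left skew_mult_add_left * S_group_sum h')
  also have "\<dots> \<in> I"
    by (intro I_mul_right I_diff I_mul_left u r S_single h h')
  finally have "tt (ordered_quadratic (\<lambda>i j. m i j + q i j * m j i)) + group_sum (\<lambda>g. vec 0 + pm_scale (d g) 1) \<in> I"
    by (simp add: ordered_part_ordered_quadratic)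
  note z = sparse_normal_form[OF PBW this]
  show "i < j \<Longrightarrow> m i j + q i j * m j i = 0" "g \<in> G \<Longrightarrow> d g = 0"
    using z by blast+
qed

lemma pbw_imp_relations:
  assumes PBW: "\<forall>u\<in>I \<inter> normal_forms. u = 0"
  shows "h \<in> G \<Longrightarrow> kap h i i = 0"
    and "i < j \<Longrightarrow> q i j * q j i = 1"
    and "h \<in> G \<Longrightarrow> i < j \<Longrightarrow> kap h j i = - q j i * kap h i j"
proof -
  show "kap h i i = 0" if h: "h \<in> G"
  proof -
    \<comment> \<open>The quadratic part of \<open>relator i i\<close> is \<open>1 - q i i\<close>
      times the square, so only the group part survives.\<close>
    have "skew_scale (1 - q i i) (square i) - relator i i = group_sum (\<lambda>h. vec 0 + pm_scale (kap h i i) 1)"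
      by (simp add: relator_def square_def qcomm_def pm.scale_left_diff_distrib)
    moreover have "\<dots> = tt (ordered_quadratic (\<lambda>i j. 0)) + group_sum (\<lambda>h. vec 0 + pm_scale (kap h i i) 1)"
      by (simp add: ordered_quadratic_zero)
    ultimately have "tt (ordered_quadratic (\<lambda>i j. 0)) + group_sum (\<lambda>h. vec 0 + pm_scale (kap h i i) 1) \<in> I"
      by (metis I_diff I_skew_scale relator_I square_I)
    from sparse_normal_form(3)[OF PBW this h] show ?thesis .
  qed
  have *: "q i j * q j i = 1 \<and> (\<forall>h\<in>G. kap h j i = - q j i * kap h i j)" if "i < j" for i j
  proof -
    let ?m = "\<lambda>a b. if a = i \<and> b = j then 1 - q i j * q j i else 0"
    have Q: "ordered_quadratic ?m = pm_scale (1 - q i j * q j i) (gen i * gen j)"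
      using that by (intro free_alg_eqI) (auto simp: lookup_ordered_quadratic gen_eq_word_elem lookup_word_elem split: list.split)
    \<comment> \<open>The factor \<open>q j i\<close> is chosen to cancel the reducible word
      \<open>v_j v_i\<close> between the relations for both orders of the pair.\<close>
    have "skew_scale (q j i) (relator i j) + relator j i = tt (ordered_quadratic ?m) + group_sum (\<lambda>h. vec 0 + pm_scale (- kap h j i - q j i * kap h i j) 1)"
      by (intro poly_mapping_eqI)
        (simp add: Q relator_def qcomm_def lookup_group_sum lookup_add lookup_minus lookup_single when_def algebra_simps)
    moreover have "skew_scale (q j i) (relator i j) + relator j i \<in> I"
      by (intro I_add I_skew_scale relator_I)
    ultimately have mem: "tt (ordered_quadratic ?m) + group_sum (\<lambda>h. vec 0 + pm_scale (- kap h j i - q j i * kap h i j) 1) \<in> I"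
      by simp
    have "kap h j i = - q j i * kap h i j" if "h \<in> G" for h
      using sparse_normal_form(3)[OF PBW mem that] by (metis minus_minus minus_mult_left right_minus_eq)
    then show ?thesis
      using sparse_normal_form(1)[OF PBW mem \<open>i < j\<close>] by simp
  qed
  show "i < j \<Longrightarrow> q i j * q j i = 1" "h \<in> G \<Longrightarrow> i < j \<Longrightarrow> kap h j i = - q j i * kap h i j"
    using * by blast+
qed

lemma pbw_imp_q_symmetric:
  assumes PBW: "\<forall>u\<in>I \<inter> normal_forms. u = 0" and "i \<noteq> j"
  shows "q i j = inverse (q j i)"
proof -
  have "q i j * q j i = 1"
    using pbw_imp_relations(2)[OF PBW, of i j] pbw_imp_relations(2)[OF PBW, of j i] assms(2)
    by (cases i j rule: linorder_cases) (simp_all add: mult.commute)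
  then show ?thesis by (metis inverse_unique mult.commute)
qed

lemma pbw_imp_quantum_2_form:
  assumes PBW: "\<forall>u\<in>I \<inter> normal_forms. u = 0"
  shows "quantum_2_form v q \<kappa>"
  unfolding quantum_2_form_iff
proof (intro ballI allI conjI)
  fix h and i j :: 'n assume h: "h \<in> G"
  show "kap h i i = 0" by (rule pbw_imp_relations(1)[OF PBW h])
  show "kap h j i = - inverse (q i j) * kap h i j"
  proof (cases i j rule: linorder_cases)
    case less
    then show ?thesis
      using pbw_imp_relations(3)[OF PBW h less] pbw_imp_q_symmetric[OF PBW, of j i] by simp
  next
    case equal
    then show ?thesis using pbw_imp_relations(1)[OF PBW h] by simp
  next
    case greater
    then show ?thesis
      using pbw_imp_relations(3)[OF PBW h greater] q_nonzero[of i j] by (simp add: field_simps)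
  qed
qed

text \<open>\<open>overlap_distinct\<close> solved for its group sum; all other terms are multiples
  of relators.\<close>

lemma pbw_imp_overlap_vec:
  assumes PBW: "\<forall>u\<in>I \<inter> normal_forms. u = 0" and h: "h \<in> G"
  shows "overlap_vec h i j k = 0"
proof -
  have "group_sum (\<lambda>h. vec (overlap_vec h i j k)) =
    skew_scale (q i j) (relator i k \<star> tt (gen j)) + skew_scale (q i j * q i k) (tt (gen i) \<star> relator j k)
    - skew_scale (q j k) (tt (gen j) \<star> relator i k) - skew_scale (q j k * q i k) (relator i j \<star> tt (gen k))
    - (relator j k \<star> tt (gen i) - tt (gen k) \<star> relator i j)"
    unfolding overlap_distinct by simp
  also have "\<dots> \<in> I"
    by (intro I_diff I_add I_skew_scale I_mul_left I_mul_right relator_I S_single G_id)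
  finally show ?thesis by (rule group_sum_vec_I[OF PBW _ h])
qed

lemma pbw_imp_left_right:
  assumes PBW: "\<forall>u\<in>I \<inter> normal_forms. u = 0" and h: "h \<in> G"
  shows "kap h i j *s q i j *s v i + kap h i j *s h (v i) = 0"
    "kap h i j *s q i j *s h (v j) + kap h i j *s v j = 0"
proof -
  have "group_sum (\<lambda>h. vec (kap h i j *s q i j *s v i + kap h i j *s h (v i))) =
    - skew_scale (q i j) (tt (gen i) \<star> relator i j) - skew_scale (q i j * q i j) (square i \<star> tt (gen j))
    - (relator i j \<star> tt (gen i) - tt (gen j) \<star> square i)"
    unfolding overlap_right by simp
  also have "\<dots> \<in> I"
    by (intro I_diff I_uminus I_skew_scale I_mul_left I_mul_right relator_I square_I S_single G_id)
  finally show "kap h i j *s q i j *s v i + kap h i j *s h (v i) = 0" by (rule group_sum_vec_I[OF PBW _ h])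
  have "group_sum (\<lambda>h. vec (kap h i j *s q i j *s h (v j) + kap h i j *s v j)) =
    (square j \<star> tt (gen i) - tt (gen j) \<star> relator i j)
    - (skew_scale (q i j) (relator i j \<star> tt (gen j)) + skew_scale (q i j * q i j) (tt (gen i) \<star> square j))"
    unfolding overlap_left by simp
  also have "\<dots> \<in> I"
    by (intro I_diff I_add I_skew_scale I_mul_left I_mul_right relator_I square_I S_single G_id)
  finally show "kap h i j *s q i j *s h (v j) + kap h i j *s v j = 0" by (rule group_sum_vec_I[OF PBW _ h])
qed

lemma pbw_imp_equivariance:
  assumes PBW: "\<forall>u\<in>I \<inter> normal_forms. u = 0" and "g \<in> G" and h: "h \<in> G"
  shows "kap (inv\<^bsub>GL scale\<^esub> h \<otimes>\<^bsub>GL scale\<^esub> g \<otimes>\<^bsub>GL scale\<^esub> h) r s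
      = (\<Sum>(i, j) | i < j. qdet scale v q r s i j h * kap g i j)"
    and "(\<Sum>(i, j) | i < j. ent h i r * ent h j r * kap g i j) = 0"
  using conj_normal_form(2)[OF PBW h relator_I conj_relator[OF h, of r s] \<open>g \<in> G\<close>]
    conj_normal_form(2)[OF PBW h square_I conj_square[OF h, of r] \<open>g \<in> G\<close>] by simp_all

lemma pbw_imp_preserves_qext:
  assumes PBW: "\<forall>u\<in>I \<inter> normal_forms. u = 0"
  shows preserves_qext
  unfolding preserves_qext_def
  using conj_normal_form(1)[OF PBW _ relator_I conj_relator] conj_normal_form(1)[OF PBW _ square_I conj_square]
  by blast

subsection \<open>The rewriting system\<close>

definition basis_elem :: "'n list \<times> ('v \<Rightarrow> 'v) \<Rightarrow> ('v \<Rightarrow> 'v) \<Rightarrow>\<^sub>0 ('n, 'k) free_alg" where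
  "basis_elem x = Poly_Mapping.single (snd x) (word_elem (fst x))"

text \<open>Length is compared first, letters only afterwards. Group elements are not compared at
  all: reduction changes them without control.\<close>

abbreviation below :: "('n list \<times> 'n list) set" where "below \<equiv> lenlex {(i, j). i < j}"

lemma wf_below: "wf below"
proof (rule wf_lenlex)
  show "wf {(i :: 'n, j). i < j}"
    by (rule wf_subset[OF wf_measure[of "\<lambda>i. card {..<i}"]]) (auto intro!: psubset_card_mono)
qed

lemma lookup_basis_elem: "Poly_Mapping.lookup (Poly_Mapping.lookup (basis_elem x) g) (Fmon w) = (if x = (w, g) then 1 else 0)"
  by (cases x) (auto simp: basis_elem_def lookup_single lookup_word_elem when_def)

lemma inj_basis_elem: "inj basis_elem"
proof (rule injI)
  fix x y assume "basis_elem x = basis_elem y"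
  with lookup_basis_elem[of x "snd x" "fst x"] have "Poly_Mapping.lookup (Poly_Mapping.lookup (basis_elem y) (snd x)) (Fmon (fst x)) = (1 :: 'k)"
    by simp
  then show "x = y" unfolding lookup_basis_elem by (simp split: if_splits)
qed

lemma indep_basis_elem: "skew_scale.independent (range basis_elem)"
  unfolding skew_scale.dependent_def
proof clarify
  fix w g assume "basis_elem (w, g) \<in> skew_scale.span (range basis_elem - {basis_elem (w, g)})"
  moreover have "skew_scale.subspace {u. Poly_Mapping.lookup (Poly_Mapping.lookup u g) (Fmon w) = (0 :: 'k)}"
    by (auto simp: skew_scale.subspace_def lookup_add)
  ultimately have "Poly_Mapping.lookup (Poly_Mapping.lookup (basis_elem (w, g)) g) (Fmon w) = (0 :: 'k)"
    by (rule skew_scale.span_induct[of _ _ "\<lambda>u. Poly_Mapping.lookup (Poly_Mapping.lookup u g) (Fmon w) = 0"])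
      (auto simp: lookup_basis_elem)
  then show False by (simp add: lookup_basis_elem)
qed

section \<open>Degrees and the order on words\<close>

definition homogeneous :: "nat \<Rightarrow> ('n, 'k) free_alg set" where
  "homogeneous n = pm.span {word_elem w | w. length w = n}"

lemma homogeneous_word_elem: "word_elem w \<in> homogeneous (length w)"
  unfolding homogeneous_def by (rule pm.span_base) auto

lemma homogeneous_induct:
  assumes "a \<in> homogeneous n" "\<And>w. length w = n \<Longrightarrow> X (word_elem w) \<in> skew_scale.span T"
    "\<And>a b. X (a + b) = X a + X b" "\<And>c a. X (pm_scale c a) = skew_scale c (X a)"
  shows "X a \<in> skew_scale.span T"
proof -
  have "X 0 = 0" using assms(4)[of 0 0] by simp
  then have "pm.subspace {a. X a \<in> skew_scale.span T}"
    by (auto simp: pm.subspace_def assms skew_scale.span_zero skew_scale.span_add skew_scale.span_scale)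
  from pm.span_induct[OF assms(1)[unfolded homogeneous_def] this] show ?thesis using assms(2) by auto
qed

lemma homogeneous_mult:
  assumes "a \<in> homogeneous m" "b \<in> homogeneous n"
  shows "a * b \<in> homogeneous (m + n)"
proof -
  have s: "pm.subspace (homogeneous k)" for k unfolding homogeneous_def by (rule pm.subspace_span)
  have "pm.subspace {a. \<forall>w. length w = n \<longrightarrow> a * word_elem w \<in> homogeneous (m + n)}"
    using s[of "m + n"] by (auto simp: pm.subspace_def distrib_right)
  moreover have "word_elem x * word_elem w \<in> homogeneous (m + n)" if "length x = m" "length w = n" for x w
    using homogeneous_word_elem[of "x @ w"] that by simp
  ultimately have 1: "\<forall>w. length w = n \<longrightarrow> a * word_elem w \<in> homogeneous (m + n)"
    using pm.span_induct[OF assms(1)[unfolded homogeneous_def], of "\<lambda>a. \<forall>w. length w = n \<longrightarrow> a * word_elem w \<in> homogeneous (m + n)"]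
    by blast
  have "pm.subspace {b. a * b \<in> homogeneous (m + n)}"
    using s[of "m + n"] by (auto simp: pm.subspace_def distrib_left)
  from pm.span_induct[OF assms(2)[unfolded homogeneous_def] this] show ?thesis using 1 by auto
qed

text \<open>The action mixes letters but keeps lengths, and the length is all the order needs for
  terms that have become shorter.\<close>

lemma homogeneous_act: "act h (word_elem w) \<in> homogeneous (length w)"
proof (induction w)
  case Nil
  then show ?case using homogeneous_word_elem[of "[]"] by (simp add: word_elem_Nil)
next
  case (Cons i w)
  have "vec (h (v i)) \<in> homogeneous 1"
    unfolding vec_incl_def gen_eq_word_elem homogeneous_def by (intro pm.span_sum pm.span_scale pm.span_base) auto
  from homogeneous_mult[OF this Cons] show ?case by (simp add: tensor_act_word_elem)
qed

text \<open>One relation for each reducible two-letter word. On the diagonal it must be the square: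
  \<open>relator i i\<close> may have leading coefficient 0.\<close>

definition lead_relation :: "'n \<Rightarrow> 'n \<Rightarrow> ('v \<Rightarrow> 'v) \<Rightarrow>\<^sub>0 ('n, 'k) free_alg" where
  "lead_relation i j = (if i = j then square i else relator i j)"

definition remainder :: "'n \<Rightarrow> 'n \<Rightarrow> ('v \<Rightarrow> 'v) \<Rightarrow>\<^sub>0 ('n, 'k) free_alg" where
  "remainder i j = (if i = j then 0 else skew_scale (q i j) (tt (word_elem [i, j])) + group_sum (\<lambda>h. pm_scale (kap h i j) 1))"

lemma lead_relation_remainder: "lead_relation i j = tt (word_elem [j, i]) - remainder i j"
  by (auto simp: lead_relation_def remainder_def relator_def square_def qcomm_def gen_eq_word_elem single_diff)

lemma S_lead_relation: "lead_relation i j \<in> carrier S"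
  by (simp add: lead_relation_def S_relator S_square)

lemma tt_mul: "tt a \<star> (tt b \<star> u) = tt (a * b) \<star> u"
  by (simp add: mul_assoc[symmetric] G_id)

lemma tt_basis_elem: "tt (word_elem A) \<star> basis_elem (D, g) = basis_elem (A @ D, g)"
  by (simp add: basis_elem_def)

lemma remainder_basis_elem: "tt (word_elem A) \<star> (remainder i j \<star> basis_elem (D, g)) = (if i = j then 0 else skew_scale (q i j) (basis_elem (A @ [i, j] @ D, g))
   + (\<Sum>h\<in>G. skew_scale (kap h i j) (Poly_Mapping.single (h \<circ> g) (word_elem A * act h (word_elem D)))))"
  by (simp add: remainder_def skew_mult_add_left skew_mult_add_right skew_mult_scale_left skew_mult_scale_right group_sum_def
      skew_mult_sum_left skew_mult_sum_right basis_elem_def)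

lemma single_homogeneous:
  assumes "a \<in> homogeneous n" "g \<in> Q" "\<And>w'. length w' = n \<Longrightarrow> (w', w) \<in> below"
  shows "Poly_Mapping.single g a \<in> skew_scale.span (basis_elem ` {(w', g). (w', w) \<in> below \<and> g \<in> Q})"
proof (rule homogeneous_induct[OF assms(1)])
  fix w' :: "'n list" assume "length w' = n"
  then show "Poly_Mapping.single g (word_elem w') \<in> skew_scale.span (basis_elem ` {(w', g). (w', w) \<in> below \<and> g \<in> Q})"
    using assms by (intro skew_scale.span_base image_eqI[of _ _ "(w', g)"]) (auto simp: basis_elem_def)
qed (simp_all add: single_add)

lemma below_length: "length w' < length w \<Longrightarrow> (w', w) \<in> below"
  by (simp add: lenlex_conv)

lemma below_swap: "i < j \<Longrightarrow> length B = length B' \<Longrightarrow> (A @ i # B, A @ j # B') \<in> below"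
  by (simp add: Cons_lenlex_iff irrefl_def)

text \<open>The swapped word is smaller at the first changed letter, the \<open>\<kappa>\<close>
  terms are shorter by two. \<open>Q\<close> will be \<open>G\<close> when reducts have to stay in
  the carrier, and \<open>UNIV\<close> for functionals on the whole ambient space.\<close>

lemma remainder_below:
  assumes "i \<le> j" "g \<in> Q" "\<And>h g. h \<in> G \<Longrightarrow> g \<in> Q \<Longrightarrow> h \<circ> g \<in> Q"
  shows "tt (word_elem A) \<star> (remainder i j \<star> basis_elem (D, g)) \<in> skew_scale.span (basis_elem ` {(w', g). (w', A @ [j, i] @ D) \<in> below \<and> g \<in> Q})"
proof (cases "i = j")
  case True
  then show ?thesis by (simp add: remainder_def skew_scale.span_zero)
next
  case False
  with assms have "i < j" by simp
  have "basis_elem (A @ [i, j] @ D, g) \<in> skew_scale.span (basis_elem ` {(w', g). (w', A @ [j, i] @ D) \<in> below \<and> g \<in> Q})"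
    using \<open>i < j\<close> assms by (intro skew_scale.span_base imageI) (auto simp: below_swap)
  moreover have "Poly_Mapping.single (h \<circ> g) (word_elem A * act h (word_elem D))
      \<in> skew_scale.span (basis_elem ` {(w', g). (w', A @ [j, i] @ D) \<in> below \<and> g \<in> Q})" if "h \<in> G" for h
    by (rule single_homogeneous[OF homogeneous_mult[OF homogeneous_word_elem homogeneous_act]]) (auto intro: assms that below_length)
  ultimately show ?thesis
    unfolding remainder_basis_elem using False by (auto intro!: skew_scale.span_add skew_scale.span_sum skew_scale.span_scale simp del: skew_scale_single)
qed

text \<open>What may be used to resolve an ambiguity at the word \<open>w\<close>: instances of
  relations with smaller leading word, whatever their group element.\<close>

definition lower_relations :: "'n list \<Rightarrow> (('v \<Rightarrow> 'v) \<Rightarrow>\<^sub>0 ('n, 'k) free_alg) set" where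
  "lower_relations w = skew_scale.span {tt (word_elem A) \<star> (lead_relation i j \<star> basis_elem (D, g)) | A i j D g. i \<le> j \<and> (A @ [j, i] @ D, w) \<in> below}"

lemma lower_relations_base: "i \<le> j \<Longrightarrow> (A @ [j, i] @ D, w) \<in> below \<Longrightarrow> tt (word_elem A) \<star> (lead_relation i j \<star> basis_elem (D, g)) \<in> lower_relations w"
  unfolding lower_relations_def by (rule skew_scale.span_base) blast

text \<open>The contexts need not be words: with the leading word of length 2 the total degree stays
  below the length of \<open>w\<close>, so every word occurring is smaller.\<close>

lemma lower_relations_homogeneous:
  assumes "a \<in> homogeneous m" "d \<in> homogeneous n" "i \<le> j" "m + 2 + n < length w"
  shows "tt a \<star> (lead_relation i j \<star> Poly_Mapping.single g d) \<in> lower_relations w"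
  unfolding lower_relations_def
proof (rule homogeneous_induct[OF assms(1)])
  fix A :: "'n list" assume A: "length A = m"
  show "tt (word_elem A) \<star> (lead_relation i j \<star> Poly_Mapping.single g d) \<in>
    skew_scale.span {tt (word_elem A) \<star> (lead_relation i j \<star> basis_elem (D, g)) | A i j D g. i \<le> j \<and> (A @ [j, i] @ D, w) \<in> below}"
  proof (rule homogeneous_induct[OF assms(2)])
    fix D :: "'n list" assume "length D = n"
    then show "tt (word_elem A) \<star> (lead_relation i j \<star> Poly_Mapping.single g (word_elem D)) \<in>
      skew_scale.span {tt (word_elem A) \<star> (lead_relation i j \<star> basis_elem (D, g)) | A i j D g. i \<le> j \<and> (A @ [j, i] @ D, w) \<in> below}"
      using lower_relations_base[of i j A D w g] A assms by (simp add: basis_elem_def below_length lower_relations_def)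
  qed (simp_all add: single_add skew_mult_add_right skew_mult_scale_right skew_scale_single[symmetric] del: skew_scale_single)
qed (simp_all add: single_add skew_mult_add_left skew_mult_scale_left skew_scale_single[symmetric] del: skew_scale_single)

lemma lead_relation_less: "i < j \<Longrightarrow> lead_relation i j = relator i j" and lead_relation_same: "lead_relation i i = square i"
  by (auto simp: lead_relation_def)

lemma relator_comb_lead_relation: "relator_comb m = (\<Sum>(i, j) | i < j. skew_scale (m j i) (lead_relation i j)) + (\<Sum>i\<in>UNIV. skew_scale (m i i) (lead_relation i i))"
  unfolding relator_comb_def by (intro arg_cong2[of _ _ _ _ "(+)"] sum.cong) (auto simp: lead_relation_def)

lemma lower_relations_subspace: "skew_scale.subspace (lower_relations w)"
  unfolding lower_relations_def by (rule skew_scale.subspace_span)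

text \<open>Stated for a linear \<open>X\<close> and any subspace, as it serves both for
  \<open>lower_relations\<close> and for the kernel of a functional.\<close>

lemma relator_comb_mem_subspace:
  assumes T: "skew_scale.subspace T" and "\<And>i j. i \<le> j \<Longrightarrow> X (lead_relation i j) \<in> T"
    and add: "\<And>x y. X (x + y) = X x + X y" and sc: "\<And>c x. X (skew_scale c x) = skew_scale c (X x)"
  shows "X (relator_comb m) \<in> T"
proof -
  have "X 0 = 0" using sc[of 0 0] by simp
  then have "skew_scale.subspace {x. X x \<in> T}"
    by (auto simp: skew_scale.subspace_def add sc skew_scale.subspace_0[OF T] skew_scale.subspace_add[OF T] skew_scale.subspace_scale[OF T])
  moreover have "skew_scale c (lead_relation i j) \<in> skew_scale.span {lead_relation i j | i j. i \<le> j}" if "i \<le> j" for c i j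
    using that by (intro skew_scale.span_scale skew_scale.span_base) blast
  then have "relator_comb m \<in> skew_scale.span {lead_relation i j | i j. i \<le> j}"
    unfolding relator_comb_lead_relation by (auto intro!: skew_scale.span_add skew_scale.span_sum less_imp_le)
  ultimately show ?thesis
    using skew_scale.span_induct[of "relator_comb m" "{lead_relation i j | i j. i \<le> j}" "\<lambda>x. X x \<in> T"] assms(2) by auto
qed

lemma lower_relations_relator_comb:
  assumes "a \<in> homogeneous m" "d \<in> homogeneous n" "m + 2 + n < length w"
  shows "tt a \<star> (relator_comb c \<star> Poly_Mapping.single g d) \<in> lower_relations w"
  by (rule relator_comb_mem_subspace[OF lower_relations_subspace, where X = "\<lambda>x. tt a \<star> (x \<star> Poly_Mapping.single g d)"])
    (simp_all add: lower_relations_homogeneous[OF assms(1,2) _ assms(3)] skew_mult_add_left skew_mult_add_right skew_mult_scale_left skew_mult_scale_right)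

lemma lower_relations_left:
  assumes "x \<le> y" "(A @ [y, x, z] @ D, w) \<in> below"
  shows "tt (word_elem A) \<star> ((lead_relation x y \<star> tt (gen z)) \<star> basis_elem (D, g)) \<in> lower_relations w"
proof -
  have "(lead_relation x y \<star> tt (gen z)) \<star> basis_elem (D, g) = lead_relation x y \<star> basis_elem (z # D, g)"
    using S_lead_relation tt_basis_elem[of "[z]" D g] by (simp add: mul_assoc S_carrier gen_eq_word_elem)
  then show ?thesis using lower_relations_base[of x y A "z # D" w g] assms by simp
qed

lemma lower_relations_right:
  assumes "x \<le> y" "(A @ [z, y, x] @ D, w) \<in> below"
  shows "tt (word_elem A) \<star> ((tt (gen z) \<star> lead_relation x y) \<star> basis_elem (D, g)) \<in> lower_relations w"
proof -
  have "tt (word_elem A) \<star> ((tt (gen z) \<star> lead_relation x y) \<star> basis_elem (D, g)) = tt (word_elem (A @ [z])) \<star> (lead_relation x y \<star> basis_elem (D, g))"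
    by (simp add: mul_assoc G_id tt_mul gen_eq_word_elem)
  then show ?thesis using lower_relations_base[of x y "A @ [z]" D w g] assms by simp
qed

text \<open>Each reduction changes an element only by a member of the ideal, and reduction
  terminates.\<close>

lemma spanning: "\<forall>u\<in>carrier S. \<exists>z\<in>carrier S \<inter> normal_forms. u - z \<in> I"
proof
  let ?T = "{u. \<exists>z\<in>carrier S \<inter> normal_forms. u - z \<in> I}"
  have normal_forms: "skew_scale.subspace (carrier S \<inter> normal_forms)"
    unfolding skew_scale.subspace_def
    by (auto simp: S_zero S_add S_skew_scale normal_forms_def lookup_add) (metis add_0)
  have T: "skew_scale.subspace ?T"
    unfolding skew_scale.subspace_def
  proof (intro conjI ballI allI)
    show "0 \<in> ?T" using skew_scale.subspace_0[OF normal_forms] I_zero by force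
    fix x assume "x \<in> ?T"
    then obtain z where z: "z \<in> carrier S \<inter> normal_forms" "x - z \<in> I" by auto
    show "skew_scale c x \<in> ?T" for c
      using skew_scale.subspace_scale[OF normal_forms z(1), of c] I_skew_scale[OF z(2), of c] by (auto simp: skew_scale.scale_right_diff_distrib)
    fix y assume "y \<in> ?T"
    then obtain z' where z': "z' \<in> carrier S \<inter> normal_forms" "y - z' \<in> I" by auto
    have "(x + y) - (z + z') \<in> I" using I_add[OF z(2) z'(2)] by (simp add: algebra_simps)
    then show "x + y \<in> ?T" using skew_scale.subspace_add[OF normal_forms z(1) z'(1)] by blast
  qed
  \<comment> \<open>All \<open>g\<close> are treated at once, since the reducts of
    \<open>(w, g)\<close> carry group elements \<open>h \<circ> g\<close>.\<close>
  have basis_elem_T: "\<forall>g\<in>G. basis_elem (w, g) \<in> ?T" for w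
    using wf_below
  proof (induction w rule: wf_induct_rule)
    case (less w)
    show ?case
    proof
      fix g assume g: "g \<in> G"
      show "basis_elem (w, g) \<in> ?T"
      proof (cases "sorted_wrt (<) w")
        case True
        then have "basis_elem (w, g) \<in> normal_forms" by (simp add: normal_forms_def lookup_basis_elem)
        moreover have "basis_elem (w, g) \<in> carrier S" using g by (simp add: basis_elem_def S_single)
        ultimately have "basis_elem (w, g) \<in> carrier S \<inter> normal_forms" by blast
        then show ?thesis using I_zero by force
      next
        case False
        then obtain A i j D where w: "i \<le> j" "w = A @ [j, i] @ D"
          unfolding not_strictly_sorted_split by blast
        have "basis_elem (w, g) - tt (word_elem A) \<star> (remainder i j \<star> basis_elem (D, g)) = tt (word_elem A) \<star> (lead_relation i j \<star> basis_elem (D, g))"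
          using w tt_basis_elem[of "A @ [j, i]" D g] by (simp add: lead_relation_remainder skew_mult_diff_left skew_mult_diff_right tt_mul tt_basis_elem)
        also have "\<dots> \<in> I"
        proof -
          have "lead_relation i j \<in> I" by (simp add: lead_relation_def relator_I square_I)
          then show ?thesis using g by (intro I_mul_left I_mul_right) (simp_all add: basis_elem_def S_single G_id)
        qed
        finally have *: "basis_elem (w, g) - tt (word_elem A) \<star> (remainder i j \<star> basis_elem (D, g)) \<in> I" .
        have "tt (word_elem A) \<star> (remainder i j \<star> basis_elem (D, g)) \<in> skew_scale.span (basis_elem ` {(w', g). (w', A @ [j, i] @ D) \<in> below \<and> g \<in> G})"
          by (rule remainder_below[OF w(1) g G_comp])
        also have "\<dots> \<subseteq> skew_scale.span ?T"
          by (rule skew_scale.span_mono) (use less w in auto)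
        also have "\<dots> = ?T" by (rule skew_scale.span_eq_iff[THEN iffD2, OF T])
        finally obtain z where "z \<in> carrier S \<inter> normal_forms" "tt (word_elem A) \<star> (remainder i j \<star> basis_elem (D, g)) - z \<in> I" by auto
        then show ?thesis using I_add[OF *] by force
      qed
    qed
  qed
  fix u assume u: "u \<in> carrier S"
  have "Poly_Mapping.single h (Poly_Mapping.single x c) \<in> ?T" if "h \<in> G" for h x c
    using skew_scale.subspace_scale[OF T, of "basis_elem (letters x, h)" c] basis_elem_T[of "letters x"] that by (simp add: basis_elem_def word_elem_def)
  then have "(\<Sum>h\<in>Poly_Mapping.keys u. Poly_Mapping.single h (\<Sum>x\<in>Poly_Mapping.keys (Poly_Mapping.lookup u h).
        Poly_Mapping.single x (Poly_Mapping.lookup (Poly_Mapping.lookup u h) x))) \<in> ?T"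
    unfolding single_sum using u by (intro skew_scale.subspace_sum[OF T]) (auto simp: S_carrier)
  then have "u \<in> ?T" by (simp add: poly_mapping_sum_single)
  then show "\<exists>z\<in>carrier S \<inter> normal_forms. u - z \<in> I" by blast
qed

text \<open>Termination settles spanning; what can fail is the uniqueness of normal forms.\<close>

lemma pbw_iff_no_normal: "truncated_quantum_drinfeld_hecke scale v G q \<kappa> \<longleftrightarrow> (\<forall>u\<in>I \<inter> normal_forms. u = 0)"
  unfolding pbw_iff eqTrueI[OF spanning] simp_thms ..

end

subsection \<open>Sufficiency of the conditions\<close>

locale tqdh_conditions = tqdh_data scale v G q \<kappa>
  for scale :: "'k::field \<Rightarrow> 'v::ab_group_add \<Rightarrow> 'v"  (infixr \<open>*s\<close> 75)
    and v :: "'n::{finite,linorder} \<Rightarrow> 'v"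
    and G :: "('v \<Rightarrow> 'v) set"
    and q :: "'n \<Rightarrow> 'n \<Rightarrow> 'k"
    and \<kappa> :: "'v \<Rightarrow> 'v \<Rightarrow> ('v \<Rightarrow> 'v) \<Rightarrow>\<^sub>0 'k" +
  assumes q_symmetric: "i \<noteq> j \<Longrightarrow> q i j = inverse (q j i)"
    and form: "quantum_2_form v q \<kappa>"
    and ext: preserves_qext
    and overlap_vec_zero: "h \<in> G \<Longrightarrow> i < j \<Longrightarrow> j < k \<Longrightarrow> overlap_vec h i j k = 0"
    and equivariant: "g \<in> G \<Longrightarrow> h \<in> G \<Longrightarrow> r < s \<Longrightarrow>
       kap (inv\<^bsub>GL scale\<^esub> h \<otimes>\<^bsub>GL scale\<^esub> g \<otimes>\<^bsub>GL scale\<^esub> h) r s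
         = (\<Sum>(i, j) | i < j. qdet scale v q r s i j h * kap g i j)"
    and left_zero: "h \<in> G \<Longrightarrow> i < j \<Longrightarrow> kap h i j *s q i j *s v i + kap h i j *s h (v i) = 0"
    and right_zero: "h \<in> G \<Longrightarrow> i < j \<Longrightarrow> kap h i j *s q i j *s h (v j) + kap h i j *s v j = 0"
    and square_zero: "g \<in> G \<Longrightarrow> h \<in> G \<Longrightarrow> (\<Sum>(i, j) | i < j. ent h i r * ent h j r * kap g i j) = 0"
begin

section \<open>Resolving the ambiguities\<close>

lemma group_sum_zero: "(\<And>h. h \<in> G \<Longrightarrow> f h = 0) \<Longrightarrow> group_sum f = 0"
  unfolding group_sum_def by (intro sum.neutral) simp

text \<open>Both defects of conjugation vanish by the conditions. Group elements can now cross
  relations, at the price of a combination of relations of which only the existence matters.\<close>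

lemma conj_lead_relation:
  assumes h: "h \<in> G" and "r \<le> s"
  obtains m where "gg h \<star> lead_relation r s = relator_comb m \<star> gg h"
proof (cases "r = s")
  case True
  have "gg h \<star> square r = relator_comb (square_matrix h r) \<star> gg h"
    using conj_square[OF h, of r] preserves_qext_imp_ordered_part(2)[OF ext h, of r] h
    by (simp add: group_sum_zero square_zero)
  then show thesis using True that by (simp add: lead_relation_def)
next
  case False
  then have "r < s" using assms by simp
  have "gg h \<star> relator r s = relator_comb (relator_matrix h r s) \<star> gg h"
    using conj_relator[OF h, of r s] preserves_qext_imp_ordered_part(1)[OF ext h False] h equivariant[OF _ h \<open>r < s\<close>]
    by (simp add: group_sum_zero)
  then show thesis using False that by (simp add: lead_relation_def)
qed

lemma lead_relation_overlap:
  assumes "i \<le> j" "j \<le> k"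
  shows "tt (word_elem A) \<star> ((lead_relation j k \<star> tt (gen i) - tt (gen k) \<star> lead_relation i j) \<star> basis_elem (D, g)) \<in> lower_relations (A @ [k, j, i] @ D)"
proof -
  note sub = skew_scale.subspace_add[OF lower_relations_subspace] skew_scale.subspace_diff[OF lower_relations_subspace]
    skew_scale.subspace_scale[OF lower_relations_subspace] skew_scale.subspace_neg[OF lower_relations_subspace] skew_scale.subspace_0[OF lower_relations_subspace]
  note dist = skew_mult_add_left skew_mult_add_right skew_mult_diff_left skew_mult_diff_right skew_mult_scale_left skew_mult_scale_right
    skew_mult_uminus_left skew_mult_uminus_right
  consider "i < j" "j < k" | "i < j" "j = k" | "i = j" "j < k" | "i = j" "j = k"
    using assms le_less by metis
  then show ?thesis
  proof cases
    case 1
    then have "i < k" by simp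
    have "lead_relation j k \<star> tt (gen i) - tt (gen k) \<star> lead_relation i j =
      skew_scale (q i j) (lead_relation i k \<star> tt (gen j)) + skew_scale (q i j * q i k) (tt (gen i) \<star> lead_relation j k)
      - skew_scale (q j k) (tt (gen j) \<star> lead_relation i k) - skew_scale (q j k * q i k) (lead_relation i j \<star> tt (gen k))"
      using 1 \<open>i < k\<close> overlap_distinct[of j k i] by (simp add: lead_relation_less group_sum_zero overlap_vec_zero)
    \<comment> \<open>The leading words of the four products are \<open>k i j\<close>,
      \<open>i k j\<close>, \<open>j k i\<close> and \<open>j i k\<close>, all smaller than
      \<open>k j i\<close>.\<close>
    then show ?thesis
      using 1 \<open>i < k\<close> by (simp only: dist) (intro sub lower_relations_left lower_relations_right; simp add: Cons_lenlex_iff irrefl_def)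
  next
    case 2
    have "group_sum (\<lambda>h. vec (kap h i j *s q i j *s h (v j) + kap h i j *s v j)) = 0"
      by (rule group_sum_zero) (simp only: right_zero[OF _ 2(1)] vec_zero)
    with 2 have "lead_relation j k \<star> tt (gen i) - tt (gen k) \<star> lead_relation i j =
      skew_scale (q i j) (lead_relation i j \<star> tt (gen j)) + skew_scale (q i j * q i j) (tt (gen i) \<star> lead_relation j j)"
      using overlap_left[of j i] by (simp add: lead_relation_less lead_relation_same)
    then show ?thesis
      using 2 by (simp only: dist) (intro sub lower_relations_left lower_relations_right; simp add: Cons_lenlex_iff irrefl_def)
  next
    case 3
    have "group_sum (\<lambda>h. vec (kap h i k *s q i k *s v i + kap h i k *s h (v i))) = 0"
      using 3 by (intro group_sum_zero) (simp only: left_zero vec_zero)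
    with 3 have "lead_relation j k \<star> tt (gen i) - tt (gen k) \<star> lead_relation i j =
      - skew_scale (q i k) (tt (gen i) \<star> lead_relation i k) - skew_scale (q i k * q i k) (lead_relation i i \<star> tt (gen k))"
      using overlap_right[of i k] by (simp add: lead_relation_less lead_relation_same)
    then show ?thesis
      using 3 by (simp only: dist) (intro sub lower_relations_left lower_relations_right; simp add: Cons_lenlex_iff irrefl_def)
  next
    case 4
    \<comment> \<open>The overlap of \<open>v_j v_j\<close> with itself: both products are the cube
      of \<open>v_j\<close>.\<close>
    then have "lead_relation j k \<star> tt (gen i) - tt (gen k) \<star> lead_relation i j = 0"
      by (simp add: lead_relation_def square_def mult.assoc)
    then show ?thesis by (simp add: sub)
  qed
qed

text \<open>For plain words two disjoint reductions commute. Here the left remainder contains group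
  elements \<open>h\<close> that stand before the right relation; \<open>conj_lead_relation\<close>
  moves them past it, and the result has smaller degree.\<close>

lemma lead_relation_disjoint:
  assumes "i \<le> j" "i' \<le> j'" and w: "w = A @ [j, i] @ C @ [j', i'] @ D"
  shows "tt (word_elem A) \<star> (lead_relation i j \<star> basis_elem (C @ [j', i'] @ D, g))
      - tt (word_elem (A @ [j, i] @ C)) \<star> (lead_relation i' j' \<star> basis_elem (D, g)) \<in> lower_relations w"
proof -
  note sub = skew_scale.subspace_add[OF lower_relations_subspace] skew_scale.subspace_diff[OF lower_relations_subspace]
    skew_scale.subspace_scale[OF lower_relations_subspace] skew_scale.subspace_neg[OF lower_relations_subspace] skew_scale.subspace_0[OF lower_relations_subspace]
    skew_scale.subspace_sum[OF lower_relations_subspace]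
  let ?u = "basis_elem (D, g)"
  have lead: "tt (word_elem [j, i]) = lead_relation i j + remainder i j" for i j by (simp add: lead_relation_remainder)
  have "tt (word_elem A) \<star> (lead_relation i j \<star> basis_elem (C @ [j', i'] @ D, g))
      - tt (word_elem (A @ [j, i] @ C)) \<star> (lead_relation i' j' \<star> ?u)
    = tt (word_elem A) \<star> (lead_relation i j \<star> (tt (word_elem C) \<star> (tt (word_elem [j', i']) \<star> ?u)))
      - tt (word_elem A) \<star> (tt (word_elem [j, i]) \<star> (tt (word_elem C) \<star> (lead_relation i' j' \<star> ?u)))"
    by (simp add: tt_mul tt_basis_elem)
  \<comment> \<open>Both leading words are replaced by relation plus remainder; the terms containing
    two relations cancel.\<close>
  also have "\<dots> = tt (word_elem A) \<star> (lead_relation i j \<star> (tt (word_elem C) \<star> (remainder i' j' \<star> ?u)))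
      - tt (word_elem A) \<star> (remainder i j \<star> (tt (word_elem C) \<star> (lead_relation i' j' \<star> ?u)))"
    unfolding lead by (simp add: skew_mult_add_left skew_mult_add_right)
  also have "\<dots> \<in> lower_relations w"
  proof (intro sub(2))
    have "tt (word_elem A) \<star> (lead_relation i j \<star> Poly_Mapping.single (h \<circ> g) (word_elem C * act h (word_elem D))) \<in> lower_relations w" for h
      by (rule lower_relations_homogeneous[OF homogeneous_word_elem homogeneous_mult[OF homogeneous_word_elem homogeneous_act]]) (simp_all add: w assms)
    moreover have "tt (word_elem A) \<star> (lead_relation i j \<star> basis_elem (C @ [i', j'] @ D, g)) \<in> lower_relations w" if "i' \<noteq> j'"
      using assms that below_swap[of i' j' "j' # D" "i' # D" "A @ [j, i] @ C"]
      by (intro lower_relations_base) (auto simp: w)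
    ultimately show "tt (word_elem A) \<star> (lead_relation i j \<star> (tt (word_elem C) \<star> (remainder i' j' \<star> ?u))) \<in> lower_relations w"
      unfolding remainder_basis_elem
      by (auto simp: skew_mult_add_right skew_mult_scale_right skew_mult_sum_right simp del: skew_scale_single intro!: sub)
  next
    have "tt (word_elem A) \<star> (gg h \<star> (tt (word_elem C) \<star> (lead_relation i' j' \<star> ?u))) \<in> lower_relations w" if h: "h \<in> G" for h
    proof -
      obtain m where m: "gg h \<star> lead_relation i' j' = relator_comb m \<star> gg h" using conj_lead_relation[OF h assms(2)] .
      have "gg h \<star> (tt (word_elem C) \<star> (lead_relation i' j' \<star> ?u)) = tt (act h (word_elem C)) \<star> (gg h \<star> (lead_relation i' j' \<star> ?u))"
        by (simp add: mul_assoc[symmetric] h G_id)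
      also have "gg h \<star> (lead_relation i' j' \<star> ?u) = relator_comb m \<star> (gg h \<star> ?u)"
        using m h I_S[OF relator_comb_I[of m]] by (simp add: mul_assoc[symmetric] S_carrier)
      finally have "tt (word_elem A) \<star> (gg h \<star> (tt (word_elem C) \<star> (lead_relation i' j' \<star> ?u)))
        = tt (word_elem A * act h (word_elem C)) \<star> (relator_comb m \<star> Poly_Mapping.single (h \<circ> g) (act h (word_elem D)))"
        by (simp add: tt_mul basis_elem_def)
      also have "\<dots> \<in> lower_relations w"
        by (rule lower_relations_relator_comb[OF homogeneous_mult[OF homogeneous_word_elem homogeneous_act] homogeneous_act]) (simp add: w)
      finally show ?thesis .
    qed
    moreover have "tt (word_elem A) \<star> (tt (word_elem [i, j]) \<star> (tt (word_elem C) \<star> (lead_relation i' j' \<star> ?u))) \<in> lower_relations w" if "i \<noteq> j"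
      using assms that below_swap[of i j "j # C @ [j', i'] @ D" "i # C @ [j', i'] @ D" A]
        lower_relations_base[of i' j' "A @ [i, j] @ C" D w g]
      by (simp add: tt_mul w)
    ultimately show "tt (word_elem A) \<star> (remainder i j \<star> (tt (word_elem C) \<star> (lead_relation i' j' \<star> ?u))) \<in> lower_relations w"
      unfolding remainder_def group_sum_def skew_scale_single[symmetric]
      by (auto simp: skew_mult_add_left skew_mult_add_right skew_mult_scale_left skew_mult_scale_right skew_mult_sum_left skew_mult_sum_right
          simp del: skew_scale_single intro!: sub)
  qed
  finally show ?thesis .
qed

lemma lead_relation_resolvable_aux:
  assumes "i \<le> j" "i' \<le> j'" "A @ [j, i] @ D = A' @ [j', i'] @ D'" "length A \<le> length A'"
  shows "tt (word_elem A) \<star> (lead_relation i j \<star> basis_elem (D, g)) - tt (word_elem A') \<star> (lead_relation i' j' \<star> basis_elem (D', g)) \<in> lower_relations (A @ [j, i] @ D)"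
proof -
  from assms(3,4) obtain B where B: "A' = A @ B" "[j, i] @ D = B @ [j', i'] @ D'"
    by (auto simp: append_eq_append_conv2)
  \<comment> \<open>\<open>B\<close> is the offset of the second leading word: zero for equal
    positions, one letter for an overlap, two or more for disjoint positions.\<close>
  consider "B = []" | "B = [j]" | C where "B = [j, i] @ C"
    using B(2) by (cases B; cases "tl B") auto
  then show ?thesis
  proof cases
    case 1
    then show ?thesis using B skew_scale.subspace_0[OF lower_relations_subspace] by simp
  next
    case 2
    then have e: "A' = A @ [j]" "j' = i" "D = i' # D'" using B by auto
    have "tt (word_elem A) \<star> (lead_relation i j \<star> basis_elem (D, g)) - tt (word_elem A') \<star> (lead_relation i' j' \<star> basis_elem (D', g))
      = tt (word_elem A) \<star> ((lead_relation i j \<star> tt (gen i') - tt (gen j) \<star> lead_relation i' i) \<star> basis_elem (D', g))"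
      using S_lead_relation[of i j] tt_basis_elem[of "[i']" D' g]
      by (simp add: e skew_mult_diff_left skew_mult_diff_right mul_assoc S_carrier G_id gen_eq_word_elem tt_mul)
    then show ?thesis
      using lead_relation_overlap[of i' i j A D' g] assms by (simp add: e)
  next
    case 3
    then show ?thesis using lead_relation_disjoint[OF assms(1,2) refl, of A C D' g] B by simp
  qed
qed

lemma lead_relation_resolvable:
  assumes "i \<le> j" "i' \<le> j'" "A @ [j, i] @ D = A' @ [j', i'] @ D'"
  shows "tt (word_elem A) \<star> (lead_relation i j \<star> basis_elem (D, g)) - tt (word_elem A') \<star> (lead_relation i' j' \<star> basis_elem (D', g)) \<in> lower_relations (A @ [j, i] @ D)"
proof (cases "length A \<le> length A'")
  case True
  then show ?thesis by (rule lead_relation_resolvable_aux[OF assms])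
next
  case False
  from lead_relation_resolvable_aux[OF assms(2,1) assms(3)[symmetric], of g] False assms(3)
  show ?thesis using skew_scale.subspace_neg[OF lower_relations_subspace] by fastforce
qed

text \<open>\<open>linear_diamond\<close> for the rules in context. A functional invariant under
  rewriting is one that vanishes on all relations in context.\<close>

lemma normal_functional:
  obtains N where "Vector_Spaces.linear skew_scale (*) N"
    "\<And>A i j D g. i \<le> j \<Longrightarrow> N (tt (word_elem A) \<star> (lead_relation i j \<star> basis_elem (D, g))) = 0"
    "\<And>w g. sorted_wrt (<) w \<Longrightarrow> N (basis_elem (w, g)) = c (w, g)"
proof -
  define T where "T = (\<lambda>A i j D g. tt (word_elem A) \<star> (lead_relation i j \<star> basis_elem (D, g)))"
  define R where "R = {((A @ [j, i] @ D, g), basis_elem (A @ [j, i] @ D, g) - T A i j D g) | A i j D g. i \<le> j}"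
  have remainder: "basis_elem (A @ [j, i] @ D, g) - T A i j D g = tt (word_elem A) \<star> (remainder i j \<star> basis_elem (D, g))" for A i j D g
    using tt_basis_elem[of "A @ [j, i]" D g]
    by (simp add: T_def lead_relation_remainder skew_mult_diff_left skew_mult_diff_right tt_mul tt_basis_elem)
  obtain N where N: "Vector_Spaces.linear skew_scale (*) N" "\<And>x f. (x, f) \<in> R \<Longrightarrow> N f = N (basis_elem x)"
    "\<And>x. (\<And>f. (x, f) \<notin> R) \<Longrightarrow> N (basis_elem x) = c x"
  proof (rule linear_diamond[OF skew_scale.vector_space_axioms inj_basis_elem indep_basis_elem, of "inv_image below fst" R c])
    show "wf (inv_image below (fst :: 'n list \<times> ('v \<Rightarrow> 'v) \<Rightarrow> _))" by (rule wf_inv_image[OF wf_below])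
  next
    fix x f assume "(x, f) \<in> R"
    then obtain A i j D g where "i \<le> j" "x = (A @ [j, i] @ D, g)" "f = tt (word_elem A) \<star> (remainder i j \<star> basis_elem (D, g))"
      unfolding R_def remainder by blast
    then show "f \<in> skew_scale.span (basis_elem ` {y. (y, x) \<in> inv_image below fst})"
      using remainder_below[of i j g UNIV A D] by (auto simp: inv_image_def case_prod_unfold)
  next
    fix x f f' assume "(x, f) \<in> R" "(x, f') \<in> R"
    then obtain A i j D g A' i' j' D' where x: "i \<le> j" "x = (A @ [j, i] @ D, g)" "f = basis_elem x - T A i j D g"
      "i' \<le> j'" "A' @ [j', i'] @ D' = A @ [j, i] @ D" "f' = basis_elem x - T A' i' j' D' g"
      unfolding R_def by (smt (verit) Pair_inject mem_Collect_eq)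
    \<comment> \<open>Primed and unprimed terms change sides, because a reduct is the leading term
      minus \<open>T\<close>.\<close>
    have "T A' i' j' D' g - T A i j D g \<in> lower_relations (A' @ [j', i'] @ D')"
      unfolding T_def by (rule lead_relation_resolvable) fact+
    moreover have "{tt (word_elem A) \<star> (lead_relation i j \<star> basis_elem (D, g)) | A i j D g. i \<le> j \<and> (A @ [j, i] @ D, w) \<in> below}
      \<subseteq> {basis_elem y - e | y e. (y, e) \<in> R \<and> (y, (w, g)) \<in> inv_image below fst}" for w and g :: "'v \<Rightarrow> 'v"
    proof clarify
      fix A i j D g'
      assume *: "i \<le> j" "(A @ [j, i] @ D, w) \<in> below"
      show "\<exists>y e. tt (word_elem A) \<star> (lead_relation i j \<star> basis_elem (D, g')) = basis_elem y - e \<and> (y, e) \<in> R \<and> (y, (w, g)) \<in> inv_image below fst"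
        by (rule exI[of _ "(A @ [j, i] @ D, g')"], rule exI[of _ "basis_elem (A @ [j, i] @ D, g') - T A i j D g'"])
          (use * in \<open>auto simp: T_def R_def\<close>)
    qed
    then have "lower_relations w \<subseteq> skew_scale.span {basis_elem y - e | y e. (y, e) \<in> R \<and> (y, (w, g)) \<in> inv_image below fst}" for w
      unfolding lower_relations_def by (rule skew_scale.span_mono)
    ultimately show "f - f' \<in> skew_scale.span {basis_elem y - e | y e. (y, e) \<in> R \<and> (y, x) \<in> inv_image below fst}"
      using x by auto
  qed blast
  interpret N: Vector_Spaces.linear skew_scale "(*)" N by (rule N)
  show thesis
  proof (rule that[OF N(1)])
    fix A i j D g assume "(i :: 'n) \<le> j"
    then have "N (basis_elem (A @ [j, i] @ D, g) - T A i j D g) = N (basis_elem (A @ [j, i] @ D, g))"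
      by (intro N(2)) (auto simp: R_def)
    then show "N (tt (word_elem A) \<star> (lead_relation i j \<star> basis_elem (D, g))) = 0"
      by (simp add: N.diff T_def)
  next
    fix w g assume "sorted_wrt (<) (w :: 'n list)"
    then have "((w, g), f) \<notin> R" for f
      using not_strictly_sorted_split[of w] by (auto simp: R_def)
    then show "N (basis_elem (w, g)) = c (w, g)" by (rule N(3))
  qed
qed

text \<open>The rules use only part of the generators. The others are multiples: the factor is
  \<open>1 - q i i\<close> on the diagonal, where \<open>\<kappa>\<close> vanishes, and
  \<open>- q i j\<close> for \<open>i > j\<close>, by the symmetry of \<open>q\<close> and
  \<open>\<kappa>\<close>.\<close>

lemma gens_lead_relation:
  shows "\<exists>c r s. r \<le> s \<and> relator i j = skew_scale c (lead_relation r s)"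
proof (cases i j rule: linorder_cases)
  case less
  then show ?thesis using lead_relation_less[OF less] by (intro exI[of _ 1] exI[of _ i] exI[of _ j]) simp
next
  case equal
  have "relator i i = skew_scale (1 - q i i) (lead_relation i i)"
    using form by (intro poly_mapping_eqI)
      (simp add: relator_def lead_relation_same square_def qcomm_def lookup_minus lookup_group_sum lookup_single when_def
        quantum_2_form_iff pm.scale_left_diff_distrib)
  then show ?thesis using equal by blast
next
  case greater
  have qs: "q i j = inverse (q j i)" using q_symmetric[of i j] greater by blast
  then have q: "q i j * q j i = 1" using q_nonzero[of j i] by simp
  have "kap h i j = - q i j * kap h j i" if "h \<in> G" for h
    using form that unfolding quantum_2_form_iff qs by blast
  then have "relator i j = skew_scale (- q i j) (lead_relation j i)"
    by (intro poly_mapping_eqI)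
      (simp add: relator_def lead_relation_less[OF greater] qcomm_def lookup_minus lookup_group_sum lookup_single when_def
        right_diff_distrib mult.assoc[symmetric] q)
  then show ?thesis using greater less_imp_le by blast
qed

text \<open>Vanishing is given for contexts with a word on the left and no group element there. A
  left factor \<open>h\<close> is moved across the relation by \<open>conj_lead_relation\<close> and
  absorbed into the right context.\<close>

lemma functional_kills_ideal:
  assumes lin: "Vector_Spaces.linear skew_scale (*) N"
    and zero: "\<And>A i j D g. i \<le> j \<Longrightarrow> N (tt (word_elem A) \<star> (lead_relation i j \<star> basis_elem (D, g))) = 0"
    and "u \<in> I"
  shows "N u = 0"
proof -
  interpret N: Vector_Spaces.linear skew_scale "(*)" N by (rule lin)
  have lead_relation_zero: "N (tt a \<star> (lead_relation i j \<star> b)) = 0" if "i \<le> j" for i j a b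
  proof (induction a rule: free_alg_induct)
    case (word c A)
    show ?case
    proof (induction b rule: poly_mapping_additive_induct)
      case (single g d)
      show ?case
      proof (induction d rule: free_alg_induct)
        case (word d D)
        show ?case
          using zero[OF that, of A D g]
          by (simp add: skew_scale_single[symmetric] skew_mult_scale_left skew_mult_scale_right N.scale basis_elem_def del: skew_scale_single)
      next
        case (add d d')
        then show ?case by (simp add: single_add skew_mult_add_right N.add)
      qed
    next
      case (add b b')
      then show ?case by (simp add: skew_mult_add_right N.add)
    qed
  next
    case (add a a')
    then show ?case by (simp add: single_add skew_mult_add_left N.add)
  qed
  have single_zero: "N (Poly_Mapping.single h a \<star> (lead_relation i j \<star> b)) = 0"
    if ij: "i \<le> j" and h: "h \<in> G" for i j h a b
  proof -
    obtain m where m: "gg h \<star> lead_relation i j = relator_comb m \<star> gg h" using conj_lead_relation[OF h ij] .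
    have "Poly_Mapping.single h a \<star> (lead_relation i j \<star> b) = (tt a \<star> gg h) \<star> (lead_relation i j \<star> b)"
      by simp
    also have "\<dots> = tt a \<star> ((gg h \<star> lead_relation i j) \<star> b)"
      using mul_assoc[of "tt a" "gg h" "lead_relation i j \<star> b"] mul_assoc[of "gg h" "lead_relation i j" b] h G_id
      by (simp del: skew_mult_single)
    also have "\<dots> = tt a \<star> (relator_comb m \<star> (gg h \<star> b))"
      using I_S[OF relator_comb_I[of m]] by (simp add: m mul_assoc S_carrier)
    also have "N \<dots> \<in> {0}"
    proof -
      have "tt a \<star> (relator_comb m \<star> (gg h \<star> b)) \<in> {u. N u = 0}"
        by (rule relator_comb_mem_subspace[where X = "\<lambda>x. tt a \<star> (x \<star> (gg h \<star> b))"])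
          (simp_all add: skew_scale.subspace_def N.zero N.add N.scale lead_relation_zero skew_mult_add_left skew_mult_add_right
            skew_mult_scale_left skew_mult_scale_right)
      then show ?thesis by simp
    qed
    finally show ?thesis by simp
  qed
  have mul_zero: "N (a \<star> (lead_relation i j \<star> b)) = 0" if "i \<le> j" "a \<in> carrier S" for i j a b
  proof -
    have "N ((\<Sum>h\<in>Poly_Mapping.keys a. Poly_Mapping.single h (Poly_Mapping.lookup a h)) \<star> (lead_relation i j \<star> b)) = 0"
      using that unfolding skew_mult_sum_left N.sum
      by (intro sum.neutral) (auto simp: S_carrier intro!: single_zero)
    then show ?thesis by (simp add: poly_mapping_sum_single)
  qed
  \<comment> \<open>The largest two-sided ideal inside the kernel of \<open>N\<close>; it is enough
    to find the generators in it.\<close>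
  define J where "J = {x \<in> carrier S. \<forall>a\<in>carrier S. \<forall>b\<in>carrier S. N (a \<star> (x \<star> b)) = 0}"
  have "ideal J S"
  proof (rule idealI[OF ring_S])
    show "subgroup J (add_monoid S)"
    proof (rule group.subgroupI[OF abelian_group.a_group[OF ring.is_abelian_group[OF ring_S]]])
      show "J \<subseteq> carrier (add_monoid S)" by (auto simp: J_def)
      show "J \<noteq> {}" by (auto simp: J_def S_zero N.zero intro!: exI[of _ 0])
      fix x y assume x: "x \<in> J" and y: "y \<in> J"
      show "inv\<^bsub>add_monoid S\<^esub> x \<in> J"
        using x S_a_inv[of x] by (auto simp: J_def a_inv_def S_uminus skew_mult_uminus_left skew_mult_uminus_right N.neg)
      show "x \<otimes>\<^bsub>add_monoid S\<^esub> y \<in> J"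
        using x y by (auto simp: J_def S_add skew_mult_add_left skew_mult_add_right N.add)
    qed
    show "y \<otimes>\<^bsub>S\<^esub> x \<in> J" "x \<otimes>\<^bsub>S\<^esub> y \<in> J" if "x \<in> J" "y \<in> carrier S" for x y
    proof -
      have "a \<star> ((y \<star> x) \<star> b) = (a \<star> y) \<star> (x \<star> b)" "a \<star> ((x \<star> y) \<star> b) = a \<star> (x \<star> (y \<star> b))"
        if "a \<in> carrier S" for a b
        using that \<open>x \<in> J\<close> \<open>y \<in> carrier S\<close> by (simp_all add: J_def mul_assoc S_carrier)
      then show "y \<otimes>\<^bsub>S\<^esub> x \<in> J" "x \<otimes>\<^bsub>S\<^esub> y \<in> J"
        using that by (simp_all add: J_def S_mul)
    qed
  qed
  moreover have "skew_scale c (lead_relation i j) \<in> J" if "i \<le> j" for c i j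
    using that by (simp add: J_def S_skew_scale S_lead_relation skew_mult_scale_left skew_mult_scale_right N.scale mul_zero)
  then have "relator i j \<in> J" "square i \<in> J" for i j
    using gens_lead_relation[of i j] lead_relation_same[of i] skew_scale.scale_one[of "square i"] by (metis, metis order_refl)
  then have "{relator i j | i j. True} \<union> {square i | i. True} \<subseteq> J"
    by blast
  ultimately have "I \<subseteq> J"
    unfolding I_eq by (rule ring.genideal_minimal[OF ring_S])
  then have "N (gg id \<star> (u \<star> gg id)) = 0"
    using \<open>u \<in> I\<close> S_single[OF G_id, of 1] unfolding J_def by blast
  then show ?thesis by simp
qed

lemma normal_in_ideal_zero: "\<forall>u\<in>I \<inter> normal_forms. u = 0"
proof
  fix u assume u: "u \<in> I \<inter> normal_forms"
  show "u = 0"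
  proof (intro poly_mapping_eqI[of u] free_alg_eqI)
    fix g w
    show "Poly_Mapping.lookup (Poly_Mapping.lookup u g) (Fmon w) = Poly_Mapping.lookup (Poly_Mapping.lookup 0 g) (Fmon w)"
    proof (cases "sorted_wrt (<) w")
      case False
      then show ?thesis using u by (auto simp: normal_forms_def)
    next
      case True
      obtain N where N: "Vector_Spaces.linear skew_scale (*) N"
        "\<And>A i j D g. i \<le> j \<Longrightarrow> N (tt (word_elem A) \<star> (lead_relation i j \<star> basis_elem (D, g))) = 0"
        "\<And>x h. sorted_wrt (<) x \<Longrightarrow> N (basis_elem (x, h)) = (if (x, h) = (w, g) then 1 else 0)"
        using normal_functional[of "\<lambda>y. if y = (w, g) then 1 else 0"] by metis
      interpret N: Vector_Spaces.linear skew_scale "(*)" N by (rule N)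
      let ?T = "{u. N u = Poly_Mapping.lookup (Poly_Mapping.lookup u g) (Fmon w)}"
      have T: "skew_scale.subspace ?T"
        by (auto simp: skew_scale.subspace_def N.zero N.add N.scale lookup_add)
      \<comment> \<open>On reducible words \<open>N\<close> need not agree with the coefficient at
        \<open>(w, g)\<close>, but these do not occur in \<open>u\<close>.\<close>
      have "skew_scale (Poly_Mapping.lookup (Poly_Mapping.lookup u h) x) (basis_elem (letters x, h)) \<in> ?T" for h x
      proof (cases "sorted_wrt (<) (letters x)")
        case True
        then have "basis_elem (letters x, h) \<in> ?T" by (simp add: N(3) lookup_basis_elem)
        then show ?thesis by (rule skew_scale.subspace_scale[OF T])
      next
        case False
        then have "Poly_Mapping.lookup (Poly_Mapping.lookup u h) x = 0" using u by (cases x) (auto simp: normal_forms_def)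
        then show ?thesis using skew_scale.subspace_0[OF T] by simp
      qed
      moreover have "skew_scale (Poly_Mapping.lookup (Poly_Mapping.lookup u h) x) (basis_elem (letters x, h))
          = Poly_Mapping.single h (Poly_Mapping.single x (Poly_Mapping.lookup (Poly_Mapping.lookup u h) x))" for h x
        by (simp add: basis_elem_def word_elem_def)
      ultimately have "(\<Sum>h\<in>Poly_Mapping.keys u. Poly_Mapping.single h (\<Sum>x\<in>Poly_Mapping.keys (Poly_Mapping.lookup u h).
          Poly_Mapping.single x (Poly_Mapping.lookup (Poly_Mapping.lookup u h) x))) \<in> ?T"
        unfolding single_sum by (intro skew_scale.subspace_sum[OF T]) (simp only:)
      then have "u \<in> ?T" by (simp add: poly_mapping_sum_single)
      then show ?thesis using functional_kills_ideal[OF N(1,2)] u by simp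
    qed
  qed
qed

end

theorem theorem2p8:
  fixes scale :: "'k::field \<Rightarrow> 'v::ab_group_add \<Rightarrow> 'v"  (infixr \<open>*s\<close> 75)
    and v :: "'n::{finite,linorder} \<Rightarrow> 'v"
    and G :: "('v \<Rightarrow> 'v) set"
    and q :: "'n \<Rightarrow> 'n \<Rightarrow> 'k"
    and \<kappa> :: "'v \<Rightarrow> 'v \<Rightarrow> ('v \<Rightarrow> 'v) \<Rightarrow>\<^sub>0 'k"
  assumes "CHAR('k) \<noteq> 2"
    and "vector_space scale"
    and "vs_basis scale v"
    and "subgroup G (GL scale)" and "finite G"
    and "\<not> CHAR('k) dvd card G"
    and "\<And>i j. q i j \<noteq> 0"
    and "bilinear_into_group_algebra scale G \<kappa>"
  shows "truncated_quantum_drinfeld_hecke scale v G q \<kappa> \<longleftrightarrow>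
    (acts_on_qext_by_automorphisms scale v q G \<and> (\<forall>i j. i \<noteq> j \<longrightarrow> q i j = inverse (q j i))) \<and>
    quantum_2_form v q \<kappa> \<and>
    (\<forall>h\<in>G. \<forall>i j k. i < j \<and> j < k \<longrightarrow>
       0 = form_comp v \<kappa> h i j *s ((q i k * q j k) *s h (v k) - v k)
         + form_comp v \<kappa> h i k *s (q j k *s v j - q i j *s h (v j))
         + form_comp v \<kappa> h j k *s (h (v i) - (q i j * q i k) *s v i)) \<and>
    (\<forall>g\<in>G. \<forall>h\<in>G. \<forall>r s. r < s \<longrightarrow>
       form_comp v \<kappa> (inv\<^bsub>GL scale\<^esub> h \<otimes>\<^bsub>GL scale\<^esub> g \<otimes>\<^bsub>GL scale\<^esub> h) r s
         = (\<Sum>(i, j) | i < j. qdet scale v q r s i j h * form_comp v \<kappa> g i j)) \<and>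
    (\<forall>h\<in>G. \<forall>i j. i < j \<longrightarrow>
       0 = form_comp v \<kappa> h i j *s q i j *s v i + form_comp v \<kappa> h i j *s h (v i) \<and>
       0 = form_comp v \<kappa> h i j *s q i j *s h (v j) + form_comp v \<kappa> h i j *s v j) \<and>
    (\<forall>g\<in>G. \<forall>h\<in>G. \<forall>r.
       (\<Sum>(i, j) | i < j. entry scale v g i r * entry scale v g j r * form_comp v \<kappa> h i j) = 0)"
    (is "?pbw \<longleftrightarrow> (?acts \<and> ?sym) \<and> ?form \<and> ?iii \<and> ?iv \<and> ?v \<and> ?vi")
proof -
  interpret tqdh_data scale v G q \<kappa>
    by (intro tqdh_data.intro assms)
  show ?thesis
  proof
    assume ?pbw
    then have PBW: "\<forall>u\<in>I \<inter> normal_forms. u = 0" by (simp only: pbw_iff_no_normal)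
    have ?acts by (rule preserves_qext_imp_acts[OF pbw_imp_preserves_qext[OF PBW]])
    moreover have ?sym using pbw_imp_q_symmetric[OF PBW] by blast
    moreover have ?form by (rule pbw_imp_quantum_2_form[OF PBW])
    moreover have ?iii
      by (intro ballI allI impI pbw_imp_overlap_vec[OF PBW, unfolded overlap_vec_def, symmetric])
    moreover have ?iv
      by (intro ballI allI impI pbw_imp_equivariance(1)[OF PBW])
    moreover have ?v
      by (intro ballI allI impI conjI pbw_imp_left_right[OF PBW, symmetric])
    moreover have ?vi
      by (intro ballI allI pbw_imp_equivariance(2)[OF PBW])
    ultimately show "(?acts \<and> ?sym) \<and> ?form \<and> ?iii \<and> ?iv \<and> ?v \<and> ?vi" by (intro conjI)
  next
    assume R: "(?acts \<and> ?sym) \<and> ?form \<and> ?iii \<and> ?iv \<and> ?v \<and> ?vi"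
    note acts = R[THEN conjunct1, THEN conjunct1] and sym = R[THEN conjunct1, THEN conjunct2]
      and R2 = R[THEN conjunct2]
    note form = R2[THEN conjunct1] and R3 = R2[THEN conjunct2]
    note iii = R3[THEN conjunct1] and R4 = R3[THEN conjunct2]
    note iv = R4[THEN conjunct1] and R5 = R4[THEN conjunct2]
    note v = R5[THEN conjunct1] and vi = R5[THEN conjunct2]
    interpret tqdh_conditions scale v G q \<kappa>
    proof
      show "q i j = inverse (q j i)" if "i \<noteq> j" for i j using sym that by blast
      show "quantum_2_form v q \<kappa>" by (rule form)
      show preserves_qext by (rule acts_imp_preserves_qext[OF acts sym])
      show "overlap_vec h i j k = 0" if "h \<in> G" "i < j" "j < k" for h i j k
        unfolding overlap_vec_def using iii[rule_format, OF that(1) conjI, OF that(2,3), symmetric] .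
      show "kap (inv\<^bsub>GL scale\<^esub> h \<otimes>\<^bsub>GL scale\<^esub> g \<otimes>\<^bsub>GL scale\<^esub> h) r s
         = (\<Sum>(i, j) | i < j. qdet scale v q r s i j h * kap g i j)" if "g \<in> G" "h \<in> G" "r < s" for g h r s
        by (rule iv[rule_format, OF that])
      show "kap h i j *s q i j *s v i + kap h i j *s h (v i) = 0"
        "kap h i j *s q i j *s h (v j) + kap h i j *s v j = 0" if "h \<in> G" "i < j" for h i j
        using v[rule_format, OF that, THEN conjunct1, symmetric] v[rule_format, OF that, THEN conjunct2, symmetric]
        by this+
      show "(\<Sum>(i, j) | i < j. ent h i r * ent h j r * kap g i j) = 0" if "g \<in> G" "h \<in> G" for g h r
        \<comment> \<open>The locale names the acting element \<open>h\<close> and the component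
          \<open>g\<close>, condition (vi) the other way round.\<close>
        by (rule vi[rule_format, OF that(2,1)])
    qed
    show ?pbw unfolding pbw_iff_no_normal by (rule normal_in_ideal_zero)
  qed
qed

end
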